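(* Let $d\ge3$ and let $K\subset\mathbb R^d$ be a compact non-polar set with $\mathbb R^d\setminus\Omega_K=K^r$. Then, uniformly for $x\in\mathbb R^d$, as $t\to\infty$ and $|x|/t\to0$, $$E_0\big[\mathrm{vol}_d(S_K(t))\,\big|\,B_t=x\big]\sim \mathrm{Cap}(K)\,t .$$
   Context: $B_t$ is a standard Brownian motion in $\mathbb R^d$, $P_y$ and $E_y$ its law and expectation when started at $y$; conditioning on $B_t=x$ refers to the Brownian bridge from $0$ to $x$ of length $t$. $\sigma_D=\inf\{t>0:B_t\in D\}$. $K$ is non-polar if $P_y[\sigma_K<\infty]>0$ for some $y$; $K^r=\{y\in K:P_y[\sigma_K=0]=1\}$; $\Omega_K=\{y:P_y[\sigma_{\partial U(R)}<\sigma_K]>0\}$ for any $R$ with $K\subset U(R)$, $U(R)$ the open ball of radius $R$ about the origin. $S_K(t)=\{z\in\mathbb R^d:z-B_s\in K\text{ for some }s\in[0,t)\}$ is the Wiener sausage; $\mathrm{vol}_d$ is Lebesgue measure. With $\nu=\frac d2-1$ and $G^{(d)}(1)=\Gamma(\nu)/(2\pi^{\nu+1})$, $\mathrm{Cap}(K)=\frac1{G^{(d)}(1)}\lim_{|y|\to\infty}|y|^{d-2}P_y[\sigma_K<\infty]$. $f\sim g$ means $f/g\to1$. *)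

theory Defs
  imports "HOL-Probability.Probability"
begin

text \<open>
  \<open>\<real>\<^sup>d\<close> is rendered as an arbitrary Euclidean space \<open>'a\<close> with \<open>d = DIM('a)\<close>. Only times \<open>t \<ge> 0\<close>
  are meaningful. All paths, not just almost all, are required to be continuous, so that the
  events and random variables below are measurable without completing \<open>M\<close>.
\<close>

locale standard_brownian_motion = prob_space M
  for M :: "'w measure" and B :: "real \<Rightarrow> 'w \<Rightarrow> 'a::euclidean_space" +
  assumes measurable_BM: "\<And>t. t \<ge> 0 \<Longrightarrow> B t \<in> borel_measurable M"
    and start_BM: "\<And>\<omega>. \<omega> \<in> space M \<Longrightarrow> B 0 \<omega> = 0"
    and continuous_BM: "\<And>\<omega>. \<omega> \<in> space M \<Longrightarrow> continuous_on {0..} (\<lambda>t. B t \<omega>)"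
    and increments_normal: "\<And>s t. 0 \<le> s \<Longrightarrow> s < t \<Longrightarrow>
      distributed M lborel (\<lambda>\<omega>. B t \<omega> - B s \<omega>)
        (\<lambda>z. ennreal (\<Prod>b\<in>Basis. normal_density 0 (sqrt (t - s)) (z \<bullet> b)))"
    and increments_indep: "\<And>(n::nat) \<tau>. 0 \<le> \<tau> 0 \<Longrightarrow> (\<And>i. i < n \<Longrightarrow> \<tau> i \<le> \<tau> (Suc i)) \<Longrightarrow>
      indep_vars (\<lambda>_. borel) (\<lambda>i \<omega>. B (\<tau> (Suc i)) \<omega> - B (\<tau> i) \<omega>) {..<n}"

text \<open>The law \<open>P\<^sub>y\<close> is that of the translated motion \<open>y + B\<close>; \<open>Q\<close> is a property of paths.\<close>

definition prob_from ::
    "'w measure \<Rightarrow> (real \<Rightarrow> 'w \<Rightarrow> 'a::euclidean_space) \<Rightarrow> 'a \<Rightarrow> ((real \<Rightarrow> 'a) \<Rightarrow> bool) \<Rightarrow> real" where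
  "prob_from M B y Q = measure M {\<omega> \<in> space M. Q (\<lambda>s. y + B s \<omega>)}"

definition hitting_time :: "'a set \<Rightarrow> (real \<Rightarrow> 'a) \<Rightarrow> ereal" where
  "hitting_time D w = Inf {ereal t | t. t > 0 \<and> w t \<in> D}"

definition nonpolar ::
    "'w measure \<Rightarrow> (real \<Rightarrow> 'w \<Rightarrow> 'a::euclidean_space) \<Rightarrow> 'a set \<Rightarrow> bool" where
  "nonpolar M B K \<longleftrightarrow> (\<exists>y. prob_from M B y (\<lambda>w. hitting_time K w < \<infinity>) > 0)"

definition regular_points ::
    "'w measure \<Rightarrow> (real \<Rightarrow> 'w \<Rightarrow> 'a::euclidean_space) \<Rightarrow> 'a set \<Rightarrow> 'a set" where
  "regular_points M B K = {y \<in> K. prob_from M B y (\<lambda>w. hitting_time K w = 0) = 1}"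

text \<open>For \<open>K \<subseteq> ball 0 R\<close> this set does not depend on \<open>R\<close>.\<close>

definition Omega ::
    "'w measure \<Rightarrow> (real \<Rightarrow> 'w \<Rightarrow> 'a::euclidean_space) \<Rightarrow> real \<Rightarrow> 'a set \<Rightarrow> 'a set" where
  "Omega M B R K =
     {y. prob_from M B y (\<lambda>w. hitting_time (frontier (ball 0 R)) w < hitting_time K w) > 0}"

definition Green_one :: "nat \<Rightarrow> real" where
  "Green_one d = (let \<nu> = real d / 2 - 1 in Gamma \<nu> / (2 * pi powr (\<nu> + 1)))"

definition Cap ::
    "'w measure \<Rightarrow> (real \<Rightarrow> 'w \<Rightarrow> 'a::euclidean_space) \<Rightarrow> 'a set \<Rightarrow> real" where
  "Cap M B K = 1 / Green_one DIM('a) *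
     Lim at_infinity
       (\<lambda>y. norm y ^ (DIM('a) - 2) * prob_from M B y (\<lambda>w. hitting_time K w < \<infinity>))"

definition wiener_sausage :: "'a::euclidean_space set \<Rightarrow> real \<Rightarrow> (real \<Rightarrow> 'a) \<Rightarrow> 'a set" where
  "wiener_sausage K t w = {z. \<exists>s\<in>{0..<t}. z - w s \<in> K}"

text \<open>
  The Brownian bridge from \<open>0\<close> to \<open>x\<close> of length \<open>t > 0\<close>, on the time interval \<open>[0, t]\<close>.
  For \<open>x = 0\<close> it is independent of \<open>B t\<close>, and \<open>x = B t \<omega>\<close> gives back \<open>B\<close>, so its laws,
  indexed by \<open>x\<close>, are the weakly continuous version of the conditional law of
  \<open>(B s)\<^bsub>0 \<le> s \<le> t\<^esub>\<close> given \<open>B t = x\<close>.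
\<close>

definition brownian_bridge ::
    "(real \<Rightarrow> 'w \<Rightarrow> 'a::euclidean_space) \<Rightarrow> real \<Rightarrow> 'a \<Rightarrow> real \<Rightarrow> 'w \<Rightarrow> 'a" where
  "brownian_bridge B t x s \<omega> = B s \<omega> + (s / t) *\<^sub>R (x - B t \<omega>)"

text \<open>\<open>E\<^sub>0[F(B) | B t = x]\<close> for a functional \<open>F\<close> depending only on the path up to time \<open>t\<close>.\<close>

definition bridge_expectation ::
    "'w measure \<Rightarrow> (real \<Rightarrow> 'w \<Rightarrow> 'a::euclidean_space) \<Rightarrow> real \<Rightarrow> 'a \<Rightarrow> ((real \<Rightarrow> 'a) \<Rightarrow> real) \<Rightarrow> real" where
  "bridge_expectation M B t x F = (\<integral>\<omega>. F (\<lambda>s. brownian_bridge B t x s \<omega>) \<partial>M)"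

end

theory Submission
  imports Defs
begin

text \<open>
  Cut \<open>[0, t]\<close> into unit intervals and charge each point of the sausage to the last interval in
  which it is covered. Integrating Girsanov's formula over all constant drifts shows that the part of
  a bridge over a segment of length \<open>k\<close> is a mixture of bridges of length \<open>k\<close>, whose endpoint is
  Gaussian with mean \<open>k x / t\<close> and variance \<open>k (1 - k / t)\<close>; as \<open>t \<rightarrow> \<infinity>\<close> and \<open>|x| / t \<rightarrow> 0\<close> this mixture
  tends to Brownian motion on \<open>[0, k]\<close>. The density of the mixture is at most \<open>(1 - k / t)^(-d/2)\<close> times
  that of Brownian motion with drift \<open>x / t\<close>, for which the expected volume covered in two unit
  intervals at distance \<open>j\<close> is of order \<open>j^(-d/2)\<close>. This is summable for \<open>d \<ge> 3\<close>, so the expected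
  volume divided by \<open>t\<close> tends to the integral over \<open>y\<close> of the probability \<open>\<phi>(y)\<close> that the motion from
  \<open>y\<close> visits \<open>K\<close> during \<open>[0, 1]\<close> and never afterwards.

  Decomposing at the integer part of the last visit, the probability to hit \<open>K\<close> from \<open>y\<close> is \<open>\<phi>(y)\<close> plus
  the integral of \<open>\<Sum>i\<ge>1. heat i (z - y)\<close> against \<open>\<phi>(z) dz\<close>. The sum behaves like the Green
  function at infinity, whence the integral of \<open>\<phi>\<close> is the capacity; it is positive because \<open>K\<close> is non-polar.
\<close>

text \<open>Expectation is linear, so only the law of short stretches of the bridge matters, never
  the dependence between distant stretches. The look-ahead after a visit is cut off at a finite
  \<open>m\<close>, which makes the event local to a segment of length \<open>1 + m\<close>; the law
  of such a segment does not depend on its position, and limits in \<open>t\<close> are taken with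
  \<open>m\<close> fixed. The price is that a point may be charged several times, and the pair
  estimate bounds this overcounting. The density comparison behind it degenerates when a segment
  fills almost all of \<open>[0, t]\<close>, so the lower bound gives up the last fraction
  \<open>\<eta>\<close> of the time.

  Uniformity in \<open>x\<close> comes from the fact that \<open>x\<close> enters only through the
  drift \<open>x / t\<close>; what remains is continuity at drift zero, by dominated convergence.
  The majorant needs polynomial growth of bridge means in the endpoint, which is why hitting
  probabilities are given a high power of decay in the starting point.

  All decompositions are made at integer times, so the Markov property is needed at fixed times
  only.\<close>

abbreviation path_space :: "(real \<Rightarrow> 'a::euclidean_space) measure" where
  "path_space \<equiv> PiM {0..} (\<lambda>_. borel)"

section \<open>Laws of path-valued random variables\<close>

text \<open>Cut down to \<open>{0..}\<close> because the points of \<open>path_space\<close> are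
  functions that are \<open>undefined\<close> off the index set.\<close>

definition traj :: "(real \<Rightarrow> 'w \<Rightarrow> 'a) \<Rightarrow> 'w \<Rightarrow> real \<Rightarrow> 'a" where
  "traj X \<omega> = (\<lambda>s\<in>{0..}. X s \<omega>)"

lemma traj_apply [simp]: "0 \<le> s \<Longrightarrow> traj X \<omega> s = X s \<omega>"
  by (simp add: traj_def)

lemma measurable_traj [measurable (raw)]:
  "(\<And>s. 0 \<le> s \<Longrightarrow> X s \<in> borel_measurable N) \<Longrightarrow> traj X \<in> measurable N path_space"
  unfolding traj_def by (rule measurable_restrict) auto

definition increments :: "nat \<Rightarrow> (nat \<Rightarrow> real) \<Rightarrow> (real \<Rightarrow> 'w \<Rightarrow> 'a::real_vector) \<Rightarrow> 'w \<Rightarrow> nat \<Rightarrow> 'a" where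
  "increments n \<tau> X \<omega> = (\<lambda>i\<in>{..<n}. X (\<tau> (Suc i)) \<omega> - X (\<tau> i) \<omega>)"

lemma law_eqI:
  fixes X :: "real \<Rightarrow> 'w \<Rightarrow> 'a::euclidean_space" and X' :: "real \<Rightarrow> 'v \<Rightarrow> 'a"
  assumes fin: "finite_measure N" "finite_measure N'"
    and X: "\<And>s. 0 \<le> s \<Longrightarrow> X s \<in> borel_measurable N"
    and X': "\<And>s. 0 \<le> s \<Longrightarrow> X' s \<in> borel_measurable N'"
    and X0: "\<And>\<omega>. \<omega> \<in> space N \<Longrightarrow> X 0 \<omega> = 0"
    and X'0: "\<And>\<omega>. \<omega> \<in> space N' \<Longrightarrow> X' 0 \<omega> = 0"
    and eq: "\<And>n \<tau> A. \<tau> 0 = 0 \<Longrightarrow> (\<And>i. i < n \<Longrightarrow> \<tau> i \<le> \<tau> (Suc i)) \<Longrightarrow>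
      (\<And>i. i \<le> n \<Longrightarrow> 0 \<le> \<tau> i) \<Longrightarrow> (\<And>i. A i \<in> sets borel) \<Longrightarrow>
      emeasure N {\<omega>\<in>space N. \<forall>i<n. X (\<tau> (Suc i)) \<omega> - X (\<tau> i) \<omega> \<in> A i} =
      emeasure N' {\<omega>\<in>space N'. \<forall>i<n. X' (\<tau> (Suc i)) \<omega> - X' (\<tau> i) \<omega> \<in> A i}"
  shows "distr N path_space (traj X) = distr N' path_space (traj X')"
proof (rule measure_eqI_PiM_infinite)
  show "finite_measure (distr N path_space (traj X))"
    by (intro finite_measure.finite_measure_distr fin measurable_traj X)
  fix A :: "real \<Rightarrow> 'a set" and J :: "real set"
  assume J: "finite J" "J \<subseteq> {0..}" and A: "\<And>i. i \<in> J \<Longrightarrow> A i \<in> sets borel"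
  define xs where "xs = sorted_list_of_set J"
  define n where "n = length xs"
  \<comment> \<open>The grid is \<open>J\<close> in increasing order with \<open>0\<close> put in
    front, hence the shift by one. If \<open>0 \<in> J\<close>, the first increment is trivial, so
    grids may only be required to increase weakly.\<close>
  define \<tau> where "\<tau> i = (if i = 0 then 0 else xs ! (i - 1))" for i
  have setxs: "set xs = J" and sxs: "sorted xs" using J by (auto simp: xs_def)
  have xs0: "0 \<le> xs ! i" if "i < n" for i
    using that J setxs nth_mem[of i xs] unfolding n_def by auto
  have \<tau>0: "\<tau> 0 = 0" by (simp add: \<tau>_def)
  have \<tau>pos: "0 \<le> \<tau> i" if "i \<le> n" for i
    using that xs0 by (cases i) (auto simp: \<tau>_def)
  have \<tau>mono: "\<tau> i \<le> \<tau> (Suc i)" if "i < n" for i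
    using that xs0 sxs by (cases i) (auto simp: \<tau>_def n_def sorted_nth_mono)
  define P where "P = PiM {..<n} (\<lambda>_. borel :: 'a measure)"
  have m: "increments n \<tau> X \<in> measurable N P" "increments n \<tau> X' \<in> measurable N' P" 
    unfolding P_def increments_def by (auto intro!: measurable_restrict borel_measurable_diff X X' \<tau>pos)
  have law: "distr N P (increments n \<tau> X) = distr N' P (increments n \<tau> X')"
    unfolding P_def
  proof (rule measure_eqI_PiM_infinite)
    show "finite_measure (distr N (PiM {..<n} (\<lambda>_. borel)) (increments n \<tau> X))"
      using m(1) unfolding P_def by (intro finite_measure.finite_measure_distr fin)
    fix C :: "nat \<Rightarrow> 'a set" and I :: "nat set"
    assume I: "finite I" "I \<subseteq> {..<n}" and C: "\<And>i. i \<in> I \<Longrightarrow> C i \<in> sets borel"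
    let ?E = "prod_emb {..<n} (\<lambda>_. borel) I (Pi\<^sub>E I C)"
    \<comment> \<open>A rectangle that constrains only the increments in \<open>I\<close> is
      completed by \<open>UNIV\<close>, which brings it into the form of the hypothesis
      \<open>eq\<close>.\<close>
    define C' where "C' i = (if i \<in> I then C i else UNIV)" for i
    have C': "C' i \<in> sets borel" for i using C by (auto simp: C'_def)
    have E: "?E \<in> sets P" unfolding P_def using I C by (auto intro!: sets_PiM_I)
    have pre: "increments n \<tau> Y -` ?E \<inter> S = {\<omega>\<in>S. \<forall>i<n. Y (\<tau> (Suc i)) \<omega> - Y (\<tau> i) \<omega> \<in> C' i}" for Y and S :: "'u set"
      using I by (auto simp: increments_def prod_emb_def C'_def PiE_iff subset_eq restrict_def extensional_def split: if_splits)
    show "emeasure (distr N (PiM {..<n} (\<lambda>_. borel)) (increments n \<tau> X)) ?E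
        = emeasure (distr N' (PiM {..<n} (\<lambda>_. borel)) (increments n \<tau> X')) ?E"
      using E m unfolding P_def
      by (simp add: emeasure_distr pre eq[OF \<tau>0 \<tau>mono \<tau>pos C'])
  qed simp_all
  \<comment> \<open>A condition on partial sums is not a rectangle in the increments; this is where
    equality of the full increment laws is used.\<close>
  define E where "E = {d \<in> space P. \<forall>i\<in>{..<n}. (\<Sum>l\<in>{..i}. d l) \<in> A (xs ! i)}"
  have [measurable]: "A (xs ! i) \<in> sets borel" if "i < n" for i
    using that setxs A nth_mem[of i xs] unfolding n_def by auto
  have Em: "E \<in> sets P"
    unfolding E_def P_def
  proof (intro sets.sets_Collect_finite_All )
    fix i assume i: "i \<in> {..<n}"
    have "(\<lambda>d. \<Sum>l\<in>{..i}. d l) \<in> borel_measurable (PiM {..<n} (\<lambda>_. borel :: 'a measure))"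
      using i by (intro borel_measurable_sum measurable_component_singleton) auto
    from measurable_sets[OF this, of "A (xs ! i)"] i
    show "{d \<in> space (PiM {..<n} (\<lambda>_. borel :: 'a measure)). (\<Sum>l\<in>{..i}. d l) \<in> A (xs ! i)} \<in> sets (PiM {..<n} (\<lambda>_. borel))"
      by (auto simp: vimage_def Int_def conj_commute)
  qed auto
  have tele: "(\<Sum>l\<in>{..i}. increments n \<tau> Y \<omega> l) = Y (xs ! i) \<omega>" if "i < n" "Y 0 \<omega> = 0" for Y :: "real \<Rightarrow> 'u \<Rightarrow> 'a" and i \<omega>
  proof -
    have "(\<Sum>l\<in>{..i}. increments n \<tau> Y \<omega> l) = (\<Sum>l\<in>{..<Suc i}. Y (\<tau> (Suc l)) \<omega> - Y (\<tau> l) \<omega>)"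
      using that by (intro sum.cong) (auto simp: increments_def)
    also have "\<dots> = Y (\<tau> (Suc i)) \<omega> - Y (\<tau> 0) \<omega>"
      by (rule sum_lessThan_telescope)
    finally show ?thesis using that by (simp add: \<tau>_def)
  qed
  have sp: "increments n \<tau> Y \<omega> \<in> space P" for Y :: "real \<Rightarrow> 'u \<Rightarrow> 'a" and \<omega>
    by (simp add: P_def space_PiM increments_def)
  have ball: "(\<forall>j\<in>J. Q j) \<longleftrightarrow> (\<forall>i<n. Q (xs ! i))" for Q
    unfolding setxs[symmetric] n_def by (metis in_set_conv_nth nth_mem)
  have pre: "traj Y -` prod_emb {0..} (\<lambda>_. borel) J (Pi\<^sub>E J A) \<inter> S = increments n \<tau> Y -` E \<inter> S"
    if "\<And>\<omega>. \<omega> \<in> S \<Longrightarrow> Y 0 \<omega> = 0" for Y :: "real \<Rightarrow> 'u \<Rightarrow> 'a" and S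
  proof -
    have "traj Y -` prod_emb {0..} (\<lambda>_. borel) J (Pi\<^sub>E J A) \<inter> S = {\<omega>\<in>S. \<forall>j\<in>J. Y j \<omega> \<in> A j}"
      using J by (auto simp: traj_def prod_emb_def PiE_iff subset_eq)
    also have "\<dots> = increments n \<tau> Y -` E \<inter> S"
      unfolding ball E_def using that sp by (auto simp: tele)
    finally show ?thesis .
  qed
  have F: "prod_emb {0..} (\<lambda>_. borel) J (Pi\<^sub>E J A) \<in> sets path_space"
    using J A by (auto intro!: sets_PiM_I)
  have "emeasure (distr N path_space (traj X)) (prod_emb {0..} (\<lambda>_. borel) J (Pi\<^sub>E J A)) = emeasure (distr N P (increments n \<tau> X)) E"
    using F X X0 Em m by (simp add: emeasure_distr measurable_traj pre)
  also have "\<dots> = emeasure (distr N' path_space (traj X')) (prod_emb {0..} (\<lambda>_. borel) J (Pi\<^sub>E J A))"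
    unfolding law using F X' X'0 Em m by (simp add: emeasure_distr measurable_traj pre)
  finally show "emeasure (distr N path_space (traj X)) (prod_emb {0..} (\<lambda>_. borel) J (Pi\<^sub>E J A))
    = emeasure (distr N' path_space (traj X')) (prod_emb {0..} (\<lambda>_. borel) J (Pi\<^sub>E J A))" .
qed simp_all

section \<open>The heat kernel and the Markov property\<close>

definition heat :: "real \<Rightarrow> 'a::euclidean_space \<Rightarrow> real" where
  "heat s z = exp (- (norm z)\<^sup>2 / (2 * s)) / sqrt (2 * pi * s) ^ DIM('a)"

lemma heat_nonneg [simp]: "0 \<le> s \<Longrightarrow> 0 \<le> heat s z"
  by (simp add: heat_def)

lemma heat_minus [simp]: "heat s (- z) = heat s z"
  by (simp add: heat_def)

lemma heat_commute: "heat s (z - y) = heat s (y - z)"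
  by (simp add: heat_def norm_minus_commute)

lemma measurable_heat [measurable]: "heat s \<in> borel_measurable borel"
  unfolding heat_def by measurable

lemma norm_Basis_sum: "(norm (z::'a::euclidean_space))\<^sup>2 = (\<Sum>b\<in>Basis. (z \<bullet> b)\<^sup>2)"
  by (subst power2_norm_eq_inner, subst euclidean_inner) (simp add: power2_eq_square)

lemma prod_normal_density:
  fixes z :: "'a::euclidean_space"
  assumes "0 < s"
  shows "(\<Prod>b\<in>Basis. normal_density 0 (sqrt s) (z \<bullet> b)) = heat s z"
proof -
  have "(\<Prod>b\<in>Basis. normal_density 0 (sqrt s) (z \<bullet> b)) =
      (\<Prod>b\<in>(Basis::'a set). 1 / sqrt (2 * pi * s)) * exp (\<Sum>b\<in>Basis. - (z \<bullet> b)\<^sup>2 / (2 * s))"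
    using assms by (simp only: normal_density_def prod.distrib exp_sum finite_Basis) simp
  also have "(\<Sum>b\<in>Basis. - (z \<bullet> b)\<^sup>2 / (2 * s)) = - (norm z)\<^sup>2 / (2 * s)"
    by (simp add: norm_Basis_sum sum_negf sum_divide_distrib[symmetric])
  finally show ?thesis
    by (simp add: heat_def power_divide)
qed

text \<open>Completing the square. The exponential factor is the Girsanov density of the constant
  drift \<open>v\<close> at time \<open>s\<close>.\<close>

lemma heat_shift:
  assumes "0 < s"
  shows "heat s (z - s *\<^sub>R v) = heat s z * exp (v \<bullet> z - s * (norm v)\<^sup>2 / 2)"
proof -
  have "(norm (z - s *\<^sub>R v))\<^sup>2 = (norm z)\<^sup>2 - 2 * s * (v \<bullet> z) + s\<^sup>2 * (norm v)\<^sup>2"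
    unfolding power2_norm_eq_inner
    by (simp add: inner_diff_left inner_diff_right inner_commute[of z v] power2_eq_square
        algebra_simps)
  then have "- (norm (z - s *\<^sub>R v))\<^sup>2 / (2 * s) = - (norm z)\<^sup>2 / (2 * s) + (v \<bullet> z - s * (norm v)\<^sup>2 / 2)"
    using assms by (simp add: diff_divide_distrib add_divide_distrib power2_eq_square)
  then show ?thesis by (simp add: heat_def flip: exp_add)
qed

lemma nn_integral_lborel_shift:
  fixes f :: "'a::euclidean_space \<Rightarrow> ennreal"
  assumes [measurable]: "f \<in> borel_measurable borel"
  shows "(\<integral>\<^sup>+z. f (a + z) \<partial>lborel) = (\<integral>\<^sup>+z. f z \<partial>lborel)"
proof -
  have "(\<integral>\<^sup>+z. f z \<partial>lborel) = (\<integral>\<^sup>+z. f z \<partial>distr lborel borel ((+) a))"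
    by (simp add: lborel_distr_plus)
  also have "\<dots> = (\<integral>\<^sup>+z. f (a + z) \<partial>lborel)"
    by (subst nn_integral_distr) auto
  finally show ?thesis by simp
qed

lemma nn_integral_lborel_scale:
  fixes f :: "'a::euclidean_space \<Rightarrow> ennreal"
  assumes [measurable]: "f \<in> borel_measurable borel" and "c \<noteq> 0"
  shows "(\<integral>\<^sup>+z. f z \<partial>lborel) = ennreal (\<bar>c\<bar> ^ DIM('a)) * (\<integral>\<^sup>+z. f (c *\<^sub>R z) \<partial>lborel)"
proof -
  have "(\<integral>\<^sup>+z. f z \<partial>lborel)
      = (\<integral>\<^sup>+z. f z \<partial>density (distr lborel borel (\<lambda>x. 0 + c *\<^sub>R x)) (\<lambda>_. ennreal (\<bar>c\<bar> ^ DIM('a))))"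
    using lborel_affine[OF \<open>c \<noteq> 0\<close>, of "0::'a"] by (simp add: ennreal_power)
  also have "\<dots> = (\<integral>\<^sup>+z. ennreal (\<bar>c\<bar> ^ DIM('a)) * f (c *\<^sub>R z) \<partial>lborel)"
    by (simp add: nn_integral_density nn_integral_distr)
  also have "\<dots> = ennreal (\<bar>c\<bar> ^ DIM('a)) * (\<integral>\<^sup>+z. f (c *\<^sub>R z) \<partial>lborel)"
    by (rule nn_integral_cmult) measurable
  finally show ?thesis .
qed

lemma heat_scale:
  fixes z :: "'a::euclidean_space"
  assumes "0 < s" "c \<noteq> 0"
  shows "heat (c\<^sup>2 * s) (c *\<^sub>R z) * \<bar>c\<bar> ^ DIM('a) = heat s z"
  using assms by (simp add: heat_def power_mult_distrib real_sqrt_mult power_divide)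

text \<open>Brownian scaling: \<open>c *\<^sub>R z\<close> is Gaussian with variance
  \<open>c\<^sup>2 * s\<close> when \<open>z\<close> is Gaussian with variance
  \<open>s\<close>.\<close>

lemma nn_integral_heat_scale:
  fixes f :: "'a::euclidean_space \<Rightarrow> ennreal"
  assumes [measurable]: "f \<in> borel_measurable borel" and "c \<noteq> 0" "0 < s"
  shows "(\<integral>\<^sup>+z. ennreal (heat s z) * f (c *\<^sub>R z) \<partial>lborel) = (\<integral>\<^sup>+z. ennreal (heat (c\<^sup>2 * s) z) * f z \<partial>lborel)"
proof -
  have "(\<integral>\<^sup>+z. ennreal (heat (c\<^sup>2 * s) z) * f z \<partial>lborel)
    = (\<integral>\<^sup>+z. ennreal (\<bar>c\<bar> ^ DIM('a)) * (ennreal (heat (c\<^sup>2 * s) (c *\<^sub>R z)) * f (c *\<^sub>R z)) \<partial>lborel)"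
    using assms(2) by (subst nn_integral_lborel_scale[of _ c]) (auto simp: nn_integral_cmult)
  also have "\<dots> = (\<integral>\<^sup>+z. ennreal (heat s z) * f (c *\<^sub>R z) \<partial>lborel)"
  proof (intro nn_integral_cong)
    fix z :: 'a
    have "ennreal (heat s z) = ennreal (\<bar>c\<bar> ^ DIM('a)) * ennreal (heat (c\<^sup>2 * s) (c *\<^sub>R z))"
      using assms(2,3) by (subst heat_scale[OF assms(3,2), symmetric]) (simp add: ennreal_mult' mult.commute)
    then show "ennreal (\<bar>c\<bar> ^ DIM('a)) * (ennreal (heat (c\<^sup>2 * s) (c *\<^sub>R z)) * f (c *\<^sub>R z))
       = ennreal (heat s z) * f (c *\<^sub>R z)"
      by (simp add: mult.assoc)
  qed
  finally show ?thesis by simp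
qed

section \<open>Past and future of a path, and the Markov property at a fixed time\<close>

definition restart :: "real \<Rightarrow> (real \<Rightarrow> 'w \<Rightarrow> 'a::real_vector) \<Rightarrow> real \<Rightarrow> 'w \<Rightarrow> 'a" where
  "restart s X u \<omega> = X (s + u) \<omega> - X s \<omega>"

text \<open>Freezing the path at time \<open>s\<close>, rather than restricting it to
  \<open>[0, s]\<close>, keeps the past in the same \<open>path_space\<close>, so that
  \<open>law_eqI\<close> applies to it.\<close>

definition stop :: "real \<Rightarrow> (real \<Rightarrow> 'w \<Rightarrow> 'a) \<Rightarrow> real \<Rightarrow> 'w \<Rightarrow> 'a" where
  "stop s X u \<omega> = X (min u s) \<omega>"

lemma prod_lessThan_add:
  fixes f :: "nat \<Rightarrow> 'a::comm_monoid_mult"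
  shows "prod f {..<m + n} = prod f {..<m} * (\<Prod>i<n. f (m + i))"
  by (induction n) (auto simp: mult_ac)

lemma all_less_add: "(\<forall>i<m + n. P i) \<longleftrightarrow> (\<forall>i<m. P i) \<and> (\<forall>i<n. P (m + i))" for m n :: nat
proof safe
  fix i assume "\<forall>i<m. P i" "\<forall>i<n. P (m + i)" "i < m + n"
  then show "P i" by (cases "i < m") (auto dest: spec[of _ "i - m"])
qed auto

lemma emeasure_vimage_eq_nn_integral:
  assumes "f \<in> measurable M N" "A \<in> sets N"
  shows "emeasure M {\<omega>\<in>space M. f \<omega> \<in> A} = (\<integral>\<^sup>+\<omega>. indicator A (f \<omega>) \<partial>M)"
proof -
  have "{\<omega>\<in>space M. f \<omega> \<in> A} \<in> sets M"
    using measurable_sets[OF assms] by (simp add: vimage_def Int_def conj_commute)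
  then have "emeasure M {\<omega>\<in>space M. f \<omega> \<in> A} = (\<integral>\<^sup>+\<omega>. indicator {\<omega>\<in>space M. f \<omega> \<in> A} \<omega> \<partial>M)"
    by simp
  also have "\<dots> = (\<integral>\<^sup>+\<omega>. indicator A (f \<omega>) \<partial>M)"
    by (intro nn_integral_cong) (simp add: indicator_def)
  finally show ?thesis .
qed

context standard_brownian_motion
begin

lemma nn_integral_increment:
  assumes "0 \<le> s" "s < t" and [measurable]: "F \<in> borel_measurable borel"
  shows "(\<integral>\<^sup>+\<omega>. F (B t \<omega> - B s \<omega>) \<partial>M) = (\<integral>\<^sup>+z. ennreal (heat (t - s) z) * F z \<partial>lborel)"
  using distributed_nn_integral[OF increments_normal[OF assms(1,2)], of F] assms(2)
  by (simp add: prod_normal_density)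

lemma nn_integral_BM:
  assumes "0 < t" and [measurable]: "F \<in> borel_measurable borel"
  shows "(\<integral>\<^sup>+\<omega>. F (B t \<omega>) \<partial>M) = (\<integral>\<^sup>+z. ennreal (heat t z) * F z \<partial>lborel)"
proof -
  have "(\<integral>\<^sup>+\<omega>. F (B t \<omega>) \<partial>M) = (\<integral>\<^sup>+\<omega>. F (B t \<omega> - B 0 \<omega>) \<partial>M)"
    by (intro nn_integral_cong) (simp add: start_BM)
  then show ?thesis using nn_integral_increment[of 0 t F] assms by simp
qed

lemma nn_integral_heat: 
  assumes "0 < t" shows "(\<integral>\<^sup>+z. ennreal (heat t (z::'a)) \<partial>lborel) = 1"
  using nn_integral_BM[OF assms, of "\<lambda>_. 1"] by (simp add: emeasure_space_1)

lemma measurable_increment: "0 \<le> s \<Longrightarrow> 0 \<le> t \<Longrightarrow> (\<lambda>\<omega>. B t \<omega> - B s \<omega>) \<in> borel_measurable M"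
  using measurable_BM[of s] measurable_BM[of t] by measurable

lemma sets_increment:
  "0 \<le> s \<Longrightarrow> 0 \<le> t \<Longrightarrow> A \<in> sets borel \<Longrightarrow> {\<omega>\<in>space M. B t \<omega> - B s \<omega> \<in> A} \<in> sets M"
  using measurable_sets[OF measurable_increment, of s t A] by (simp add: vimage_def Int_def conj_commute)

lemma prob_increment_shift:
  assumes "0 \<le> s" "0 \<le> r" "r \<le> t" and [measurable]: "A \<in> sets borel"
  shows "prob {\<omega>\<in>space M. B (s + t) \<omega> - B (s + r) \<omega> \<in> A} = prob {\<omega>\<in>space M. B t \<omega> - B r \<omega> \<in> A}"
proof (cases "r = t")
  case False
  have eq: "emeasure M {\<omega>\<in>space M. B t \<omega> - B r \<omega> \<in> A} = (\<integral>\<^sup>+z. ennreal (heat (t - r) z) * indicator A z \<partial>lborel)"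
    if "0 \<le> r" "r < t" for r t
  proof -
    have "emeasure M {\<omega>\<in>space M. B t \<omega> - B r \<omega> \<in> A} = (\<integral>\<^sup>+\<omega>. indicator A (B t \<omega> - B r \<omega>) \<partial>M)"
      using that by (intro emeasure_vimage_eq_nn_integral[of _ _ borel] measurable_increment) auto
    then show ?thesis using nn_integral_increment[OF that, of "indicator A"] by simp
  qed
  show ?thesis
    using eq[of r t] eq[of "s + r" "s + t"] assms False by (simp add: measure_def)
qed simp

lemma prob_increments:
  assumes "\<And>i. i \<le> n \<Longrightarrow> 0 \<le> \<tau> i" "\<And>i. i < n \<Longrightarrow> \<tau> i \<le> \<tau> (Suc i)" "\<And>i. i < n \<Longrightarrow> A i \<in> sets borel"
  shows "prob {\<omega>\<in>space M. \<forall>i<n. B (\<tau> (Suc i)) \<omega> - B (\<tau> i) \<omega> \<in> A i}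
    = (\<Prod>i<n. prob {\<omega>\<in>space M. B (\<tau> (Suc i)) \<omega> - B (\<tau> i) \<omega> \<in> A i})"
proof (cases "n = 0")
  case True
  then show ?thesis by (simp add: prob_space)
next
  case False
  have iv: "indep_vars (\<lambda>_. borel) (\<lambda>i \<omega>. B (\<tau> (Suc i)) \<omega> - B (\<tau> i) \<omega>) {..<n}"
    using assms by (intro increments_indep) auto
  have "{\<omega>\<in>space M. \<forall>i<n. B (\<tau> (Suc i)) \<omega> - B (\<tau> i) \<omega> \<in> A i}
     = (\<Inter>i\<in>{..<n}. (\<lambda>\<omega>. B (\<tau> (Suc i)) \<omega> - B (\<tau> i) \<omega>) -` A i \<inter> space M)"
    using False by auto
  moreover have "prob (\<Inter>i\<in>{..<n}. (\<lambda>\<omega>. B (\<tau> (Suc i)) \<omega> - B (\<tau> i) \<omega>) -` A i \<inter> space M)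
      = (\<Prod>i<n. prob ((\<lambda>\<omega>. B (\<tau> (Suc i)) \<omega> - B (\<tau> i) \<omega>) -` A i \<inter> space M))"
    by (rule indep_varsD_finite[OF iv]) (use False assms(3) in auto)
  moreover have "(\<lambda>\<omega>. B (\<tau> (Suc i)) \<omega> - B (\<tau> i) \<omega>) -` A i \<inter> space M
      = {\<omega>\<in>space M. B (\<tau> (Suc i)) \<omega> - B (\<tau> i) \<omega> \<in> A i}" for i
    by auto
  ultimately show ?thesis by (simp only:)
qed

lemma sets_increments:
  assumes "\<And>i. i \<le> n \<Longrightarrow> 0 \<le> \<tau> i" "\<And>i. i < n \<Longrightarrow> A i \<in> sets borel"
  shows "{\<omega>\<in>space M. \<forall>i<n. B (\<tau> (Suc i)) \<omega> - B (\<tau> i) \<omega> \<in> A i} \<in> sets M"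
proof -
  have "{\<omega>\<in>space M. \<forall>i\<in>{..<n}. B (\<tau> (Suc i)) \<omega> - B (\<tau> i) \<omega> \<in> A i} \<in> sets M"
  proof (rule sets.sets_Collect_finite_All)
    fix i assume "i \<in> {..<n}"
    then show "{\<omega>\<in>space M. B (\<tau> (Suc i)) \<omega> - B (\<tau> i) \<omega> \<in> A i} \<in> sets M"
      using assms by (intro sets_increment) (simp_all add: Suc_le_eq)
  qed simp
  also have "{\<omega>\<in>space M. \<forall>i\<in>{..<n}. B (\<tau> (Suc i)) \<omega> - B (\<tau> i) \<omega> \<in> A i}
    = {\<omega>\<in>space M. \<forall>i<n. B (\<tau> (Suc i)) \<omega> - B (\<tau> i) \<omega> \<in> A i}"
    by blast
  finally show ?thesis .
qed

lemma measurable_restart: "0 \<le> s \<Longrightarrow> 0 \<le> u \<Longrightarrow> restart s B u \<in> borel_measurable M"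
  unfolding restart_def[abs_def] by (intro measurable_increment) auto

lemma measurable_stop: "0 \<le> s \<Longrightarrow> 0 \<le> u \<Longrightarrow> stop s B u \<in> borel_measurable M"
  unfolding stop_def[abs_def] by (intro measurable_BM) auto

lemmas measurable_trajs [measurable] =
  measurable_traj[OF measurable_BM] measurable_traj[OF measurable_restart] measurable_traj[OF measurable_stop]

text \<open>The two grids are concatenated, so that independence of increments is used once; the
  increments after \<open>s\<close> are then moved back to \<open>0\<close> by stationarity.\<close>

lemma prob_past_future:
  assumes \<tau>: "\<And>i. i \<le> n \<Longrightarrow> 0 \<le> \<tau> i" "\<And>i. i < n \<Longrightarrow> \<tau> i \<le> \<tau> (Suc i)" "\<And>i. i \<le> n \<Longrightarrow> \<tau> i \<le> s"
    and \<tau>': "\<tau>' 0 = 0" "\<And>i. i \<le> n' \<Longrightarrow> 0 \<le> \<tau>' i" "\<And>i. i < n' \<Longrightarrow> \<tau>' i \<le> \<tau>' (Suc i)"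
    and A: "\<And>i. A i \<in> sets borel" and A': "\<And>i. A' i \<in> sets borel"
  shows "prob {\<omega>\<in>space M. (\<forall>i<n. B (\<tau> (Suc i)) \<omega> - B (\<tau> i) \<omega> \<in> A i) \<and>
           (\<forall>i<n'. restart s B (\<tau>' (Suc i)) \<omega> - restart s B (\<tau>' i) \<omega> \<in> A' i)}
    = prob {\<omega>\<in>space M. \<forall>i<n. B (\<tau> (Suc i)) \<omega> - B (\<tau> i) \<omega> \<in> A i} *
      prob {\<omega>\<in>space M. \<forall>i<n'. B (\<tau>' (Suc i)) \<omega> - B (\<tau>' i) \<omega> \<in> A' i}"
    (is "?L = ?P * ?Q")
proof -
  \<comment> \<open>Index \<open>n\<close> carries the unconstrained increment from
    \<open>\<tau> n\<close> up to \<open>s\<close>; the second grid follows with its indices raised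
    by \<open>Suc n\<close>.\<close>
  define \<sigma> where "\<sigma> i = (if i \<le> n then \<tau> i else s + \<tau>' (i - Suc n))" for i
  define C where "C i = (if i < n then A i else if i = n then UNIV else A' (i - Suc n))" for i
  have s: "0 \<le> s" using \<tau>(1,3)[of 0] by auto
  have \<sigma>0: "0 \<le> \<sigma> i" if "i \<le> Suc n + n'" for i
    using that \<tau>(1) \<tau>'(2) s by (auto simp: \<sigma>_def)
  have \<sigma>m: "\<sigma> i \<le> \<sigma> (Suc i)" if i: "i < Suc n + n'" for i
  proof -
    consider "i < n" | "i = n" | "i > n" by linarith
    then show ?thesis
    proof cases
      case 3
      then have "Suc i - Suc n = Suc (i - Suc n)" by simp
      with 3 i \<tau>'(3)[of "i - Suc n"] show ?thesis by (simp add: \<sigma>_def)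
    qed (use \<tau> \<tau>' in \<open>auto simp: \<sigma>_def\<close>)
  qed
  have C: "C i \<in> sets borel" for i using A A' by (auto simp: C_def)
  have \<sigma>_simps: "\<sigma> (Suc n + i) = s + \<tau>' i" "\<sigma> (Suc (Suc n + i)) = s + \<tau>' (Suc i)" "C (Suc n + i) = A' i" for i
    by (auto simp: \<sigma>_def C_def)
  have \<sigma>_less: "\<sigma> i = \<tau> i \<and> \<sigma> (Suc i) = \<tau> (Suc i) \<and> C i = A i" if "i < n" for i
    using that by (auto simp: \<sigma>_def C_def)
  have Cn: "C n = UNIV" by (simp add: C_def)
  have all: "(\<forall>i<Suc n + n'. B (\<sigma> (Suc i)) \<omega> - B (\<sigma> i) \<omega> \<in> C i) \<longleftrightarrow>
    (\<forall>i<n. B (\<tau> (Suc i)) \<omega> - B (\<tau> i) \<omega> \<in> A i) \<and>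
           (\<forall>i<n'. restart s B (\<tau>' (Suc i)) \<omega> - restart s B (\<tau>' i) \<omega> \<in> A' i)" for \<omega>
    unfolding all_less_add \<sigma>_simps restart_def
    using \<sigma>_less Cn by (simp add: All_less_Suc cong: conj_cong)
  have "?L = (\<Prod>i<Suc n + n'. prob {\<omega>\<in>space M. B (\<sigma> (Suc i)) \<omega> - B (\<sigma> i) \<omega> \<in> C i})"
    unfolding all[symmetric] by (intro prob_increments \<sigma>0 \<sigma>m C) 
  also have "\<dots> = (\<Prod>i<n. prob {\<omega>\<in>space M. B (\<tau> (Suc i)) \<omega> - B (\<tau> i) \<omega> \<in> A i}) *
      (\<Prod>i<n'. prob {\<omega>\<in>space M. B (s + \<tau>' (Suc i)) \<omega> - B (s + \<tau>' i) \<omega> \<in> A' i})"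
    unfolding prod_lessThan_add \<sigma>_simps using \<sigma>_less Cn by (simp add: prob_space)
  also have "\<dots> = ?P * ?Q"
  proof (rule arg_cong2[of _ _ _ _ "(*)"])
    show "(\<Prod>i<n. prob {\<omega>\<in>space M. B (\<tau> (Suc i)) \<omega> - B (\<tau> i) \<omega> \<in> A i}) = ?P"
      by (rule prob_increments[symmetric]) (use \<tau> A in auto)
    have "(\<Prod>i<n'. prob {\<omega>\<in>space M. B (s + \<tau>' (Suc i)) \<omega> - B (s + \<tau>' i) \<omega> \<in> A' i})
        = (\<Prod>i<n'. prob {\<omega>\<in>space M. B (\<tau>' (Suc i)) \<omega> - B (\<tau>' i) \<omega> \<in> A' i})"
      using \<tau>' A' s by (intro prod.cong prob_increment_shift) auto
    also have "\<dots> = ?Q"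
      by (rule prob_increments[symmetric]) (use \<tau>' A' in auto)
    finally show "(\<Prod>i<n'. prob {\<omega>\<in>space M. B (s + \<tau>' (Suc i)) \<omega> - B (s + \<tau>' i) \<omega> \<in> A' i}) = ?Q" .
  qed
  finally show ?thesis .
qed

lemma finite_measure_indicator_density: "A \<in> events \<Longrightarrow> finite_measure (density M (indicator A))"
  by (intro finite_measureI) (simp add: emeasure_density)

lemma finite_measure_const_density: "c < \<infinity> \<Longrightarrow> finite_measure (density M (\<lambda>_. c))"
  by (intro finite_measureI) (simp add: emeasure_density emeasure_space_1)

text \<open>Under \<open>M\<close> restricted to the past event, the restarted path has the same
  increment probabilities as \<open>B\<close> under \<open>M\<close> scaled by the probability of
  that event. So \<open>law_eqI\<close> extends independence from future cylinders to every future
  event.\<close>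

lemma emeasure_past_cylinder_future:
  assumes \<tau>: "\<And>i. i \<le> n \<Longrightarrow> 0 \<le> \<tau> i" "\<And>i. i < n \<Longrightarrow> \<tau> i \<le> \<tau> (Suc i)" "\<And>i. i \<le> n \<Longrightarrow> \<tau> i \<le> s"
    and A: "\<And>i. A i \<in> sets borel" and \<Lambda>: "\<Lambda> \<in> sets path_space"
  shows "emeasure M {\<omega>\<in>space M. (\<forall>i<n. B (\<tau> (Suc i)) \<omega> - B (\<tau> i) \<omega> \<in> A i) \<and> traj (restart s B) \<omega> \<in> \<Lambda>}
    = emeasure M {\<omega>\<in>space M. \<forall>i<n. B (\<tau> (Suc i)) \<omega> - B (\<tau> i) \<omega> \<in> A i} *
      emeasure (distr M path_space (traj B)) \<Lambda>"
proof -
  define \<Xi> where "\<Xi> = {\<omega>\<in>space M. \<forall>i<n. B (\<tau> (Suc i)) \<omega> - B (\<tau> i) \<omega> \<in> A i}"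
  have s: "0 \<le> s" using \<tau>(1,3)[of 0] by auto
  have \<Xi>: "\<Xi> \<in> sets M" unfolding \<Xi>_def by (rule sets_increments) (use \<tau>(1) A in auto)
  have \<Xi>fin: "emeasure M \<Xi> < \<infinity>" by (simp add: less_top[symmetric])
  have law: "distr (density M (indicator \<Xi>)) path_space (traj (restart s B))
      = distr (density M (\<lambda>_. emeasure M \<Xi>)) path_space (traj B)"
  proof (rule law_eqI)
    fix n' and \<tau>' :: "nat \<Rightarrow> real" and A' :: "nat \<Rightarrow> 'a set"
    assume 1: "\<tau>' 0 = 0" "\<And>i. i < n' \<Longrightarrow> \<tau>' i \<le> \<tau>' (Suc i)" "\<And>i. i \<le> n' \<Longrightarrow> 0 \<le> \<tau>' i" "\<And>i. A' i \<in> sets borel"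
    let ?F = "{\<omega>\<in>space M. \<forall>i<n'. restart s B (\<tau>' (Suc i)) \<omega> - restart s B (\<tau>' i) \<omega> \<in> A' i}"
    let ?G = "{\<omega>\<in>space M. \<forall>i<n'. B (\<tau>' (Suc i)) \<omega> - B (\<tau>' i) \<omega> \<in> A' i}"
    have eqF: "?F = {\<omega>\<in>space M. \<forall>i<n'. B (s + \<tau>' (Suc i)) \<omega> - B (s + \<tau>' i) \<omega> \<in> A' i}"
      by (simp add: restart_def)
    have F: "?F \<in> sets M"
      unfolding eqF by (rule sets_increments) (use 1(3,4) s in \<open>auto intro: add_nonneg_nonneg\<close>)
    have G: "?G \<in> sets M"
      by (rule sets_increments) (use 1(3,4) in auto)
    have "emeasure (density M (indicator \<Xi>)) ?F = emeasure M (\<Xi> \<inter> ?F)"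
      by (rule emeasure_restricted[OF \<Xi> F])
    also have "\<Xi> \<inter> ?F = {\<omega>\<in>space M. (\<forall>i<n. B (\<tau> (Suc i)) \<omega> - B (\<tau> i) \<omega> \<in> A i) \<and>
           (\<forall>i<n'. restart s B (\<tau>' (Suc i)) \<omega> - restart s B (\<tau>' i) \<omega> \<in> A' i)}"
      unfolding \<Xi>_def by blast
    also have "emeasure M \<dots> = emeasure M \<Xi> * emeasure M ?G"
      unfolding \<Xi>_def emeasure_eq_measure
      by (subst prob_past_future) (use \<tau> A 1 in \<open>auto simp: ennreal_mult\<close>)
    also have "\<dots> = emeasure (density M (\<lambda>_. emeasure M \<Xi>)) ?G"
      by (rule emeasure_density_const[OF G, symmetric])
    finally show "emeasure (density M (indicator \<Xi>)) {\<omega>\<in>space (density M (indicator \<Xi>)).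
        \<forall>i<n'. restart s B (\<tau>' (Suc i)) \<omega> - restart s B (\<tau>' i) \<omega> \<in> A' i}
      = emeasure (density M (\<lambda>_. emeasure M \<Xi>)) {\<omega>\<in>space (density M (\<lambda>_. emeasure M \<Xi>)).
        \<forall>i<n'. B (\<tau>' (Suc i)) \<omega> - B (\<tau>' i) \<omega> \<in> A' i}"
      by simp
  qed (use \<Xi> s \<Xi>fin in \<open>simp_all add: finite_measure_indicator_density finite_measure_const_density measurable_restart measurable_BM start_BM restart_def\<close>)
  have R: "traj (restart s B) \<in> measurable M path_space" and T: "traj B \<in> measurable M path_space"
    using s by (auto intro!: measurable_traj measurable_restart measurable_BM)
  have "{\<omega>\<in>space M. (\<forall>i<n. B (\<tau> (Suc i)) \<omega> - B (\<tau> i) \<omega> \<in> A i) \<and> traj (restart s B) \<omega> \<in> \<Lambda>}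
      = \<Xi> \<inter> (traj (restart s B) -` \<Lambda> \<inter> space M)"
    by (auto simp: \<Xi>_def)
  also have "emeasure M \<dots> = emeasure (density M (indicator \<Xi>)) (traj (restart s B) -` \<Lambda> \<inter> space M)"
    using measurable_sets[OF R \<Lambda>] by (rule emeasure_restricted[OF \<Xi>, symmetric])
  also have "\<dots> = emeasure (distr (density M (indicator \<Xi>)) path_space (traj (restart s B))) \<Lambda>"
    using R \<Lambda> by (simp add: emeasure_distr)
  also have "\<dots> = emeasure M \<Xi> * emeasure (distr M path_space (traj B)) \<Lambda>"
    unfolding law using T \<Lambda> measurable_sets[OF T \<Lambda>] by (simp add: emeasure_distr emeasure_density_const)
  finally show ?thesis unfolding \<Xi>_def .
qed

text \<open>The argument of \<open>emeasure_past_cylinder_future\<close> with the roles exchanged: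
  an arbitrary future event is held fixed, and the law of the stopped path is determined through its
  cylinders. Rectangles then determine the product measure.\<close>

lemma distr_past_future:
  assumes s: "0 \<le> s"
  shows "distr M (path_space \<Otimes>\<^sub>M path_space) (\<lambda>\<omega>. (traj (stop s B) \<omega>, traj (restart s B) \<omega>))
    = distr M path_space (traj (stop s B)) \<Otimes>\<^sub>M distr M path_space (traj B)"
proof (rule pair_measure_eqI[symmetric])
  have R: "traj (restart s B) \<in> measurable M path_space" and T: "traj B \<in> measurable M path_space"
    and S: "traj (stop s B) \<in> measurable M path_space"
    using s by (auto intro!: measurable_traj measurable_restart measurable_BM measurable_stop)
  show "sigma_finite_measure (distr M path_space (traj (stop s B)))"
    "sigma_finite_measure (distr M path_space (traj B))"
    using S T by (auto intro!: prob_space_imp_sigma_finite prob_space_distr)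
  fix \<Gamma> \<Lambda> :: "(real \<Rightarrow> 'a) set"
  assume "\<Gamma> \<in> sets (distr M path_space (traj (stop s B)))" "\<Lambda> \<in> sets (distr M path_space (traj B))"
  then have \<Gamma>: "\<Gamma> \<in> sets path_space" and \<Lambda>: "\<Lambda> \<in> sets path_space" by auto
  define \<Xi> where "\<Xi> = traj (restart s B) -` \<Lambda> \<inter> space M"
  have \<Xi>: "\<Xi> \<in> sets M" unfolding \<Xi>_def by (rule measurable_sets[OF R \<Lambda>])
  define c where "c = emeasure (distr M path_space (traj B)) \<Lambda>"
  have "c \<noteq> \<infinity>" 
    using prob_space.finite_measure[OF prob_space_distr[OF T]] by (simp add: c_def finite_measure.emeasure_finite)
  then have cfin: "c < \<infinity>" by (simp add: less_top)
  have law: "distr (density M (indicator \<Xi>)) path_space (traj (stop s B))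
      = distr (density M (\<lambda>_. c)) path_space (traj (stop s B))"
  proof (rule law_eqI)
    fix n and \<tau> :: "nat \<Rightarrow> real" and A :: "nat \<Rightarrow> 'a set"
    assume 1: "\<tau> 0 = 0" "\<And>i. i < n \<Longrightarrow> \<tau> i \<le> \<tau> (Suc i)" "\<And>i. i \<le> n \<Longrightarrow> 0 \<le> \<tau> i" "\<And>i. A i \<in> sets borel"
    \<comment> \<open>Times beyond \<open>s\<close> collapse to \<open>s\<close>, so a grid for the
      stopped path is a weakly increasing grid for \<open>B\<close> inside
      \<open>[0, s]\<close>.\<close>
    define \<sigma> where "\<sigma> i = min (\<tau> i) s" for i
    have \<sigma>: "\<And>i. i \<le> n \<Longrightarrow> 0 \<le> \<sigma> i" "\<And>i. i < n \<Longrightarrow> \<sigma> i \<le> \<sigma> (Suc i)" "\<And>i. i \<le> n \<Longrightarrow> \<sigma> i \<le> s"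
      using 1 s by (auto simp: \<sigma>_def min_le_iff_disj)
    let ?F = "{\<omega>\<in>space M. \<forall>i<n. stop s B (\<tau> (Suc i)) \<omega> - stop s B (\<tau> i) \<omega> \<in> A i}"
    have eqF: "?F = {\<omega>\<in>space M. \<forall>i<n. B (\<sigma> (Suc i)) \<omega> - B (\<sigma> i) \<omega> \<in> A i}"
      by (simp add: stop_def \<sigma>_def)
    have F: "?F \<in> sets M"
      unfolding eqF by (rule sets_increments) (use \<sigma>(1) 1(4) in auto)
    have "emeasure (density M (indicator \<Xi>)) ?F = emeasure M (\<Xi> \<inter> ?F)"
      by (rule emeasure_restricted[OF \<Xi> F])
    also have "\<Xi> \<inter> ?F = {\<omega>\<in>space M. (\<forall>i<n. B (\<sigma> (Suc i)) \<omega> - B (\<sigma> i) \<omega> \<in> A i) \<and> traj (restart s B) \<omega> \<in> \<Lambda>}"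
      unfolding eqF \<Xi>_def by blast
    also have "emeasure M \<dots> = emeasure M ?F * c"
      unfolding eqF c_def using \<sigma> 1 \<Lambda> by (intro emeasure_past_cylinder_future) auto
    also have "\<dots> = emeasure (density M (\<lambda>_. c)) ?F"
      unfolding mult.commute[of _ c] by (rule emeasure_density_const[OF F, symmetric])
    finally show "emeasure (density M (indicator \<Xi>)) {\<omega>\<in>space (density M (indicator \<Xi>)).
        \<forall>i<n. stop s B (\<tau> (Suc i)) \<omega> - stop s B (\<tau> i) \<omega> \<in> A i}
      = emeasure (density M (\<lambda>_. c)) {\<omega>\<in>space (density M (\<lambda>_. c)).
        \<forall>i<n. stop s B (\<tau> (Suc i)) \<omega> - stop s B (\<tau> i) \<omega> \<in> A i}"
      by simp
  qed (use \<Xi> s cfin in \<open>simp_all add: finite_measure_indicator_density finite_measure_const_density measurable_stop start_BM stop_def\<close>)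
  have "emeasure (distr M path_space (traj (stop s B))) \<Gamma> * c
    = emeasure (distr (density M (\<lambda>_. c)) path_space (traj (stop s B))) \<Gamma>"
    using S \<Gamma> measurable_sets[OF S \<Gamma>] by (simp add: emeasure_distr emeasure_density_const mult.commute)
  also have "\<dots> = emeasure M (\<Xi> \<inter> (traj (stop s B) -` \<Gamma> \<inter> space M))"
    unfolding law[symmetric] using S \<Gamma> measurable_sets[OF S \<Gamma>] \<Xi> by (simp add: emeasure_distr emeasure_restricted)
  also have "\<Xi> \<inter> (traj (stop s B) -` \<Gamma> \<inter> space M)
      = (\<lambda>\<omega>. (traj (stop s B) \<omega>, traj (restart s B) \<omega>)) -` (\<Gamma> \<times> \<Lambda>) \<inter> space M"
    by (auto simp: \<Xi>_def)
  also have "emeasure M \<dots> = emeasure (distr M (path_space \<Otimes>\<^sub>M path_space) (\<lambda>\<omega>. (traj (stop s B) \<omega>, traj (restart s B) \<omega>))) (\<Gamma> \<times> \<Lambda>)"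
    using S R \<Gamma> \<Lambda> by (simp add: emeasure_distr)
  finally show "emeasure (distr M path_space (traj (stop s B))) \<Gamma> * emeasure (distr M path_space (traj B)) \<Lambda>
    = emeasure (distr M (path_space \<Otimes>\<^sub>M path_space) (\<lambda>\<omega>. (traj (stop s B) \<omega>, traj (restart s B) \<omega>))) (\<Gamma> \<times> \<Lambda>)"
    unfolding c_def .
qed simp

text \<open>The restarted path is an independent copy of the whole motion; drawing that copy from
  \<open>M\<close> a second time turns the product law into an iterated integral.\<close>

theorem markov:
  assumes s: "0 \<le> s" and F [measurable]: "F \<in> borel_measurable (path_space \<Otimes>\<^sub>M path_space)"
  shows "(\<integral>\<^sup>+\<omega>. F (traj (stop s B) \<omega>, traj (restart s B) \<omega>) \<partial>M)
    = (\<integral>\<^sup>+\<omega>. (\<integral>\<^sup>+\<omega>'. F (traj (stop s B) \<omega>, traj B \<omega>') \<partial>M) \<partial>M)"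
proof -
  have [measurable]: "traj (restart s B) \<in> measurable M path_space" "traj B \<in> measurable M path_space"
    "traj (stop s B) \<in> measurable M path_space"
    using s by (auto intro!: measurable_traj measurable_restart measurable_BM measurable_stop)
  interpret T: prob_space "distr M path_space (traj B)" by (rule prob_space_distr) measurable
  have "(\<integral>\<^sup>+\<omega>. F (traj (stop s B) \<omega>, traj (restart s B) \<omega>) \<partial>M)
    = (\<integral>\<^sup>+p. F p \<partial>(distr M path_space (traj (stop s B)) \<Otimes>\<^sub>M distr M path_space (traj B)))"
    unfolding distr_past_future[OF s, symmetric] by (simp add: nn_integral_distr)
  also have "\<dots> = (\<integral>\<^sup>+x. \<integral>\<^sup>+y. F (x, y) \<partial>distr M path_space (traj B) \<partial>distr M path_space (traj (stop s B)))"
    by (rule T.nn_integral_fst[symmetric]) simp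
  also have "\<dots> = (\<integral>\<^sup>+\<omega>. \<integral>\<^sup>+y. F (traj (stop s B) \<omega>, y) \<partial>distr M path_space (traj B) \<partial>M)"
    by (simp add: nn_integral_distr)
  also have "\<dots> = (\<integral>\<^sup>+\<omega>. (\<integral>\<^sup>+\<omega>'. F (traj (stop s B) \<omega>, traj B \<omega>') \<partial>M) \<partial>M)"
  proof (intro nn_integral_cong)
    fix \<omega> assume "\<omega> \<in> space M"
    then have "traj (stop s B) \<omega> \<in> space path_space"
      by (simp add: space_PiM traj_def)
    from measurable_compose[OF measurable_Pair1'[OF this] F]
    show "(\<integral>\<^sup>+y. F (traj (stop s B) \<omega>, y) \<partial>distr M path_space (traj B))
      = (\<integral>\<^sup>+\<omega>'. F (traj (stop s B) \<omega>, traj B \<omega>') \<partial>M)"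
      by (simp add: nn_integral_distr)
  qed
  finally show ?thesis .
qed

end

section \<open>Girsanov's formula and Brownian bridges\<close>

context standard_brownian_motion
begin

text \<open>Girsanov's formula for a single increment: translate the Gaussian and read off the
  quotient of densities from \<open>heat_shift\<close>. Empty increments are included because grids
  may repeat a time.\<close>

lemma nn_integral_increment_shift:
  assumes "0 \<le> r" "r \<le> t" and A [measurable]: "A \<in> sets borel"
  shows "emeasure M {\<omega>\<in>space M. B t \<omega> - B r \<omega> + (t - r) *\<^sub>R v \<in> A}
    = (\<integral>\<^sup>+\<omega>. indicator A (B t \<omega> - B r \<omega>) *
        ennreal (exp (v \<bullet> (B t \<omega> - B r \<omega>) - (t - r) * (norm v)\<^sup>2 / 2)) \<partial>M)"
proof (cases "r = t")
  case True
  then show ?thesis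
    by (subst emeasure_vimage_eq_nn_integral[of _ _ borel]) auto
next
  case False
  define u where "u = t - r"
  have u: "0 < u" using False assms by (simp add: u_def)
  have "emeasure M {\<omega>\<in>space M. B t \<omega> - B r \<omega> + u *\<^sub>R v \<in> A}
      = (\<integral>\<^sup>+\<omega>. indicator A (B t \<omega> - B r \<omega> + u *\<^sub>R v) \<partial>M)"
    using assms measurable_increment[of r t]
    by (intro emeasure_vimage_eq_nn_integral[of _ _ borel] borel_measurable_add) auto
  also have "\<dots> = (\<integral>\<^sup>+z. ennreal (heat u z) * indicator A (z + u *\<^sub>R v) \<partial>lborel)"
    using nn_integral_increment[of r t "\<lambda>z. indicator A (z + u *\<^sub>R v)"] assms False by (simp add: u_def)
  also have "\<dots> = (\<integral>\<^sup>+z. ennreal (heat u (u *\<^sub>R v + z - u *\<^sub>R v)) * indicator A (u *\<^sub>R v + z) \<partial>lborel)"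
    by (simp add: add.commute)
  also have "\<dots> = (\<integral>\<^sup>+z. ennreal (heat u (z - u *\<^sub>R v)) * indicator A z \<partial>lborel)"
    by (rule nn_integral_lborel_shift) measurable
  also have "\<dots> = (\<integral>\<^sup>+z. ennreal (heat u z) * (indicator A z * ennreal (exp (v \<bullet> z - u * (norm v)\<^sup>2 / 2))) \<partial>lborel)"
    using u by (simp add: heat_shift ennreal_mult mult_ac)
  also have "\<dots> = (\<integral>\<^sup>+\<omega>. indicator A (B t \<omega> - B r \<omega>) *
        ennreal (exp (v \<bullet> (B t \<omega> - B r \<omega>) - u * (norm v)\<^sup>2 / 2)) \<partial>M)"
    using nn_integral_increment[of r t "\<lambda>z. indicator A z * ennreal (exp (v \<bullet> z - u * (norm v)\<^sup>2 / 2))"] assms False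
    by (simp add: u_def)
  finally show ?thesis by (simp add: u_def)
qed

lemma nn_integral_exp_BM:
  assumes "0 \<le> k"
  shows "(\<integral>\<^sup>+\<omega>. ennreal (exp (v \<bullet> B k \<omega> - k * (norm v)\<^sup>2 / 2)) \<partial>M) = 1"
proof -
  have "(\<integral>\<^sup>+\<omega>. ennreal (exp (v \<bullet> B k \<omega> - k * (norm v)\<^sup>2 / 2)) \<partial>M)
      = (\<integral>\<^sup>+\<omega>. indicator UNIV (B k \<omega> - B 0 \<omega>) *
        ennreal (exp (v \<bullet> (B k \<omega> - B 0 \<omega>) - (k - 0) * (norm v)\<^sup>2 / 2)) \<partial>M)"
    by (intro nn_integral_cong) (simp add: start_BM)
  also have "\<dots> = 1"
    using nn_integral_increment_shift[of 0 k UNIV v] assms by (simp add: emeasure_space_1)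
  finally show ?thesis .
qed

text \<open>The densities of the single increments multiply, and their exponents telescope to
  \<open>B k\<close> and \<open>k\<close> because the grid runs from \<open>0\<close> to
  \<open>k\<close>.\<close>

lemma increments_shift:
  assumes \<sigma>: "\<And>i. i \<le> n \<Longrightarrow> 0 \<le> \<sigma> i" "\<And>i. i < n \<Longrightarrow> \<sigma> i \<le> \<sigma> (Suc i)" and C: "\<And>i. C i \<in> sets borel"
    and start: "\<sigma> 0 = 0" and fin: "\<sigma> n = k"
  shows "emeasure M {\<omega>\<in>space M. \<forall>i<n. B (\<sigma> (Suc i)) \<omega> - B (\<sigma> i) \<omega> + (\<sigma> (Suc i) - \<sigma> i) *\<^sub>R v \<in> C i}
    = (\<integral>\<^sup>+\<omega>. (\<Prod>i<n. indicator (C i) (B (\<sigma> (Suc i)) \<omega> - B (\<sigma> i) \<omega>)) *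
        ennreal (exp (v \<bullet> B k \<omega> - k * (norm v)\<^sup>2 / 2)) \<partial>M)"
proof -
  define D where "D i \<omega> = B (\<sigma> (Suc i)) \<omega> - B (\<sigma> i) \<omega>" for i \<omega>
  define \<Delta> where "\<Delta> i = \<sigma> (Suc i) - \<sigma> i" for i
  define g where "g i z = indicator (C i) z * ennreal (exp (v \<bullet> z - \<Delta> i * (norm v)\<^sup>2 / 2))" for i and z :: 'a
  define C' where "C' i = (\<lambda>z. z + \<Delta> i *\<^sub>R v) -` C i" for i
  have C': "C' i \<in> sets borel" for i
    using measurable_sets[of "\<lambda>z. z + \<Delta> i *\<^sub>R v" borel borel "C i"] C by (simp add: C'_def)
  have g: "g i \<in> borel_measurable borel" for i
    unfolding g_def using C[of i] by measurable
  have ivD: "indep_vars (\<lambda>_. borel) D {..<n}"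
    unfolding D_def[abs_def] by (rule increments_indep) (use \<sigma> start in auto)
  have iv: "indep_vars (\<lambda>_. borel) (\<lambda>i. g i \<circ> D i) {..<n}"
    by (rule indep_vars_compose[OF ivD]) (use g in auto)
  have one: "ennreal (prob {\<omega>\<in>space M. D i \<omega> \<in> C' i}) = (\<integral>\<^sup>+\<omega>. g i (D i \<omega>) \<partial>M)" if "i < n" for i
    using nn_integral_increment_shift[of "\<sigma> i" "\<sigma> (Suc i)" "C i" v] \<sigma>(1)[of i] \<sigma>(2)[of i] C that
    by (simp add: D_def C'_def g_def \<Delta>_def emeasure_eq_measure)
  have "emeasure M {\<omega>\<in>space M. \<forall>i<n. D i \<omega> \<in> C' i} = ennreal (\<Prod>i<n. prob {\<omega>\<in>space M. D i \<omega> \<in> C' i})"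
    unfolding D_def emeasure_eq_measure by (subst prob_increments) (use \<sigma> C' in auto)
  also have "\<dots> = (\<Prod>i<n. \<integral>\<^sup>+\<omega>. g i (D i \<omega>) \<partial>M)"
    by (simp add: one flip: prod_ennreal)
  also have "\<dots> = (\<integral>\<^sup>+\<omega>. (\<Prod>i<n. (g i \<circ> D i) \<omega>) \<partial>M)"
    by (subst indep_vars_nn_integral[OF _ iv]) (auto simp: o_def)
  also have "\<dots> = (\<integral>\<^sup>+\<omega>. (\<Prod>i<n. indicator (C i) (D i \<omega>)) *
        ennreal (exp (v \<bullet> B k \<omega> - k * (norm v)\<^sup>2 / 2)) \<partial>M)"
  proof (intro nn_integral_cong)
    fix \<omega> assume \<omega>: "\<omega> \<in> space M"
    have sD: "(\<Sum>i<n. D i \<omega>) = B k \<omega>"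
      unfolding D_def using sum_lessThan_telescope[of "\<lambda>i. B (\<sigma> i) \<omega>" n] \<omega> start fin by (simp add: start_BM)
    have s\<Delta>: "(\<Sum>i<n. \<Delta> i) = k"
      unfolding \<Delta>_def using sum_lessThan_telescope[of \<sigma> n] start fin by simp
    have "(\<Prod>i<n. ennreal (exp (v \<bullet> D i \<omega> - \<Delta> i * (norm v)\<^sup>2 / 2)))
      = ennreal (exp (\<Sum>i<n. v \<bullet> D i \<omega> - \<Delta> i * (norm v)\<^sup>2 / 2))"
      by (simp add: prod_ennreal exp_sum)
    also have "(\<Sum>i<n. v \<bullet> D i \<omega> - \<Delta> i * (norm v)\<^sup>2 / 2) = v \<bullet> B k \<omega> - k * (norm v)\<^sup>2 / 2"
      by (simp add: sum_subtractf sD s\<Delta> flip: inner_sum_right sum_distrib_right sum_divide_distrib)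
    finally show "(\<Prod>i<n. (g i \<circ> D i) \<omega>) = (\<Prod>i<n. indicator (C i) (D i \<omega>)) *
        ennreal (exp (v \<bullet> B k \<omega> - k * (norm v)\<^sup>2 / 2))"
      by (simp add: g_def prod.distrib)
  qed
  finally show ?thesis unfolding D_def C'_def \<Delta>_def by simp
qed

theorem girsanov:
  assumes k: "0 \<le> k" and F [measurable]: "F \<in> borel_measurable path_space"
  shows "(\<integral>\<^sup>+\<omega>. F (traj (\<lambda>u \<omega>. B (min u k) \<omega> + min u k *\<^sub>R v) \<omega>) \<partial>M)
    = (\<integral>\<^sup>+\<omega>. F (traj (stop k B) \<omega>) * ennreal (exp (v \<bullet> B k \<omega> - k * (norm v)\<^sup>2 / 2)) \<partial>M)"
proof -
  let ?X = "\<lambda>u \<omega>. B (min u k) \<omega> + min u k *\<^sub>R v"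
  let ?e = "\<lambda>\<omega>. ennreal (exp (v \<bullet> B k \<omega> - k * (norm v)\<^sup>2 / 2))"
  have [measurable]: "B k \<in> borel_measurable M" using k by (rule measurable_BM)
  have X: "?X u \<in> borel_measurable M" if "0 \<le> u" for u
    using k that by (intro borel_measurable_add measurable_BM) auto
  have [measurable]: "traj ?X \<in> measurable M path_space" "traj (stop k B) \<in> measurable M path_space"
    using X k by (auto intro!: measurable_traj measurable_stop)
  have fin: "finite_measure (density M ?e)"
    by (intro finite_measureI) (simp add: emeasure_density nn_integral_exp_BM[OF k])
  have law: "distr M path_space (traj ?X) = distr (density M ?e) path_space (traj (stop k B))"
  proof (rule law_eqI)
    fix n and \<tau> :: "nat \<Rightarrow> real" and A :: "nat \<Rightarrow> 'a set"
    assume 1: "\<tau> 0 = 0" "\<And>i. i < n \<Longrightarrow> \<tau> i \<le> \<tau> (Suc i)" "\<And>i. i \<le> n \<Longrightarrow> 0 \<le> \<tau> i" "\<And>i. A i \<in> sets borel"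
    \<comment> \<open>One more step, up to \<open>k\<close> and without constraint, makes the grid
      end at \<open>k\<close>, as \<open>increments_shift\<close> requires, even if all times of
      \<open>\<tau>\<close> are smaller.\<close>
    define \<sigma> where "\<sigma> i = (if i \<le> n then min (\<tau> i) k else k)" for i
    define C where "C i = (if i < n then A i else UNIV)" for i
    have \<sigma>: "\<And>i. i \<le> Suc n \<Longrightarrow> 0 \<le> \<sigma> i" "\<And>i. i < Suc n \<Longrightarrow> \<sigma> i \<le> \<sigma> (Suc i)" 
      "\<sigma> 0 = 0" "\<sigma> (Suc n) = k"
      using 1(1,3) k min.mono[OF 1(2) order.refl, of _ k] by (auto simp: \<sigma>_def Suc_le_eq)
    have C: "C i \<in> sets borel" for i using 1(4) by (simp add: C_def)
    have 2: "\<sigma> (Suc i) = min (\<tau> (Suc i)) k \<and> \<sigma> i = min (\<tau> i) k \<and> C i = A i" if "i < n" for i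
      using that by (simp add: \<sigma>_def C_def)
    have Cn: "C n = UNIV" by (simp add: C_def)
    let ?S = "{\<omega>\<in>space M. \<forall>i<n. stop k B (\<tau> (Suc i)) \<omega> - stop k B (\<tau> i) \<omega> \<in> A i}"
    have "?S = {\<omega>\<in>space M. \<forall>i<n. B (min (\<tau> (Suc i)) k) \<omega> - B (min (\<tau> i) k) \<omega> \<in> A i}"
      by (simp add: stop_def)
    also have "\<dots> \<in> sets M"
      by (rule sets_increments) (use 1 k in auto)
    finally have S: "?S \<in> sets M" .
    have "{\<omega>\<in>space M. \<forall>i<n. ?X (\<tau> (Suc i)) \<omega> - ?X (\<tau> i) \<omega> \<in> A i}
      = {\<omega>\<in>space M. \<forall>i<Suc n. B (\<sigma> (Suc i)) \<omega> - B (\<sigma> i) \<omega> + (\<sigma> (Suc i) - \<sigma> i) *\<^sub>R v \<in> C i}"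
      unfolding All_less_Suc Cn using 2 by (intro Collect_cong) (simp add: algebra_simps)
    also have "emeasure M \<dots> = (\<integral>\<^sup>+\<omega>. (\<Prod>i<Suc n. indicator (C i) (B (\<sigma> (Suc i)) \<omega> - B (\<sigma> i) \<omega>)) * ?e \<omega> \<partial>M)"
      by (rule increments_shift) (use \<sigma> C in auto)
    also have "\<dots> = (\<integral>\<^sup>+\<omega>. ?e \<omega> * indicator ?S \<omega> \<partial>M)"
    proof (intro nn_integral_cong)
      fix \<omega> assume \<omega>: "\<omega> \<in> space M"
      have "(\<Prod>i<Suc n. indicator (C i) (B (\<sigma> (Suc i)) \<omega> - B (\<sigma> i) \<omega>) :: ennreal)
        = (\<Prod>i<n. indicator (A i) (stop k B (\<tau> (Suc i)) \<omega> - stop k B (\<tau> i) \<omega>))"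
        unfolding prod.lessThan_Suc Cn using 2 by (simp add: stop_def)
      also have "\<dots> = indicator ?S \<omega>"
      proof (cases "\<omega> \<in> ?S")
        case True then show ?thesis by simp
      next
        case False
        then obtain i where "i < n" "stop k B (\<tau> (Suc i)) \<omega> - stop k B (\<tau> i) \<omega> \<notin> A i" using \<omega> by auto
        then show ?thesis using False by (auto intro!: prod_zero bexI[of _ i])
      qed
      finally show "(\<Prod>i<Suc n. indicator (C i) (B (\<sigma> (Suc i)) \<omega> - B (\<sigma> i) \<omega>)) * ?e \<omega>
        = ?e \<omega> * indicator ?S \<omega>"
        by (simp only: mult.commute)
    qed
    also have "\<dots> = emeasure (density M ?e) ?S"
      by (rule emeasure_density[OF _ S, symmetric]) measurable
    finally show "emeasure M {\<omega>\<in>space M. \<forall>i<n. ?X (\<tau> (Suc i)) \<omega> - ?X (\<tau> i) \<omega> \<in> A i}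
      = emeasure (density M ?e) {\<omega>\<in>space (density M ?e). \<forall>i<n. stop k B (\<tau> (Suc i)) \<omega> - stop k B (\<tau> i) \<omega> \<in> A i}"
      by simp
  qed (use k X fin in \<open>simp_all add: finite_measure_axioms measurable_stop start_BM stop_def\<close>)
  have "(\<integral>\<^sup>+\<omega>. F (traj ?X \<omega>) \<partial>M) = (\<integral>\<^sup>+w. F w \<partial>distr M path_space (traj ?X))"
    by (simp add: nn_integral_distr)
  also have "\<dots> = (\<integral>\<^sup>+\<omega>. F (traj (stop k B) \<omega>) \<partial>density M ?e)"
    unfolding law by (subst nn_integral_distr) auto
  also have "\<dots> = (\<integral>\<^sup>+\<omega>. F (traj (stop k B) \<omega>) * ?e \<omega> \<partial>M)"
    by (subst nn_integral_density) (auto simp: mult.commute)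
  finally show ?thesis .
qed

end

lemma measurable_path_component [measurable (raw)]:
  "0 \<le> s \<Longrightarrow> f \<in> measurable N path_space \<Longrightarrow> (\<lambda>x. f x s) \<in> borel_measurable N"
  using measurable_compose[OF _ measurable_component_singleton[of s "{0..}" "\<lambda>_. borel"], of f N] by simp

lemma measurable_path_fun:
  "(\<And>s. 0 \<le> s \<Longrightarrow> (\<lambda>x. f x s) \<in> borel_measurable N) \<Longrightarrow> (\<lambda>x. \<lambda>s\<in>{0..}. f x s) \<in> measurable N path_space"
  by (rule measurable_restrict) auto

section \<open>Mixtures of bridges\<close>

context standard_brownian_motion
begin

lemma sigma_finite_M: "sigma_finite_measure M" by unfold_locales

lemma traj_stopped_bridge:
  "traj (stop k (brownian_bridge B k u)) \<omega> = (\<lambda>s\<in>{0..}. B (min s k) \<omega> + (min s k / k) *\<^sub>R (u - B k \<omega>))"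
  by (simp add: traj_def stop_def brownian_bridge_def)

lemma measurable_stopped_bridge [measurable (raw)]:
  assumes k: "0 \<le> k" and f: "f \<in> borel_measurable N" and g: "g \<in> measurable N M"
  shows "(\<lambda>x. traj (stop k (brownian_bridge B k (f x))) (g x)) \<in> measurable N path_space"
  unfolding traj_stopped_bridge
proof (rule measurable_path_fun)
  fix s :: real assume "0 \<le> s"
  then have [measurable]: "B (min s k) \<in> borel_measurable M" "B k \<in> borel_measurable M"
    using k by (auto intro!: measurable_BM)
  note f [measurable] g [measurable]
  show "(\<lambda>x. B (min s k) (g x) + (min s k / k) *\<^sub>R (f x - B k (g x))) \<in> borel_measurable N"
    by measurable
qed

lemma measurable_nn_integral_bridge [measurable]:
  assumes k: "0 \<le> k" and F [measurable]: "F \<in> borel_measurable path_space"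
  shows "(\<lambda>u. \<integral>\<^sup>+\<omega>. F (traj (stop k (brownian_bridge B k u)) \<omega>) \<partial>M) \<in> borel_measurable borel"
proof -
  have "(\<lambda>p. traj (stop k (brownian_bridge B k (fst p))) (snd p)) \<in> measurable (borel \<Otimes>\<^sub>M M) path_space"
    using k by (intro measurable_stopped_bridge) auto
  then have "(\<lambda>p. F (traj (stop k (brownian_bridge B k (fst p))) (snd p))) \<in> borel_measurable (borel \<Otimes>\<^sub>M M)"
    by measurable
  then show ?thesis
    by (intro borel_measurable_nn_integral) (simp add: case_prod_unfold)
qed

text \<open>
  Integrating Girsanov's formula over the drift \<open>u / k\<close>, \<open>u\<close> ranging over \<open>\<real>\<^sup>d\<close>, and translating
  \<open>u\<close> by \<open>B k\<close> turns the drifted motion into the bridge, independently of \<open>B k\<close>.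
\<close>

theorem bridge_decomposition:
  assumes k: "0 < k" and F [measurable]: "F \<in> borel_measurable path_space"
  shows "(\<integral>\<^sup>+\<omega>. F (traj (stop k B) \<omega>) \<partial>M)
    = (\<integral>\<^sup>+u. ennreal (heat k u) * (\<integral>\<^sup>+\<omega>. F (traj (stop k (brownian_bridge B k u)) \<omega>) \<partial>M) \<partial>lborel)"
proof -
  interpret P: pair_sigma_finite M "lborel :: 'a measure" by unfold_locales
  let ?b = "\<lambda>u \<omega>. traj (stop k (brownian_bridge B k u)) \<omega>"
  have Bk [measurable]: "B k \<in> borel_measurable M" using k by (intro measurable_BM) auto
  have [measurable]: "traj (stop k B) \<in> measurable M path_space"
    using k by (auto intro!: measurable_traj measurable_stop)
  have b [measurable]: "(\<lambda>p. ?b (snd p) (fst p)) \<in> measurable (M \<Otimes>\<^sub>M lborel) path_space"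
    using k by (intro measurable_stopped_bridge) auto
  have b' [measurable]: "(\<lambda>p. ?b (B k (fst p) + snd p) (fst p)) \<in> measurable (M \<Otimes>\<^sub>M lborel) path_space"
    using k by (intro measurable_stopped_bridge) auto
  have tilt: "(\<integral>\<^sup>+\<omega>. F (?b (B k \<omega> + w) \<omega>) * ennreal (heat k (B k \<omega> + w)) \<partial>M)
      = (\<integral>\<^sup>+\<omega>. F (traj (stop k B) \<omega>) * ennreal (heat k (B k \<omega> - w)) \<partial>M)" for w
  proof -
    \<comment> \<open>Steered to \<open>B k \<omega> + w\<close>, the bridge is the motion with
      drift \<open>w / k\<close>. The heat weight depends only on the endpoint of that drifted path,
      so \<open>G\<close> carries it through \<open>girsanov\<close> along with
      \<open>F\<close>.\<close>
    define v where "v = (1 / k) *\<^sub>R w"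
    define G where "G p = F p * ennreal (heat k (p k))" for p
    have G: "G \<in> borel_measurable path_space" unfolding G_def by (measurable; use k in auto)
    have "(\<integral>\<^sup>+\<omega>. F (?b (B k \<omega> + w) \<omega>) * ennreal (heat k (B k \<omega> + w)) \<partial>M)
      = (\<integral>\<^sup>+\<omega>. G (traj (\<lambda>u \<omega>. B (min u k) \<omega> + min u k *\<^sub>R v) \<omega>) \<partial>M)"
    proof (intro nn_integral_cong)
      fix \<omega>
      have "?b (B k \<omega> + w) \<omega> = traj (\<lambda>u \<omega>. B (min u k) \<omega> + min u k *\<^sub>R v) \<omega>"
        unfolding traj_stopped_bridge by (simp add: traj_def v_def)
      then show "F (?b (B k \<omega> + w) \<omega>) * ennreal (heat k (B k \<omega> + w))
          = G (traj (\<lambda>u \<omega>. B (min u k) \<omega> + min u k *\<^sub>R v) \<omega>)"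
        using k by (simp add: G_def v_def)
    qed
    also have "\<dots> = (\<integral>\<^sup>+\<omega>. G (traj (stop k B) \<omega>) * ennreal (exp (v \<bullet> B k \<omega> - k * (norm v)\<^sup>2 / 2)) \<partial>M)"
      using k G by (intro girsanov) auto
    also have "\<dots> = (\<integral>\<^sup>+\<omega>. F (traj (stop k B) \<omega>) * ennreal (heat k (B k \<omega> - w)) \<partial>M)"
    proof (intro nn_integral_cong)
      fix \<omega>
      \<comment> \<open>The Girsanov density turns \<open>heat k (B k \<omega>)\<close> into a
        translate, whose integral over \<open>w\<close> will be \<open>1\<close>.\<close>
      have "heat k (B k \<omega> - w) = heat k (B k \<omega>) * exp (v \<bullet> B k \<omega> - k * (norm v)\<^sup>2 / 2)"
        using heat_shift[OF k, of "B k \<omega>" v] k by (simp add: v_def)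
      then show "G (traj (stop k B) \<omega>) * ennreal (exp (v \<bullet> B k \<omega> - k * (norm v)\<^sup>2 / 2))
          = F (traj (stop k B) \<omega>) * ennreal (heat k (B k \<omega> - w))"
        using k by (simp add: G_def stop_def ennreal_mult mult.assoc)
    qed
    finally show ?thesis .
  qed
  have "(\<integral>\<^sup>+u. ennreal (heat k u) * (\<integral>\<^sup>+\<omega>. F (?b u \<omega>) \<partial>M) \<partial>lborel)
      = (\<integral>\<^sup>+u. \<integral>\<^sup>+\<omega>. ennreal (heat k u) * F (?b u \<omega>) \<partial>M \<partial>lborel)"
    using k by (intro nn_integral_cong nn_integral_cmult[symmetric]) measurable
  also have "\<dots> = (\<integral>\<^sup>+\<omega>. \<integral>\<^sup>+u. ennreal (heat k u) * F (?b u \<omega>) \<partial>lborel \<partial>M)"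
    by (rule P.Fubini') (use b in \<open>simp add: case_prod_unfold\<close>)
  also have "\<dots> = (\<integral>\<^sup>+\<omega>. \<integral>\<^sup>+w. ennreal (heat k (B k \<omega> + w)) * F (?b (B k \<omega> + w) \<omega>) \<partial>lborel \<partial>M)"
    using k by (intro nn_integral_cong nn_integral_lborel_shift[symmetric]) measurable
  also have "\<dots> = (\<integral>\<^sup>+w. \<integral>\<^sup>+\<omega>. F (?b (B k \<omega> + w) \<omega>) * ennreal (heat k (B k \<omega> + w)) \<partial>M \<partial>lborel)"
    by (subst P.Fubini') (use b' in \<open>simp_all add: case_prod_unfold mult.commute\<close>)
  also have "\<dots> = (\<integral>\<^sup>+w. \<integral>\<^sup>+\<omega>. F (traj (stop k B) \<omega>) * ennreal (heat k (B k \<omega> - w)) \<partial>M \<partial>lborel)"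
    unfolding tilt ..
  also have "\<dots> = (\<integral>\<^sup>+\<omega>. \<integral>\<^sup>+w. F (traj (stop k B) \<omega>) * ennreal (heat k (B k \<omega> - w)) \<partial>lborel \<partial>M)"
    by (rule P.Fubini') measurable
  also have "\<dots> = (\<integral>\<^sup>+\<omega>. F (traj (stop k B) \<omega>) \<partial>M)"
  proof (intro nn_integral_cong)
    fix \<omega>
    have "(\<integral>\<^sup>+w. ennreal (heat k (B k \<omega> - w)) \<partial>lborel) = (\<integral>\<^sup>+w. ennreal (heat k (- B k \<omega> + w)) \<partial>lborel)"
      by (simp add: heat_commute[of k "B k \<omega>"])
    also have "\<dots> = (\<integral>\<^sup>+w. ennreal (heat k (w :: 'a)) \<partial>lborel)"
      by (rule nn_integral_lborel_shift) measurable
    also have "\<dots> = 1" by (rule nn_integral_heat[OF k])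
    finally show "(\<integral>\<^sup>+w. F (traj (stop k B) \<omega>) * ennreal (heat k (B k \<omega> - w)) \<partial>lborel) = F (traj (stop k B) \<omega>)"
      by (subst nn_integral_cmult) auto
  qed
  finally show ?thesis by simp
qed

lemma nn_integral_BM_add:
  assumes "0 \<le> s" "0 \<le> r" and [measurable]: "\<psi> \<in> borel_measurable borel"
  shows "(\<integral>\<^sup>+\<omega>. \<integral>\<^sup>+\<omega>'. \<psi> (B s \<omega> + B r \<omega>') \<partial>M \<partial>M) = (\<integral>\<^sup>+\<omega>. \<psi> (B (s + r) \<omega>) \<partial>M)"
proof -
  have "(\<lambda>p. \<psi> (fst p s + snd p r)) \<in> borel_measurable (path_space \<Otimes>\<^sub>M path_space)"
    by (measurable; use assms in auto)
  from markov[OF assms(1) this] show ?thesis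
    using assms by (simp add: stop_def restart_def)
qed

text \<open>The semigroup property of the heat kernel, read off from the Markov property instead of
  a convolution of Gaussians.\<close>

lemma nn_integral_heat_add:
  assumes "0 < s" "0 < r" and [measurable]: "\<psi> \<in> borel_measurable borel"
  shows "(\<integral>\<^sup>+u. ennreal (heat s u) * (\<integral>\<^sup>+y. ennreal (heat r y) * \<psi> (u + y) \<partial>lborel) \<partial>lborel)
    = (\<integral>\<^sup>+z. ennreal (heat (s + r) z) * \<psi> (z :: 'a) \<partial>lborel)"
proof -
  have "(\<integral>\<^sup>+z. ennreal (heat (s + r) z) * \<psi> (z :: 'a) \<partial>lborel) = (\<integral>\<^sup>+\<omega>. \<psi> (B (s + r) \<omega>) \<partial>M)"
    using assms by (subst nn_integral_BM) auto
  also have "\<dots> = (\<integral>\<^sup>+\<omega>. \<integral>\<^sup>+\<omega>'. \<psi> (B s \<omega> + B r \<omega>') \<partial>M \<partial>M)"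
    using assms by (subst nn_integral_BM_add) auto
  also have "\<dots> = (\<integral>\<^sup>+\<omega>. \<integral>\<^sup>+y. ennreal (heat r y) * \<psi> (B s \<omega> + y) \<partial>lborel \<partial>M)"
    using assms by (subst nn_integral_BM[of r]) auto
  also have "\<dots> = (\<integral>\<^sup>+u. ennreal (heat s u) * (\<integral>\<^sup>+y. ennreal (heat r y) * \<psi> (u + y) \<partial>lborel) \<partial>lborel)"
    using assms by (subst nn_integral_BM[of s]) auto
  finally show ?thesis by simp
qed

lemma nn_integral_heat_lincomb:
  assumes "0 < s" "0 < r" "\<alpha> \<noteq> 0" "\<beta> \<noteq> 0" and [measurable]: "\<psi> \<in> borel_measurable borel"
  shows "(\<integral>\<^sup>+u. ennreal (heat s u) * (\<integral>\<^sup>+y. ennreal (heat r y) * \<psi> (\<alpha> *\<^sub>R u + \<beta> *\<^sub>R y) \<partial>lborel) \<partial>lborel)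
    = (\<integral>\<^sup>+z. ennreal (heat (\<alpha>\<^sup>2 * s + \<beta>\<^sup>2 * r) z) * \<psi> (z :: 'a) \<partial>lborel)"
proof -
  have "(\<integral>\<^sup>+u. ennreal (heat s u) * (\<integral>\<^sup>+y. ennreal (heat r y) * \<psi> (\<alpha> *\<^sub>R u + \<beta> *\<^sub>R y) \<partial>lborel) \<partial>lborel)
    = (\<integral>\<^sup>+u. ennreal (heat s u) * (\<integral>\<^sup>+y. ennreal (heat (\<beta>\<^sup>2 * r) y) * \<psi> (\<alpha> *\<^sub>R u + y) \<partial>lborel) \<partial>lborel)"
    using assms by (subst nn_integral_heat_scale[of "\<lambda>y. \<psi> (\<alpha> *\<^sub>R _ + y)"]) auto
  also have "\<dots> = (\<integral>\<^sup>+u. ennreal (heat (\<alpha>\<^sup>2 * s) u) * (\<integral>\<^sup>+y. ennreal (heat (\<beta>\<^sup>2 * r) y) * \<psi> (u + y) \<partial>lborel) \<partial>lborel)"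
    using assms by (intro nn_integral_heat_scale) auto
  also have "\<dots> = (\<integral>\<^sup>+z. ennreal (heat (\<alpha>\<^sup>2 * s + \<beta>\<^sup>2 * r) z) * \<psi> (z :: 'a) \<partial>lborel)"
    using assms by (intro nn_integral_heat_add) auto
  finally show ?thesis .
qed

text \<open>Over the segment the bridge is the motion restarted at \<open>i\<close> plus a linear
  correction that involves \<open>x\<close> and \<open>B t\<close>. The parts of \<open>B t\<close>
  from before and after the segment are independent of it and add up to one Gaussian variable of
  variance \<open>t - k\<close>, so \<open>i\<close> disappears. Once the motion on the segment is
  written as a mixture of bridges, the correction only moves their endpoint.\<close>

theorem bridge_segment:
  assumes i: "0 \<le> i" and k: "0 < k" "k < t" and ikt: "i + k \<le> t" and F [measurable]: "F \<in> borel_measurable path_space"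
  shows "(\<integral>\<^sup>+\<omega>. F (traj (stop k (restart i (brownian_bridge B t x))) \<omega>) \<partial>M)
    = (\<integral>\<^sup>+u. ennreal (heat (k * (1 - k / t)) (u - (k / t) *\<^sub>R x)) *
        (\<integral>\<^sup>+\<omega>. F (traj (stop k (brownian_bridge B k u)) \<omega>) \<partial>M) \<partial>lborel)"
proof -
  interpret QM: pair_sigma_finite M M by unfold_locales
  interpret QL: pair_sigma_finite M "lborel :: 'a measure" by unfold_locales
  have t: "0 < t" using k by simp
  have [measurable]: "B i \<in> borel_measurable M" "B k \<in> borel_measurable M" "B (t - i) \<in> borel_measurable M"
     "B (t - i - k) \<in> borel_measurable M" "B (t - k) \<in> borel_measurable M"
    using i k ikt by (auto intro!: measurable_BM)
  have Bmin [measurable]: "B (min s k) \<in> borel_measurable M" if "0 \<le> s" for s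
    using that k by (intro measurable_BM) auto
  \<comment> \<open>Here \<open>y\<close> stands for the contribution to \<open>B t\<close> from
    outside the segment.\<close>
  define h where "h \<omega>' y = F (\<lambda>s\<in>{0..}. B (min s k) \<omega>' + (min s k / t) *\<^sub>R (x - B k \<omega>' - y))" for \<omega>' y
  have h_meas: "(\<lambda>z. h (f z) (g z)) \<in> borel_measurable N"
    if [measurable]: "f \<in> measurable N M" "g \<in> borel_measurable N" for N :: "'u measure" and f g
  proof -
    have [measurable]: "(\<lambda>z. \<lambda>s\<in>{0..}. B (min s k) (f z) + (min s k / t) *\<^sub>R (x - B k (f z) - g z)) \<in> measurable N path_space"
      by (intro measurable_path_fun) measurable
    show ?thesis unfolding h_def by measurable
  qed
  note hm [measurable] = h_meas
  define g where "g u = (\<integral>\<^sup>+\<omega>. F (traj (stop k (brownian_bridge B k u)) \<omega>) \<partial>M)" for u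
  have g [measurable]: "g \<in> borel_measurable borel"
    unfolding g_def using k by (intro measurable_nn_integral_bridge) auto
  have "(\<integral>\<^sup>+\<omega>. F (traj (stop k (restart i (brownian_bridge B t x))) \<omega>) \<partial>M)
      = (\<integral>\<^sup>+\<omega>. F (\<lambda>s\<in>{0..}. traj (restart i B) \<omega> (min s k) + (min s k / t) *\<^sub>R
          (x - traj (stop i B) \<omega> i - traj (restart i B) \<omega> (t - i))) \<partial>M)"
  proof (intro nn_integral_cong arg_cong[where f=F] ext)
    fix \<omega> s
    show "traj (stop k (restart i (brownian_bridge B t x))) \<omega> s = (\<lambda>s\<in>{0..}. traj (restart i B) \<omega> (min s k) + (min s k / t) *\<^sub>R
          (x - traj (stop i B) \<omega> i - traj (restart i B) \<omega> (t - i))) s"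
      using i k ikt t
      by (auto simp: traj_def stop_def restart_def brownian_bridge_def add_divide_distrib algebra_simps)
  qed
  \<comment> \<open>The Markov property at \<open>i\<close>, and next at \<open>k\<close> for the
    restarted motion, makes the three pieces of \<open>[0, t]\<close> independent.\<close>
  also have "\<dots> = (\<integral>\<^sup>+\<omega>. \<integral>\<^sup>+\<omega>'. F (\<lambda>s\<in>{0..}. traj B \<omega>' (min s k) + (min s k / t) *\<^sub>R
          (x - traj (stop i B) \<omega> i - traj B \<omega>' (t - i))) \<partial>M \<partial>M)"
  proof -
    define F2 where "F2 p = F (\<lambda>s\<in>{0..}. snd p (min s k) + (min s k / t) *\<^sub>R (x - fst p i - snd p (t - i)))" for p
    have "(\<lambda>p. \<lambda>s\<in>{0..}. snd p (min s k) + (min s k / t) *\<^sub>R (x - fst p i - snd p (t - i)))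
        \<in> measurable (path_space \<Otimes>\<^sub>M path_space) path_space"
      by (intro measurable_path_fun; measurable; use i k ikt in auto)
    then have "F2 \<in> borel_measurable (path_space \<Otimes>\<^sub>M path_space)"
      unfolding F2_def by measurable
    from markov[OF i this] show ?thesis by (simp add: F2_def)
  qed
  also have "\<dots> = (\<integral>\<^sup>+\<omega>. \<integral>\<^sup>+\<omega>'. \<integral>\<^sup>+\<omega>''. h \<omega>' (B i \<omega> + B (t - i - k) \<omega>'') \<partial>M \<partial>M \<partial>M)"
  proof (rule nn_integral_cong)
    fix \<omega>
    define y where "y = B i \<omega>"
    define F2 where "F2 p = F (\<lambda>s\<in>{0..}. fst p (min s k) + (min s k / t) *\<^sub>R (x - fst p k - (y + snd p (t - i - k))))" for p
    have "(\<lambda>p. \<lambda>s\<in>{0..}. fst p (min s k) + (min s k / t) *\<^sub>R (x - fst p k - (y + snd p (t - i - k))))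
        \<in> measurable (path_space \<Otimes>\<^sub>M path_space) path_space"
      by (intro measurable_path_fun; measurable; use i k ikt in auto)
    then have F2: "F2 \<in> borel_measurable (path_space \<Otimes>\<^sub>M path_space)"
      unfolding F2_def by measurable
    have "(\<integral>\<^sup>+\<omega>'. F (\<lambda>s\<in>{0..}. traj B \<omega>' (min s k) + (min s k / t) *\<^sub>R
          (x - traj (stop i B) \<omega> i - traj B \<omega>' (t - i))) \<partial>M)
      = (\<integral>\<^sup>+\<omega>'. F2 (traj (stop k B) \<omega>', traj (restart k B) \<omega>') \<partial>M)"
    proof (intro nn_integral_cong)
      fix \<omega>'
      show "F (\<lambda>s\<in>{0..}. traj B \<omega>' (min s k) + (min s k / t) *\<^sub>R
          (x - traj (stop i B) \<omega> i - traj B \<omega>' (t - i))) = F2 (traj (stop k B) \<omega>', traj (restart k B) \<omega>')"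
        unfolding F2_def using i k ikt
        by (intro arg_cong[where f=F] ext) (auto simp: stop_def restart_def y_def algebra_simps)
    qed
    also have "\<dots> = (\<integral>\<^sup>+\<omega>'. \<integral>\<^sup>+\<omega>''. F2 (traj (stop k B) \<omega>', traj B \<omega>'') \<partial>M \<partial>M)"
      using k F2 by (intro markov) auto
    also have "\<dots> = (\<integral>\<^sup>+\<omega>'. \<integral>\<^sup>+\<omega>''. h \<omega>' (B i \<omega> + B (t - i - k) \<omega>'') \<partial>M \<partial>M)"
    proof (intro nn_integral_cong)
      fix \<omega>' \<omega>''
      show "F2 (traj (stop k B) \<omega>', traj B \<omega>'') = h \<omega>' (B i \<omega> + B (t - i - k) \<omega>'')"
        unfolding F2_def h_def using i k ikt
        by (intro arg_cong[where f=F] ext) (auto simp: stop_def y_def)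
    qed
    finally show "(\<integral>\<^sup>+\<omega>'. F (\<lambda>s\<in>{0..}. traj B \<omega>' (min s k) + (min s k / t) *\<^sub>R
          (x - traj (stop i B) \<omega> i - traj B \<omega>' (t - i))) \<partial>M)
       = (\<integral>\<^sup>+\<omega>'. \<integral>\<^sup>+\<omega>''. h \<omega>' (B i \<omega> + B (t - i - k) \<omega>'') \<partial>M \<partial>M)" .
  qed
  also have "\<dots> = (\<integral>\<^sup>+\<omega>'. \<integral>\<^sup>+\<omega>. \<integral>\<^sup>+\<omega>''. h \<omega>' (B i \<omega> + B (t - i - k) \<omega>'') \<partial>M \<partial>M \<partial>M)"
    by (rule QM.Fubini') measurable
  \<comment> \<open>The outer pieces, of lengths \<open>i\<close> and \<open>t - i - k\<close>,
    merge into one of length \<open>t - k\<close>.\<close>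
  also have "\<dots> = (\<integral>\<^sup>+\<omega>'. \<integral>\<^sup>+\<omega>. h \<omega>' (B (t - k) \<omega>) \<partial>M \<partial>M)"
  proof (rule nn_integral_cong)
    fix \<omega>' assume "\<omega>' \<in> space M"
    then have "h \<omega>' \<in> borel_measurable borel" by measurable
    from nn_integral_BM_add[OF i _ this, of "t - i - k"]
    show "(\<integral>\<^sup>+\<omega>. \<integral>\<^sup>+\<omega>''. h \<omega>' (B i \<omega> + B (t - i - k) \<omega>'') \<partial>M \<partial>M) = (\<integral>\<^sup>+\<omega>. h \<omega>' (B (t - k) \<omega>) \<partial>M)"
      using ikt by (simp add: algebra_simps)
  qed
  also have "\<dots> = (\<integral>\<^sup>+\<omega>'. \<integral>\<^sup>+y. ennreal (heat (t - k) y) * h \<omega>' y \<partial>lborel \<partial>M)"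
    using k by (intro nn_integral_cong nn_integral_BM) auto
  also have "\<dots> = (\<integral>\<^sup>+y. \<integral>\<^sup>+\<omega>'. ennreal (heat (t - k) y) * h \<omega>' y \<partial>M \<partial>lborel)"
    by (rule QL.Fubini'[symmetric]) measurable
  also have "\<dots> = (\<integral>\<^sup>+y. ennreal (heat (t - k) y) * (\<integral>\<^sup>+u. ennreal (heat k u) *
      g ((1 - k / t) *\<^sub>R u + (- (k / t)) *\<^sub>R y + (k / t) *\<^sub>R x) \<partial>lborel) \<partial>lborel)"
  proof (rule nn_integral_cong)
    fix y :: 'a
    define F2 where "F2 w = F (\<lambda>s\<in>{0..}. w (min s k) + (min s k / t) *\<^sub>R (x - w k - y))" for w
    have "(\<lambda>w. \<lambda>s\<in>{0..}. w (min s k) + (min s k / t) *\<^sub>R (x - w k - y)) \<in> measurable path_space path_space"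
      by (intro measurable_path_fun; measurable; use k in auto)
    then have F2: "F2 \<in> borel_measurable path_space" unfolding F2_def by measurable
    have "(\<integral>\<^sup>+\<omega>'. ennreal (heat (t - k) y) * h \<omega>' y \<partial>M) = ennreal (heat (t - k) y) * (\<integral>\<^sup>+\<omega>'. h \<omega>' y \<partial>M)"
      by (rule nn_integral_cmult) measurable
    also have "(\<integral>\<^sup>+\<omega>'. h \<omega>' y \<partial>M) = (\<integral>\<^sup>+\<omega>'. F2 (traj (stop k B) \<omega>') \<partial>M)"
      unfolding h_def F2_def using k by (intro nn_integral_cong arg_cong[where f=F] ext) (auto simp: stop_def)
    also have "\<dots> = (\<integral>\<^sup>+u. ennreal (heat k u) * (\<integral>\<^sup>+\<omega>. F2 (traj (stop k (brownian_bridge B k u)) \<omega>) \<partial>M) \<partial>lborel)"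
      by (rule bridge_decomposition[OF k(1) F2])
    \<comment> \<open>A bridge plus a linear function of time is again a bridge; only its endpoint
      changes.\<close>
    also have "\<dots> = (\<integral>\<^sup>+u. ennreal (heat k u) * g ((1 - k / t) *\<^sub>R u + (- (k / t)) *\<^sub>R y + (k / t) *\<^sub>R x) \<partial>lborel)"
      unfolding g_def F2_def
    proof (intro nn_integral_cong arg_cong2[of _ _ _ _ "(*)"] refl arg_cong[where f=F] ext)
      fix u \<omega> s
      show "(\<lambda>s\<in>{0..}. traj (stop k (brownian_bridge B k u)) \<omega> (min s k) +
              (min s k / t) *\<^sub>R (x - traj (stop k (brownian_bridge B k u)) \<omega> k - y)) s =
          traj (stop k (brownian_bridge B k ((1 - k / t) *\<^sub>R u + (- (k / t)) *\<^sub>R y + (k / t) *\<^sub>R x))) \<omega> s"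
        using k t
        by (auto simp: traj_stopped_bridge) (simp add: algebra_simps)
    qed
    finally show "(\<integral>\<^sup>+\<omega>'. ennreal (heat (t - k) y) * h \<omega>' y \<partial>M) = ennreal (heat (t - k) y) *
      (\<integral>\<^sup>+u. ennreal (heat k u) * g ((1 - k / t) *\<^sub>R u + (- (k / t)) *\<^sub>R y + (k / t) *\<^sub>R x) \<partial>lborel)" .
  qed
  also have "\<dots> = (\<integral>\<^sup>+y. ennreal (heat (t - k) y) * (\<integral>\<^sup>+u. ennreal (heat k u) *
      g ((- (k / t)) *\<^sub>R y + (1 - k / t) *\<^sub>R u + (k / t) *\<^sub>R x) \<partial>lborel) \<partial>lborel)"
    by (simp add: add.commute)
  also have "\<dots> = (\<integral>\<^sup>+z. ennreal (heat ((- (k / t))\<^sup>2 * (t - k) + (1 - k / t)\<^sup>2 * k) z) * g (z + (k / t) *\<^sub>R x) \<partial>lborel)"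
    using k t by (intro nn_integral_heat_lincomb) auto
  also have "(- (k / t))\<^sup>2 * (t - k) + (1 - k / t)\<^sup>2 * k = k * (1 - k / t)"
    using t by (simp add: power2_eq_square field_simps)
  also have "(\<integral>\<^sup>+z. ennreal (heat (k * (1 - k / t)) z) * g (z + (k / t) *\<^sub>R x) \<partial>lborel)
     = (\<integral>\<^sup>+z. ennreal (heat (k * (1 - k / t)) ((k / t) *\<^sub>R x + z - (k / t) *\<^sub>R x)) * g ((k / t) *\<^sub>R x + z) \<partial>lborel)"
    by (simp add: add.commute)
  also have "\<dots> = (\<integral>\<^sup>+u. ennreal (heat (k * (1 - k / t)) (u - (k / t) *\<^sub>R x)) * g u \<partial>lborel)"
    by (rule nn_integral_lborel_shift) measurable
  finally show ?thesis unfolding g_def .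
qed

text \<open>For \<open>a = x / t\<close> this is the mixture of \<open>bridge_segment\<close> with
  variance \<open>k\<close> in place of \<open>k * (1 - k / t)\<close>. Comparing the two Gaussian
  weights therefore compares the bridge with drifted motion.\<close>

theorem drift_decomposition:
  assumes k: "0 < k" and F [measurable]: "F \<in> borel_measurable path_space"
  shows "(\<integral>\<^sup>+\<omega>. F (traj (stop k (\<lambda>s \<omega>. B s \<omega> + s *\<^sub>R a)) \<omega>) \<partial>M)
    = (\<integral>\<^sup>+u. ennreal (heat k (u - k *\<^sub>R a)) * (\<integral>\<^sup>+\<omega>. F (traj (stop k (brownian_bridge B k u)) \<omega>) \<partial>M) \<partial>lborel)"
proof -
  define g where "g u = (\<integral>\<^sup>+\<omega>. F (traj (stop k (brownian_bridge B k u)) \<omega>) \<partial>M)" for u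
  have g [measurable]: "g \<in> borel_measurable borel"
    unfolding g_def using k by (intro measurable_nn_integral_bridge) auto
  define F2 where "F2 w = F (\<lambda>s\<in>{0..}. w s + min s k *\<^sub>R a)" for w
  have "(\<lambda>w. \<lambda>s\<in>{0..}. w s + min s k *\<^sub>R a) \<in> measurable path_space path_space"
    by (intro measurable_path_fun; measurable; auto)
  then have F2: "F2 \<in> borel_measurable path_space" unfolding F2_def by measurable
  have "(\<integral>\<^sup>+\<omega>. F (traj (stop k (\<lambda>s \<omega>. B s \<omega> + s *\<^sub>R a)) \<omega>) \<partial>M) = (\<integral>\<^sup>+\<omega>. F2 (traj (stop k B) \<omega>) \<partial>M)"
    unfolding F2_def by (intro nn_integral_cong arg_cong[where f=F] ext) (auto simp: traj_def stop_def)
  also have "\<dots> = (\<integral>\<^sup>+u. ennreal (heat k u) * (\<integral>\<^sup>+\<omega>. F2 (traj (stop k (brownian_bridge B k u)) \<omega>) \<partial>M) \<partial>lborel)"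
    by (rule bridge_decomposition[OF k F2])
  also have "\<dots> = (\<integral>\<^sup>+u. ennreal (heat k (k *\<^sub>R a + u - k *\<^sub>R a)) * g (k *\<^sub>R a + u) \<partial>lborel)"
    unfolding g_def F2_def
  proof (intro nn_integral_cong arg_cong2[of _ _ _ _ "(*)"] arg_cong[where f=F] ext)
    fix u \<omega> s
    show "(\<lambda>s\<in>{0..}. traj (stop k (brownian_bridge B k u)) \<omega> s + min s k *\<^sub>R a) s
        = traj (stop k (brownian_bridge B k (k *\<^sub>R a + u))) \<omega> s"
      using k by (auto simp: traj_stopped_bridge) (simp add: algebra_simps)
  qed simp
  also have "\<dots> = (\<integral>\<^sup>+u. ennreal (heat k (u - k *\<^sub>R a)) * g u \<partial>lborel)"
    by (rule nn_integral_lborel_shift) measurable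
  finally show ?thesis unfolding g_def .
qed

end

section \<open>Hitting events and the volume they sweep out\<close>

text \<open>
  Testing only rational times makes \<open>hitq\<close> measurable on the product space of all paths; for
  continuous paths and closed \<open>K\<close> it means that \<open>K\<close> is hit during \<open>[a, b]\<close> (\<open>hitq_iff\<close>).
\<close>

definition hitq :: "'a::metric_space set \<Rightarrow> real \<Rightarrow> real \<Rightarrow> (real \<Rightarrow> 'a) \<Rightarrow> bool" where
  "hitq K a b w \<longleftrightarrow> (\<forall>n::nat. \<exists>q\<in>\<rat> \<inter> {a..b}. infdist (w q) K < 1 / real (Suc n))"

lemma hitq_mono: "hitq K a b w \<Longrightarrow> a' \<le> a \<Longrightarrow> b \<le> b' \<Longrightarrow> hitq K a' b' w"
  unfolding hitq_def by (force simp: Bex_def)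

lemma hitq_cong: "(\<And>s. a \<le> s \<Longrightarrow> s \<le> b \<Longrightarrow> w s = w' s) \<Longrightarrow> hitq K a b w = hitq K a b w'"
  unfolding hitq_def by (intro iff_allI bex_cong refl) auto

text \<open>Holds for every path, continuous or not: if the two halves fail at levels
  \<open>m\<close> and \<open>n\<close>, then the whole interval fails at level
  \<open>max m n\<close>.\<close>

lemma hitq_Un:
  assumes "a \<le> b" "b \<le> c"
  shows "hitq K a c w \<longleftrightarrow> hitq K a b w \<or> hitq K b c w"
proof
  assume ac: "hitq K a c w"
  show "hitq K a b w \<or> hitq K b c w"
  proof (rule ccontr)
    assume "\<not> ?thesis"
    then obtain m n where
      m: "\<And>q. q \<in> \<rat> \<inter> {a..b} \<Longrightarrow> \<not> infdist (w q) K < 1 / real (Suc m)" and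
      n: "\<And>q. q \<in> \<rat> \<inter> {b..c} \<Longrightarrow> \<not> infdist (w q) K < 1 / real (Suc n)"
      unfolding hitq_def by blast
    from ac obtain q where "q \<in> \<rat> \<inter> {a..c}" and q4: "infdist (w q) K < 1 / real (Suc (max m n))"
      unfolding hitq_def by blast
    then have q: "q \<in> \<rat>" "a \<le> q" "q \<le> c" by auto
    have "1 / real (Suc (max m n)) \<le> 1 / real (Suc m)" "1 / real (Suc (max m n)) \<le> 1 / real (Suc n)"
      by (auto intro!: divide_left_mono)
    with q q4 m[of q] n[of q] show False by (cases "q \<le> b") auto
  qed
next
  assume "hitq K a b w \<or> hitq K b c w"
  then show "hitq K a c w" using assms by (auto elim: hitq_mono)
qed

text \<open>The shift is rational so that the set of tested times is preserved.\<close>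

lemma hitq_shift:
  assumes "c \<in> \<rat>"
  shows "hitq K (c + a) (c + b) w \<longleftrightarrow> hitq K a b (\<lambda>s. w (c + s))"
proof -
  have "(\<exists>q\<in>\<rat> \<inter> {c + a..c + b}. P (w q)) \<longleftrightarrow> (\<exists>q\<in>\<rat> \<inter> {a..b}. P (w (c + q)))" for P
  proof
    assume "\<exists>q\<in>\<rat> \<inter> {c + a..c + b}. P (w q)"
    then obtain q where "q \<in> \<rat>" "c + a \<le> q" "q \<le> c + b" "P (w q)" by auto
    then show "\<exists>q\<in>\<rat> \<inter> {a..b}. P (w (c + q))"
      using assms by (intro bexI[of _ "q - c"]) auto
  next
    assume "\<exists>q\<in>\<rat> \<inter> {a..b}. P (w (c + q))"
    then obtain q where "q \<in> \<rat>" "a \<le> q" "q \<le> b" "P (w (c + q))" by auto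
    then show "\<exists>q\<in>\<rat> \<inter> {c + a..c + b}. P (w q)"
      using assms by (intro bexI[of _ "c + q"]) auto
  qed
  from this[of "\<lambda>y. infdist y K < 1 / real (Suc _)"] show ?thesis
    unfolding hitq_def by (intro iff_allI)
qed

text \<open>On the compact interval the distance to \<open>K\<close> attains its minimum, which lies
  below every threshold. Conversely, rational times inside the interval approach the hitting time;
  here \<open>a < b\<close> matters.\<close>

lemma hitq_iff:
  fixes K :: "'a::metric_space set"
  assumes K: "closed K" "K \<noteq> {}" and ab: "a < b" and w: "continuous_on {a..b} w"
  shows "hitq K a b w \<longleftrightarrow> (\<exists>s\<in>{a..b}. w s \<in> K)"
proof
  assume h: "hitq K a b w"
  have "continuous_on {a..b} (\<lambda>s. infdist (w s) K)"
    by (intro continuous_on_infdist w)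
  then obtain s where s: "s \<in> {a..b}" "\<And>q. q \<in> {a..b} \<Longrightarrow> infdist (w s) K \<le> infdist (w q) K"
    using continuous_attains_inf[of "{a..b}" "\<lambda>s. infdist (w s) K"] ab by auto
  have "infdist (w s) K < 1 / real (Suc n)" for n
    using h s unfolding hitq_def by (metis IntE order.strict_trans1)
  then have "infdist (w s) K \<le> 0"
    by (metis nat_approx_posE not_less order_less_asym)
  then have "infdist (w s) K = 0" using infdist_nonneg[of "w s" K] by simp
  then show "\<exists>s\<in>{a..b}. w s \<in> K"
    using s(1) K in_closed_iff_infdist_zero by blast
next
  assume "\<exists>s\<in>{a..b}. w s \<in> K"
  then obtain s where s: "s \<in> {a..b}" "w s \<in> K" by auto
  show "hitq K a b w" unfolding hitq_def
  proof
    fix n :: nat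
    obtain d where d: "d > 0" "\<And>q. q \<in> {a..b} \<Longrightarrow> dist q s < d \<Longrightarrow> dist (w q) (w s) < 1 / real (Suc n)"
      using w s(1) unfolding continuous_on_iff by (metis of_nat_0_less_iff zero_less_Suc zero_less_divide_1_iff)
    have "max a (s - d) < min b (s + d)" using ab s(1) d(1) by auto
    then obtain q where q: "q \<in> \<rat>" "max a (s - d) < q" "q < min b (s + d)"
      using Rats_dense_in_real by blast
    then have "dist q s < d" "q \<in> {a..b}" by (auto simp: dist_real_def)
    with d have "dist (w q) (w s) < 1 / real (Suc n)" by auto
    then have "infdist (w q) K < 1 / real (Suc n)"
      using infdist_le[OF s(2), of "w q"] by simp
    then show "\<exists>q\<in>\<rat> \<inter> {a..b}. infdist (w q) K < 1 / real (Suc n)"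
      using q \<open>q \<in> {a..b}\<close> by blast
  qed
qed

text \<open>Points of \<open>path_space\<close> are restricted functions, while processes have total
  paths. Insensitivity to negative times lets the same event be evaluated on both.\<close>

definition path_event :: "((real \<Rightarrow> 'a::euclidean_space) \<Rightarrow> bool) \<Rightarrow> bool" where
  "path_event Q \<longleftrightarrow> Measurable.pred path_space Q \<and> (\<forall>w w'. (\<forall>s\<ge>0. w s = w' s) \<longrightarrow> Q w = Q w')"

lemma path_event_pred:
  assumes Q: "path_event Q" and f: "\<And>s. 0 \<le> s \<Longrightarrow> (\<lambda>x. f x s) \<in> borel_measurable N"
  shows "Measurable.pred N (\<lambda>x. Q (f x))"
proof -
  have "Q (f x) = Q (\<lambda>s\<in>{0..}. f x s)" for x
    using Q unfolding path_event_def by (metis atLeast_iff restrict_apply')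
  moreover have "Measurable.pred N (\<lambda>x. Q (\<lambda>s\<in>{0..}. f x s))"
    using Q measurable_path_fun[of f N, OF f] unfolding path_event_def
    by (intro measurable_compose[of _ N path_space Q]) auto
  ultimately show ?thesis by simp
qed

lemma path_event_cong: "path_event Q \<Longrightarrow> (\<And>s. 0 \<le> s \<Longrightarrow> w s = w' s) \<Longrightarrow> Q w = Q w'"
  unfolding path_event_def by blast

lemma path_event_hitq:
  assumes "0 \<le> a" shows "path_event (hitq K a b)"
  unfolding path_event_def
proof safe
  have c: "countable (\<rat> \<inter> {a..b})" by (intro countable_Int1 countable_rat)
  have m: "(\<lambda>w. w q) \<in> borel_measurable path_space" if "q \<in> \<rat> \<inter> {a..b}" for q
    using that assms by (intro measurable_component_singleton) auto
  have "Measurable.pred path_space (\<lambda>w. \<exists>q\<in>\<rat> \<inter> {a..b}. infdist (w q) K < e)" for e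
    unfolding pred_def
  proof (rule sets.sets_Collect_countable_Ex'[OF _ c])
    fix q assume q: "q \<in> \<rat> \<inter> {a..b}"
    have "(\<lambda>y. infdist y K) \<in> borel_measurable borel"
      by (intro borel_measurable_continuous_onI continuous_intros)
    then have [measurable]: "(\<lambda>w. infdist (w q) K) \<in> borel_measurable path_space"
      using m[OF q] by (rule measurable_compose[rotated])
    show "{w \<in> space path_space. infdist (w q) K < e} \<in> sets path_space"
      by measurable
  qed
  then show "Measurable.pred path_space (hitq K a b)"
    unfolding hitq_def[abs_def] by (intro pred_intros_countable)
qed (use assms hitq_cong in \<open>metis order.trans\<close>)+

lemma path_event_conj: "path_event P \<Longrightarrow> path_event Q \<Longrightarrow> path_event (\<lambda>w. P w \<and> Q w)"
  unfolding path_event_def by (auto intro: pred_intros_logic)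

lemma path_event_not: "path_event P \<Longrightarrow> path_event (\<lambda>w. \<not> P w)"
  unfolding path_event_def by (auto intro: pred_intros_logic)

lemma path_event_ex: "(\<And>n::nat. path_event (P n)) \<Longrightarrow> path_event (\<lambda>w. \<exists>n. P n w)"
  unfolding path_event_def by (auto intro: pred_intros_countable)

lemma path_event_shift:
  assumes "path_event Q" "0 \<le> c" shows "path_event (\<lambda>w. Q (\<lambda>s. w (c + s)))"
  unfolding path_event_def
proof safe
  show "Measurable.pred path_space (\<lambda>w. Q (\<lambda>s. w (c + s)))"
    using assms by (intro path_event_pred measurable_component_singleton) auto
  fix w w' :: "real \<Rightarrow> 'a" assume "\<forall>s\<ge>0. w s = w' s"
  then have "\<And>s. 0 \<le> s \<Longrightarrow> w (c + s) = w' (c + s)" using assms by auto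
  then show "Q (\<lambda>s. w (c + s)) \<Longrightarrow> Q (\<lambda>s. w' (c + s))" "Q (\<lambda>s. w' (c + s)) \<Longrightarrow> Q (\<lambda>s. w (c + s))"
    using path_event_cong[OF assms(1), of "\<lambda>s. w (c + s)" "\<lambda>s. w' (c + s)"] by auto
qed

definition vol :: "((real \<Rightarrow> 'a::euclidean_space) \<Rightarrow> bool) \<Rightarrow> (real \<Rightarrow> 'a) \<Rightarrow> ennreal" where
  "vol Q w = (\<integral>\<^sup>+z. indicator (Collect Q) (\<lambda>s. z + w s) \<partial>lborel)"

lemma vol_mono: "(\<And>w. Q w \<Longrightarrow> Q' w) \<Longrightarrow> vol Q w \<le> vol Q' w"
  unfolding vol_def by (intro nn_integral_mono) (auto simp: indicator_def)

lemma vol_cong: "path_event Q \<Longrightarrow> (\<And>s. 0 \<le> s \<Longrightarrow> w s = w' s) \<Longrightarrow> vol Q w = vol Q w'"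
  unfolding vol_def indicator_def mem_Collect_eq
  by (intro nn_integral_cong arg_cong[where f=of_bool] path_event_cong) auto

lemma path_event_slice_measurable:
  assumes "path_event Q"
  shows "(\<lambda>z. indicator (Collect Q) (\<lambda>s. z + w s) :: ennreal) \<in> borel_measurable borel"
proof -
  have "Measurable.pred borel (\<lambda>z. Q (\<lambda>s. z + w s))"
    by (intro path_event_pred assms) measurable
  then show ?thesis unfolding indicator_def mem_Collect_eq of_bool_def by measurable
qed

lemma vol_translate:
  assumes "path_event Q" shows "vol Q (\<lambda>s. c + w s) = vol Q w"
proof -
  have "vol Q (\<lambda>s. c + w s) = (\<integral>\<^sup>+z. indicator (Collect Q) (\<lambda>s. (c + z) + w s) \<partial>lborel)"
    unfolding vol_def by (simp add: ac_simps)
  also have "\<dots> = vol Q w"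
    unfolding vol_def
    using nn_integral_lborel_shift[OF path_event_slice_measurable[OF assms, of w], of c] by simp
  finally show ?thesis .
qed

lemma vol_pair_measurable:
  fixes N :: "'n measure"
  assumes Q: "path_event Q" and f: "\<And>s. 0 \<le> s \<Longrightarrow> (\<lambda>x. f x s) \<in> borel_measurable N"
  shows "(\<lambda>p. indicator (Collect Q) (\<lambda>s. snd p + f (fst p) s) :: ennreal) \<in> borel_measurable (N \<Otimes>\<^sub>M lborel)"
proof -
  have "Measurable.pred (N \<Otimes>\<^sub>M lborel) (\<lambda>p. Q (\<lambda>s. snd p + f (fst p) s))"
  proof (intro path_event_pred Q)
    fix s :: real assume "0 \<le> s"
    from f[OF this] have [measurable]: "(\<lambda>x. f x s) \<in> borel_measurable N" .
    show "(\<lambda>p. snd p + f (fst p) s) \<in> borel_measurable (N \<Otimes>\<^sub>M lborel)" by measurable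
  qed
  then show ?thesis unfolding indicator_def mem_Collect_eq of_bool_def by measurable
qed

lemma vol_measurable [measurable]:
  assumes "path_event Q" shows "vol Q \<in> borel_measurable path_space"
  unfolding vol_def
  using vol_pair_measurable[OF assms, of "\<lambda>w s. w s" path_space]
  by (intro lborel.borel_measurable_nn_integral) (simp add: case_prod_unfold)

text \<open>Fubini's theorem exchanges expectation with the integral over starting points; in this
  way every expected volume becomes an integral of probabilities.\<close>

lemma nn_integral_vol:
  assumes N: "sigma_finite_measure N" and Q: "path_event Q" and X: "\<And>s. 0 \<le> s \<Longrightarrow> X s \<in> borel_measurable N"
  shows "(\<integral>\<^sup>+\<omega>. vol Q (traj X \<omega>) \<partial>N) = (\<integral>\<^sup>+z. emeasure N {\<omega>\<in>space N. Q (\<lambda>s. z + X s \<omega>)} \<partial>lborel)"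
proof -
  interpret N: sigma_finite_measure N by fact
  interpret P: pair_sigma_finite N "lborel :: 'b measure" by unfold_locales
  have "(\<integral>\<^sup>+\<omega>. vol Q (traj X \<omega>) \<partial>N) = (\<integral>\<^sup>+\<omega>. vol Q (\<lambda>s. X s \<omega>) \<partial>N)"
    by (intro nn_integral_cong vol_cong Q) simp
  also have "\<dots> = (\<integral>\<^sup>+z. \<integral>\<^sup>+\<omega>. indicator (Collect Q) (\<lambda>s. z + X s \<omega>) \<partial>N \<partial>lborel)"
    unfolding vol_def using vol_pair_measurable[OF Q, of "\<lambda>\<omega> s. X s \<omega>" N] X
    by (intro P.Fubini'[symmetric]) (simp add: case_prod_unfold)
  also have "\<dots> = (\<integral>\<^sup>+z. emeasure N {\<omega>\<in>space N. Q (\<lambda>s. z + X s \<omega>)} \<partial>lborel)"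
  proof (intro nn_integral_cong)
    fix z :: 'b
    have m: "Measurable.pred N (\<lambda>\<omega>. Q (\<lambda>s. z + X s \<omega>))"
      by (intro path_event_pred Q borel_measurable_add X) auto
    have "(\<integral>\<^sup>+\<omega>. indicator (Collect Q) (\<lambda>s. z + X s \<omega>) \<partial>N)
      = (\<integral>\<^sup>+\<omega>. indicator {\<omega>\<in>space N. Q (\<lambda>s. z + X s \<omega>)} \<omega> \<partial>N)"
      by (intro nn_integral_cong) (simp add: indicator_def)
    also have "\<dots> = emeasure N {\<omega>\<in>space N. Q (\<lambda>s. z + X s \<omega>)}"
      using m by (intro nn_integral_indicator) (simp add: pred_def)
    finally show "(\<integral>\<^sup>+\<omega>. indicator (Collect Q) (\<lambda>s. z + X s \<omega>) \<partial>N) = emeasure N {\<omega>\<in>space N. Q (\<lambda>s. z + X s \<omega>)}" .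
  qed
  finally show ?thesis .
qed

section \<open>Tails of the running maximum\<close>

text \<open>\<open>1 + x \<le> (n + 1) * (1 + x / n)\<close> and
  \<open>(1 + x / n) ^ n \<le> exp x\<close> reduce the power to an exponential; completing the
  square gives \<open>x - c * x\<^sup>2 \<le> 1 / (4 * c)\<close>.\<close>

lemma power_exp_bound:
  fixes u :: "'a::real_normed_vector"
  assumes c: "0 < c"
  shows "(1 + norm u) ^ n * exp (- c * (norm u)\<^sup>2) \<le> (real n + 1) ^ n * exp (1 / (4 * c))"
proof -
  define x where "x = norm u"
  have x: "0 \<le> x" by (simp add: x_def)
  have "(1 + x) ^ n \<le> (real n + 1) ^ n * exp x"
  proof (cases "n = 0")
    case False
    have "1 + x \<le> (real n + 1) * (1 + x / real n)" using x False by (simp add: field_simps)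
    then have "(1 + x) ^ n \<le> ((real n + 1) * (1 + x / real n)) ^ n" using x by (intro power_mono) auto
    also have "\<dots> = (real n + 1) ^ n * (1 + x / real n) ^ n" by (rule power_mult_distrib)
    also have "\<dots> \<le> (real n + 1) ^ n * exp x"
      using exp_ge_one_plus_x_over_n_power_n[of n x] x False by (intro mult_left_mono) auto
    finally show ?thesis .
  qed (use x in simp)
  then have "(1 + x) ^ n * exp (- c * x\<^sup>2) \<le> (real n + 1) ^ n * exp x * exp (- c * x\<^sup>2)"
    by (rule mult_right_mono) simp
  also have "\<dots> = (real n + 1) ^ n * exp (x - c * x\<^sup>2)" by (simp add: exp_diff exp_minus field_simps)
  also have "\<dots> \<le> (real n + 1) ^ n * exp (1 / (4 * c))"
  proof -
    have "0 \<le> c * (x - 1 / (2 * c))\<^sup>2" using c by simp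
    also have "\<dots> = c * x\<^sup>2 - x + 1 / (4 * c)" using c by (simp add: power2_eq_square field_simps)
    finally show ?thesis by simp
  qed
  finally show ?thesis unfolding x_def .
qed

text \<open>Sum over the shells between consecutive integer radii. A ball of radius
  \<open>m + 1\<close> has volume of order \<open>(m + 1) ^ DIM('a)\<close>, and two further powers
  leave the series of inverse squares.\<close>

lemma integrable_inverse_power_norm:
  assumes n: "DIM('a) + 2 \<le> n"
  shows "integrable lborel (\<lambda>z::'a::euclidean_space. 1 / (1 + norm z) ^ n)"
proof (rule integrableI_nonneg)
  define c where "c = unit_ball_vol (real DIM('a))"
  have c: "0 \<le> c" by (simp add: c_def)
  have cb [measurable]: "cball (0::'a) r \<in> sets borel" for r by simp
  have "(\<integral>\<^sup>+z. ennreal (1 / (1 + norm (z::'a)) ^ n) \<partial>lborel)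
     \<le> (\<integral>\<^sup>+z. (\<Sum>m. ennreal (1 / real (Suc m) ^ n) * indicator (cball 0 (real (Suc m))) (z::'a)) \<partial>lborel)"
  proof (intro nn_integral_mono)
    fix z :: 'a
    define m where "m = nat \<lfloor>norm z\<rfloor>"
    have m: "real m \<le> norm z" "norm z \<le> real (Suc m)" 
      unfolding m_def using floor_correct[of "norm z"] by (simp_all add: of_nat_nat add.commute)
    have "ennreal (1 / (1 + norm z) ^ n) \<le> ennreal (1 / real (Suc m) ^ n)"
      using m by (intro ennreal_leI divide_left_mono power_mono mult_pos_pos zero_less_power) (auto intro: add_pos_nonneg)
    also have "\<dots> = ennreal (1 / real (Suc m) ^ n) * indicator (cball 0 (real (Suc m))) z"
      using m by simp
    also have "\<dots> = (\<Sum>k\<in>{m}. ennreal (1 / real (Suc k) ^ n) * indicator (cball 0 (real (Suc k))) z)"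
      by (simp only: sum.insert_if sum.empty finite.emptyI empty_iff if_False add_0_right)
    also have "\<dots> \<le> (\<Sum>m. ennreal (1 / real (Suc m) ^ n) * indicator (cball 0 (real (Suc m))) z)"
      by (intro sum_le_suminf) auto
    finally show "ennreal (1 / (1 + norm z) ^ n)
      \<le> (\<Sum>m. ennreal (1 / real (Suc m) ^ n) * indicator (cball 0 (real (Suc m))) z)" .
  qed
  also have "\<dots> = (\<Sum>m. ennreal (1 / real (Suc m) ^ n) * emeasure lborel (cball (0::'a) (real (Suc m))))"
    by (subst nn_integral_suminf; (intro suminf_cong nn_integral_cmult_indicator)?; (simp only: sets_lborel cb | measurable))
  also have "\<dots> = (\<Sum>m. ennreal (c * (real (Suc m) ^ DIM('a) / real (Suc m) ^ n)))"
    by (simp add: emeasure_cball c_def ennreal_mult'[symmetric] mult_ac del: of_nat_Suc)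
  also have "\<dots> \<le> (\<Sum>m. ennreal (c * (1 / real (Suc m) ^ 2)))"
  proof (intro suminf_le ennreal_leI mult_left_mono c)
    fix m
    have "real (Suc m) ^ (DIM('a) + 2) \<le> real (Suc m) ^ n" using n by (intro power_increasing) auto
    then show "real (Suc m) ^ DIM('a) / real (Suc m) ^ n \<le> 1 / real (Suc m) ^ 2"
      by (simp add: field_simps power_add power2_eq_square del: of_nat_Suc)
  qed auto
  also have "\<dots> = ennreal (\<Sum>m. c * (1 / real (Suc m) ^ 2))"
  proof (rule suminf_ennreal2)
    show "summable (\<lambda>m. c * (1 / real (Suc m) ^ 2))"
      using inverse_power_summable[of 2, where 'a=real]
      by (intro summable_mult) (subst summable_Suc_iff[of "\<lambda>m. 1 / real m ^ 2"], simp add: inverse_eq_divide)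
  qed (use c in auto)
  also have "\<dots> < \<infinity>" by simp
  finally show "(\<integral>\<^sup>+z. ennreal (1 / (1 + norm (z::'a)) ^ n) \<partial>lborel) < \<infinity>" .
qed auto

lemma nn_integral_inverse_power_norm_finite:
  assumes "DIM('a) + 2 \<le> n"
  obtains C where "0 \<le> C" "(\<integral>\<^sup>+z. ennreal (1 / (1 + norm (z::'a::euclidean_space)) ^ n) \<partial>lborel) = ennreal C"
  using that[of "integral\<^sup>L lborel (\<lambda>z::'a. 1 / (1 + norm z) ^ n)"]
    nn_integral_eq_integral[OF integrable_inverse_power_norm[OF assms]] by (auto intro!: integral_nonneg_AE)

text \<open>
  The thresholds \<open>(3/4)^n\<close> are summable but large compared with the size \<open>2^(-n/2)\<close> of the
  increments over the dyadic mesh, so that high moments give a convergent union bound.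
\<close>

lemma dyadic_chaining:
  fixes w :: "real \<Rightarrow> 'a::real_normed_vector"
  assumes k: "0 < k" and w: "continuous_on {0..k} w" "w 0 = 0" and a: "0 \<le> a"
    and incr: "\<And>n j. j < 2 ^ n \<Longrightarrow> norm (w (k * real (Suc j) / 2 ^ n) - w (k * real j / 2 ^ n)) \<le> a * (3 / 4) ^ n"
    and s: "s \<in> {0..k}"
  shows "norm (w s) \<le> 4 * a"
proof -
  \<comment> \<open>A point of level \<open>n + 1\<close> either belongs to level \<open>n\<close>
    or lies one step to the right of a point that does.\<close>
  have dy: "norm (w (k * real j / 2 ^ n)) \<le> a * (\<Sum>i\<le>n. (3 / 4) ^ i)" if "j \<le> 2 ^ n" for n j
    using that
  proof (induction n arbitrary: j)
    case 0
    then consider "j = 0" | "j = 1" by force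
    then show ?case using incr[of 0 0] w(2) a by cases auto
  next
    case (Suc n)
    show ?case
    proof (cases "even j")
      case True
      then obtain i where i: "j = 2 * i" by blast
      then have "norm (w (k * real j / 2 ^ Suc n)) \<le> a * (\<Sum>i\<le>n. (3 / 4) ^ i)"
        using Suc.IH[of i] Suc.prems by simp
      also have "\<dots> \<le> a * (\<Sum>i\<le>Suc n. (3 / 4) ^ i)" using a by (intro mult_left_mono) auto
      finally show ?thesis .
    next
      case False
      then obtain i where i: "j = Suc (2 * i)" by (metis oddE Suc_eq_plus1)
      have "2 * i < 2 ^ Suc n" using Suc.prems i by simp
      from incr[OF this] have "norm (w (k * real j / 2 ^ Suc n) - w (k * real i / 2 ^ n)) \<le> a * (3 / 4) ^ Suc n"
        unfolding i by simp
      moreover have "norm (w (k * real i / 2 ^ n)) \<le> a * (\<Sum>i\<le>n. (3 / 4) ^ i)"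
        using Suc.prems i by (intro Suc.IH) auto
      ultimately have "norm (w (k * real j / 2 ^ Suc n)) \<le> a * (\<Sum>i\<le>n. (3 / 4) ^ i) + a * (3 / 4) ^ Suc n"
        using norm_triangle_ineq[of "w (k * real j / 2 ^ Suc n) - w (k * real i / 2 ^ n)" "w (k * real i / 2 ^ n)"]
        by simp
      then show ?thesis by (simp add: algebra_simps)
    qed
  qed
  \<comment> \<open>The final factor \<open>4\<close> is the sum of the geometric series with ratio
    \<open>3 / 4\<close>.\<close>
  have sum4: "(\<Sum>i\<le>n. (3 / 4 :: real) ^ i) \<le> 4" for n
  proof -
    have "(\<Sum>i\<le>n. (3 / 4 :: real) ^ i) = (1 - (3 / 4) ^ Suc n) / (1 - 3 / 4)"
      using sum_gp0[of "3/4 :: real" n] by simp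
    then show ?thesis by simp
  qed
  \<comment> \<open>Dyadic points just below \<open>s\<close>, from which continuity carries the
    bound to \<open>s\<close>.\<close>
  define j where "j n = nat \<lfloor>2 ^ n * s / k\<rfloor>" for n :: nat
  define q where "q n = k * real (j n) / 2 ^ n" for n
  have j1: "real (j n) \<le> 2 ^ n * s / k" "2 ^ n * s / k < real (j n) + 1" for n
    using s k unfolding j_def by (auto simp: of_nat_nat floor_correct)
  have j2: "j n \<le> 2 ^ n" for n
  proof -
    have "2 ^ n * s / k \<le> 2 ^ n" using s k by (simp add: field_simps)
    with j1(1)[of n] have "real (j n) \<le> 2 ^ n" by (rule order.trans)
    then show ?thesis by simp
  qed
  have q1: "q n \<le> s" "s - k * (1 / 2) ^ n \<le> q n" for n
  proof -
    have j3: "k * real (j n) \<le> s * 2 ^ n" "s * 2 ^ n - k \<le> k * real (j n)"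
      using j1[of n] k by (auto simp: field_simps)
    then show "q n \<le> s" by (simp add: q_def field_simps)
    have "s - k * (1 / 2) ^ n = (s * 2 ^ n - k) / 2 ^ n" by (simp add: power_divide diff_divide_distrib)
    also have "\<dots> \<le> q n" unfolding q_def using j3(2) by (intro divide_right_mono) auto
    finally show "s - k * (1 / 2) ^ n \<le> q n" .
  qed
  have q0: "0 \<le> q n" for n using k by (simp add: q_def)
  have "q \<longlonglongrightarrow> s"
  proof (rule tendsto_sandwich)
    show "(\<lambda>n. s - k * (1 / 2) ^ n) \<longlonglongrightarrow> s"
      by (rule tendsto_eq_intros LIMSEQ_power_zero refl | simp)+
  qed (use q1 in auto)
  then have "(\<lambda>n. w (q n)) \<longlonglongrightarrow> w s"
    using w(1) s q1(1) q0 by (intro continuous_on_tendsto_compose[OF w(1)]) (auto intro!: always_eventually order.trans[OF q1(1)])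
  then have "(\<lambda>n. norm (w (q n))) \<longlonglongrightarrow> norm (w s)" by (rule tendsto_norm)
  moreover have "norm (w (q n)) \<le> 4 * a" for n
  proof -
    have "norm (w (q n)) \<le> a * (\<Sum>i\<le>n. (3 / 4) ^ i)" unfolding q_def by (rule dy[OF j2])
    also have "\<dots> \<le> a * 4" using a sum4 by (intro mult_left_mono) auto
    finally show ?thesis by simp
  qed
  ultimately show ?thesis by (intro LIMSEQ_le_const2) auto
qed

declare measurable_path_component [measurable del]

section \<open>Gaussian moments, the running maximum and the decay of hitting probabilities\<close>

context standard_brownian_motion
begin

definition heat_moment :: "nat \<Rightarrow> ennreal" where
  "heat_moment N = (\<integral>\<^sup>+z. ennreal (heat 1 (z::'a)) * ennreal (norm z ^ (2 * N)) \<partial>lborel)"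

lemma heat_moment_finite: "heat_moment N < \<infinity>"
proof -
  define p where "p = DIM('a) + 2"
  define C where "C = (real (2 * N + p) + 1) ^ (2 * N + p) * exp (1 / (4 * (1 / 2)))"
  have C: "0 \<le> C" by (simp add: C_def)
  have bound: "heat 1 z * norm z ^ (2 * N) \<le> C * (1 / (1 + norm z) ^ p)" for z :: 'a
  proof -
    have "1 ^ DIM('a) \<le> sqrt (2 * pi * 1) ^ DIM('a)"
      using pi_ge_two by (intro power_mono) auto
    then have "heat 1 z \<le> exp (- (norm z)\<^sup>2 / 2)"
      unfolding heat_def by (simp add: divide_le_eq mult_le_cancel_left1)
    then have "heat 1 z * norm z ^ (2 * N) * (1 + norm z) ^ p \<le>
        exp (- (norm z)\<^sup>2 / 2) * (1 + norm z) ^ (2 * N) * (1 + norm z) ^ p"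
      by (intro mult_mono power_mono) auto
    also have "\<dots> = (1 + norm z) ^ (2 * N + p) * exp (- (1 / 2) * (norm z)\<^sup>2)"
      by (simp add: power_add)
    also have "\<dots> \<le> C" unfolding C_def by (rule power_exp_bound) simp
    finally show ?thesis by (simp add: pos_le_divide_eq add_pos_nonneg)
  qed
  obtain D where D: "0 \<le> D" "(\<integral>\<^sup>+z. ennreal (1 / (1 + norm (z::'a)) ^ p) \<partial>lborel) = ennreal D"
    using nn_integral_inverse_power_norm_finite[where 'a='a, of p] by (auto simp: p_def)
  have "heat_moment N \<le> (\<integral>\<^sup>+z. ennreal C * ennreal (1 / (1 + norm (z::'a)) ^ p) \<partial>lborel)"
    unfolding heat_moment_def using bound C
    by (intro nn_integral_mono) (simp flip: ennreal_mult' ennreal_mult'')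
  also have "\<dots> = ennreal C * ennreal D" by (subst nn_integral_cmult) (auto simp: D)
  also have "\<dots> < \<infinity>" by (simp add: ennreal_mult_less_top)
  finally show ?thesis .
qed

text \<open>Chebyshev's inequality with the moment of order \<open>2 * N\<close>, after scaling the
  increment to unit time.\<close>

lemma emeasure_increment_gt:
  assumes "0 \<le> s" "s < t" "0 < r"
  shows "emeasure M {\<omega>\<in>space M. r < norm (B t \<omega> - B s \<omega>)} \<le> heat_moment N * ennreal (((t - s) / r\<^sup>2) ^ N)"
proof -
  define h where "h = t - s"
  have h: "0 < h" using assms by (simp add: h_def)
  have "emeasure M {\<omega>\<in>space M. r < norm (B t \<omega> - B s \<omega>)}
      = emeasure M {\<omega>\<in>space M. B t \<omega> - B s \<omega> \<in> {z. r < norm z}}" by simp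
  also have "\<dots> = (\<integral>\<^sup>+\<omega>. indicator {z. r < norm z} (B t \<omega> - B s \<omega>) \<partial>M)"
    using assms by (intro emeasure_vimage_eq_nn_integral[of _ _ borel] measurable_increment) auto
  also have "\<dots> = (\<integral>\<^sup>+z. ennreal (heat h z) * indicator {z. r < norm z} (z::'a) \<partial>lborel)"
    using nn_integral_increment[of s t "indicator {z. r < norm z}"] assms by (simp add: h_def)
  also have "\<dots> \<le> (\<integral>\<^sup>+z. ennreal (heat h z) * ennreal (((norm (z::'a))\<^sup>2 / r\<^sup>2) ^ N) \<partial>lborel)"
  proof (intro nn_integral_mono mult_left_mono)
    fix z :: 'a
    show "indicator {z. r < norm z} z \<le> ennreal (((norm z)\<^sup>2 / r\<^sup>2) ^ N)"
    proof (cases "r < norm z")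
      case True
      then have "r\<^sup>2 \<le> (norm z)\<^sup>2" using assms by (intro power_mono) auto
      then have "1 \<le> ((norm z)\<^sup>2 / r\<^sup>2) ^ N" using assms by (intro one_le_power) (simp add: field_simps)
      then show ?thesis using True by (simp add: ennreal_leI flip: ennreal_1)
    qed simp
  qed simp
  also have "\<dots> = (\<integral>\<^sup>+z. ennreal (heat 1 z) * ennreal (((norm (sqrt h *\<^sub>R (z::'a)))\<^sup>2 / r\<^sup>2) ^ N) \<partial>lborel)"
    using nn_integral_heat_scale[of "\<lambda>z::'a. ennreal (((norm z)\<^sup>2 / r\<^sup>2) ^ N)" "sqrt h" 1] h by simp
  also have "\<dots> = (\<integral>\<^sup>+z. (ennreal (heat 1 z) * ennreal (norm (z::'a) ^ (2 * N))) * ennreal ((h / r\<^sup>2) ^ N) \<partial>lborel)"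
  proof (intro nn_integral_cong)
    fix z :: 'a
    have "(norm (sqrt h *\<^sub>R z))\<^sup>2 / r\<^sup>2 = (norm z)\<^sup>2 * (h / r\<^sup>2)"
      using h by (simp add: power_mult_distrib)
    then have "((norm (sqrt h *\<^sub>R z))\<^sup>2 / r\<^sup>2) ^ N = norm z ^ (2 * N) * (h / r\<^sup>2) ^ N"
      by (simp only: power_mult_distrib power_mult)
    then show "ennreal (heat 1 z) * ennreal (((norm (sqrt h *\<^sub>R z))\<^sup>2 / r\<^sup>2) ^ N)
       = (ennreal (heat 1 z) * ennreal (norm z ^ (2 * N))) * ennreal ((h / r\<^sup>2) ^ N)"
      using h by (simp add: ennreal_mult mult.assoc)
  qed
  also have "\<dots> = heat_moment N * ennreal ((h / r\<^sup>2) ^ N)"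
    unfolding heat_moment_def by (rule nn_integral_multc) measurable
  finally show ?thesis by (simp add: h_def)
qed

text \<open>Union bound over all dyadic increments. At level \<open>n\<close> there are
  \<open>2 ^ n\<close> of them, and each exceeds its threshold with probability at most a constant
  times \<open>(8 / 9) ^ (N * n)\<close>, since \<open>(1 / 2) / (3 / 4)\<^sup>2 = 8 / 9\<close>.
  The bound is phrased with an exceptional set \<open>E\<close>, the union of these events, so that
  no supremum over real times has to be measured.\<close>

lemma sup_tail:
  assumes k: "0 < k" and N: "6 \<le> N"
  obtains C where "0 \<le> C"
    "\<And>r. 0 < r \<Longrightarrow> \<exists>E\<in>sets M. emeasure M E \<le> ennreal (C / r ^ (2 * N)) \<and> (\<forall>\<omega>\<in>space M - E. \<forall>s\<in>{0..k}. norm (B s \<omega>) \<le> r)"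
proof -
  \<comment> \<open>The ratio of the geometric series in the union bound; \<open>N = 6\<close> is
    the first exponent with \<open>(8 / 9) ^ N < 1 / 2\<close>.\<close>
  define q :: real where "q = 2 * (8 / 9) ^ N"
  have q0: "0 \<le> q" by (simp add: q_def)
  have "(8 / 9 :: real) ^ N \<le> (8 / 9) ^ 6" using N by (intro power_decreasing) auto
  also have "\<dots> < 1 / 2" by (simp add: power_divide divide_less_eq)
  finally have q1: "q < 1" by (simp add: q_def)
  define H where "H = enn2real (heat_moment N)"
  have H: "heat_moment N = ennreal H" "0 \<le> H"
    using heat_moment_finite[of N] by (simp_all add: H_def ennreal_enn2real_if)
  define C where "C = H * (16 * k) ^ N * (1 / (1 - q))"
  have C0: "0 \<le> C" using H k q1 by (simp add: C_def)
  have "\<exists>E\<in>sets M. emeasure M E \<le> ennreal (C / r ^ (2 * N)) \<and> (\<forall>\<omega>\<in>space M - E. \<forall>s\<in>{0..k}. norm (B s \<omega>) \<le> r)"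
    if r: "0 < r" for r
  proof -
    \<comment> \<open>Cancels the factor \<open>4\<close> of \<open>dyadic_chaining\<close>; the
      \<open>16\<close> in \<open>C\<close> is its square.\<close>
    define a where "a = r / 4"
    have a: "0 < a" using r by (simp add: a_def)
    define t where "t n j = k * real j / 2 ^ n" for n j :: nat
    have t0: "0 \<le> t n j" for n j using k by (simp add: t_def)
    have t1: "t n (Suc j) - t n j = k / 2 ^ n" for n j by (simp add: t_def field_simps)
    have tl: "t n j < t n (Suc j)" for n j using k by (simp add: t_def field_simps)
    define D where "D n j = {\<omega>\<in>space M. a * (3 / 4) ^ n < norm (B (t n (Suc j)) \<omega> - B (t n j) \<omega>)}" for n j
    have D [measurable]: "D n j \<in> sets M" for n j
    proof -
      have [measurable]: "(\<lambda>\<omega>. B (t n (Suc j)) \<omega> - B (t n j) \<omega>) \<in> borel_measurable M"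
        using t0 by (intro measurable_increment) auto
      show ?thesis unfolding D_def by measurable
    qed
    have Db: "emeasure M (D n j) \<le> ennreal (H * (k / a\<^sup>2) ^ N * ((8 / 9) ^ N) ^ n)" for n j
    proof -
      have "emeasure M (D n j) \<le> heat_moment N * ennreal (((t n (Suc j) - t n j) / (a * (3 / 4) ^ n)\<^sup>2) ^ N)"
        unfolding D_def using t0 tl a by (intro emeasure_increment_gt) auto
      also have "(t n (Suc j) - t n j) / (a * (3 / 4) ^ n)\<^sup>2 = k / a\<^sup>2 * (8 / 9) ^ n"
      proof -
        have "(3 / 4 :: real) ^ n * (3 / 4) ^ n * (8 / 9) ^ n * 2 ^ n = 1"
          by (simp flip: power_mult_distrib)
        then show ?thesis unfolding t1 using a by (simp add: power2_eq_square field_simps)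
      qed
      also have "heat_moment N * ennreal ((k / a\<^sup>2 * (8 / 9) ^ n) ^ N) = ennreal (H * (k / a\<^sup>2) ^ N * ((8 / 9) ^ N) ^ n)"
      proof -
        have "(k / a\<^sup>2 * (8 / 9) ^ n) ^ N = (k / a\<^sup>2) ^ N * ((8 / 9) ^ N) ^ n"
          unfolding power_mult_distrib by (simp only: power_mult[symmetric] mult.commute)
        then show ?thesis using k H by (simp add: ennreal_mult' mult.assoc)
      qed
      finally show ?thesis .
    qed
    define E where "E = (\<Union>n. \<Union>j\<in>{..<2 ^ n}. D n j)"
    have Em: "E \<in> sets M" unfolding E_def by measurable
    have "emeasure M E \<le> (\<Sum>n. emeasure M (\<Union>j\<in>{..<2 ^ n}. D n j))"
      unfolding E_def by (intro emeasure_subadditive_countably) auto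
    also have "\<dots> \<le> (\<Sum>n. ennreal (H * (k / a\<^sup>2) ^ N * q ^ n))"
    proof (intro suminf_le allI)
      fix n
      have "emeasure M (\<Union>j\<in>{..<2 ^ n}. D n j) \<le> (\<Sum>j\<in>{..<2 ^ n}. emeasure M (D n j))"
        by (intro emeasure_subadditive_finite) auto
      also have "\<dots> \<le> (\<Sum>j\<in>{..<2 ^ n :: nat}. ennreal (H * (k / a\<^sup>2) ^ N * ((8 / 9) ^ N) ^ n))"
        by (intro sum_mono Db)
      also have "\<dots> = ennreal (2 ^ n * (H * (k / a\<^sup>2) ^ N * ((8 / 9) ^ N) ^ n))"
        using H k by (simp add: ennreal_mult' flip: ennreal_numeral ennreal_power)
      also have "2 ^ n * (H * (k / a\<^sup>2) ^ N * ((8 / 9) ^ N) ^ n) = H * (k / a\<^sup>2) ^ N * q ^ n"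
        by (simp add: q_def power_mult_distrib)
      finally show "emeasure M (\<Union>j\<in>{..<2 ^ n}. D n j) \<le> ennreal (H * (k / a\<^sup>2) ^ N * q ^ n)" .
    qed auto
    also have "\<dots> = ennreal (\<Sum>n. H * (k / a\<^sup>2) ^ N * q ^ n)"
      using H k q0 q1 by (intro suminf_ennreal2 summable_mult summable_geometric) auto
    also have "(\<Sum>n. H * (k / a\<^sup>2) ^ N * q ^ n) = H * (k / a\<^sup>2) ^ N * (1 / (1 - q))"
      using q0 q1 by (subst suminf_mult) (auto simp: suminf_geometric)
    also have "\<dots> = C / r ^ (2 * N)"
    proof -
      have "(k / a\<^sup>2) ^ N = (16 * k) ^ N / r ^ (2 * N)"
      proof -
        have "k / a\<^sup>2 = 16 * k / r\<^sup>2" by (simp add: a_def power_divide)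
        then show ?thesis by (simp only: power_divide power_mult)
      qed
      then show ?thesis by (simp add: C_def)
    qed
    finally have "emeasure M E \<le> ennreal (C / r ^ (2 * N))" .
    moreover have "norm (B s \<omega>) \<le> r" if \<omega>: "\<omega> \<in> space M - E" and s: "s \<in> {0..k}" for \<omega> s
    proof -
      have "norm (B s \<omega>) \<le> 4 * a"
      proof (rule dyadic_chaining[OF k _ _ _ _ s])
        show "continuous_on {0..k} (\<lambda>s. B s \<omega>)"
          using \<omega> by (intro continuous_on_subset[OF continuous_BM]) auto
        show "B 0 \<omega> = 0" using \<omega> by (simp add: start_BM)
        fix n j :: nat assume "j < 2 ^ n"
        then have "\<omega> \<notin> D n j" using \<omega> unfolding E_def by auto
        then show "norm (B (k * real (Suc j) / 2 ^ n) \<omega> - B (k * real j / 2 ^ n) \<omega>) \<le> a * (3 / 4) ^ n"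
          using \<omega> unfolding D_def t_def by auto
      qed (use a in simp)
      then show ?thesis by (simp add: a_def)
    qed
    ultimately show ?thesis using Em by blast
  qed
  then show ?thesis using C0 that by blast
qed

text \<open>One estimate for bridges, drifted motion and the motion itself: \<open>X\<close> need
  only be controlled by the maximum of \<open>B\<close> on \<open>[0, k]\<close>. For distant
  \<open>z\<close>, reaching \<open>K\<close> forces this maximum above \<open>norm z / 6\<close>;
  for the other \<open>z\<close> the trivial bound \<open>1\<close> is absorbed by the constant and
  the power of \<open>1 + m\<close>.\<close>

lemma hit_tail:
  fixes K :: "'a set"
  assumes k: "0 < k" "b \<le> k" "0 \<le> b" and N: "6 \<le> N" and K: "K \<subseteq> ball 0 R" "K \<noteq> {}"
  obtains C where "0 \<le> C"
    "\<And>X z m. 0 \<le> m \<Longrightarrow> (\<And>s. 0 \<le> s \<Longrightarrow> X s \<in> borel_measurable M) \<Longrightarrow>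
      (\<And>\<omega> r. \<omega> \<in> space M \<Longrightarrow> (\<And>s. s \<in> {0..k} \<Longrightarrow> norm (B s \<omega>) \<le> r) \<Longrightarrow>
         (\<And>s. s \<in> {0..b} \<Longrightarrow> norm (X s \<omega>) \<le> 2 * r + m)) \<Longrightarrow>
      emeasure M {\<omega>\<in>space M. hitq K 0 b (\<lambda>s. z + X s \<omega>)} \<le> ennreal (C * (1 + m) ^ (2 * N) * (1 / (1 + norm z) ^ (2 * N)))"
proof -
  obtain C0 where C0: "0 \<le> C0" and tail: "\<And>r. 0 < r \<Longrightarrow> \<exists>E\<in>sets M. emeasure M E \<le> ennreal (C0 / r ^ (2 * N)) \<and>
      (\<forall>\<omega>\<in>space M - E. \<forall>s\<in>{0..k}. norm (B s \<omega>) \<le> r)"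
    using sup_tail[OF k(1) N] by blast
  have R: "0 < R" using K by (metis all_not_in_conv ball_eq_empty not_less subset_empty)
  \<comment> \<open>The extra \<open>1\<close> is there because only the coarsest test of
    \<open>hitq\<close> is used, which puts the path within distance \<open>1\<close> of
    \<open>K\<close>.\<close>
  define L where "L = R + 1"
  \<comment> \<open>\<open>12\<close> comes from \<open>norm z / 6 \<ge> (1 + norm z) / 12\<close>
    for distant \<open>z\<close>, and \<open>2 * L + 7\<close> from
    \<open>1 + norm z \<le> (2 * L + 7) * (1 + m)\<close> for the others.\<close>
  define C where "C = C0 * 12 ^ (2 * N) + (2 * L + 7) ^ (2 * N)"
  have L: "0 \<le> L" using R by (simp add: L_def)
  have Cge: "0 \<le> C" "C0 * 12 ^ (2 * N) \<le> C" "(2 * L + 7) ^ (2 * N) \<le> C" using C0 L by (simp_all add: C_def)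
  show ?thesis
  proof (rule that[OF Cge(1)])
    fix X :: "real \<Rightarrow> 'w \<Rightarrow> 'a" and z :: 'a and m :: real
    assume m: "0 \<le> m" and X: "\<And>s. 0 \<le> s \<Longrightarrow> X s \<in> borel_measurable M"
      and bd: "\<And>\<omega> r s. \<omega> \<in> space M \<Longrightarrow> (\<And>s. s \<in> {0..k} \<Longrightarrow> norm (B s \<omega>) \<le> r) \<Longrightarrow> s \<in> {0..b} \<Longrightarrow> norm (X s \<omega>) \<le> 2 * r + m"
    let ?A = "{\<omega>\<in>space M. hitq K 0 b (\<lambda>s. z + X s \<omega>)}"
    let ?p = "2 * N"
    show "emeasure M ?A \<le> ennreal (C * (1 + m) ^ ?p * (1 / (1 + norm z) ^ ?p))"
    proof (cases "2 * (L + m) + 6 \<le> norm z")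
      case True
      then have z: "6 \<le> norm z" using L m by simp
      define r where "r = norm z / 6"
      have r: "0 < r" using z unfolding r_def by linarith
      obtain E where E: "E \<in> sets M" "emeasure M E \<le> ennreal (C0 / r ^ ?p)"
        and nE: "\<And>\<omega> s. \<omega> \<in> space M - E \<Longrightarrow> s \<in> {0..k} \<Longrightarrow> norm (B s \<omega>) \<le> r"
        using tail[OF r] by blast
      have "?A \<subseteq> E"
      proof
        fix \<omega> assume \<omega>: "\<omega> \<in> ?A"
        show "\<omega> \<in> E"
        proof (rule ccontr)
          assume "\<omega> \<notin> E"
          with \<omega> have \<omega>E: "\<omega> \<in> space M - E" by simp
          from \<omega> obtain q where q: "q \<in> {0..b}" and inf: "infdist (z + X q \<omega>) K < 1"
            unfolding hitq_def by (auto dest!: spec[of _ 0])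
          obtain y where y: "y \<in> K" "dist (z + X q \<omega>) y < 1"
            using inf K(2) cINF_less_iff[OF K(2), of "dist (z + X q \<omega>)" 1] bdd_belowI2[of K 0 "dist (z + X q \<omega>)"]
            by (auto simp: infdist_notempty)
          have "norm (X q \<omega>) \<le> 2 * r + m" using \<omega>E nE q by (intro bd) auto
          moreover have "norm y < R" using y(1) K(1) by auto
          moreover have "norm z \<le> norm (z + X q \<omega> - y) + norm y + norm (X q \<omega>)" by norm
          ultimately have "norm z < 1 + R + 2 * r + m" using y(2) by (simp add: dist_norm)
          then show False using True m z by (simp add: r_def L_def)
        qed
      qed
      then have "emeasure M ?A \<le> ennreal (C0 / r ^ ?p)"
        using E by (meson emeasure_mono order.trans)
      also have "C0 / r ^ ?p \<le> C0 * 12 ^ ?p * (1 / (1 + norm z) ^ ?p)"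
      proof -
        have "((1 + norm z) / 12) ^ ?p \<le> r ^ ?p" using z by (intro power_mono) (auto simp: r_def)
        then have "C0 / r ^ ?p \<le> C0 / ((1 + norm z) / 12) ^ ?p"
          using C0 r z by (intro divide_left_mono mult_pos_pos zero_less_power) auto
        then show ?thesis by (simp add: power_divide)
      qed
      also have "\<dots> \<le> C * (1 + m) ^ ?p * (1 / (1 + norm z) ^ ?p)"
      proof (intro mult_right_mono)
        have "C0 * 12 ^ ?p \<le> C * 1" using Cge by simp
        also have "\<dots> \<le> C * (1 + m) ^ ?p" using m Cge by (intro mult_left_mono one_le_power) auto
        finally show "C0 * 12 ^ ?p \<le> C * (1 + m) ^ ?p" .
      qed simp
      finally show ?thesis by (simp add: ennreal_leI)
    next
      case False
      have "1 + norm z \<le> (2 * L + 7) * (1 + m)"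
      proof -
        have eq: "(2 * L + 7) * (1 + m) = 2 * L + 7 + 2 * (L * m) + 7 * m" by (simp add: algebra_simps)
        define P where "P = L * m"
        have "0 \<le> P" using L m by (simp add: P_def)
        moreover have "norm z < 2 * L + 2 * m + 6" using False by simp
        ultimately have "1 + norm z \<le> 2 * L + 7 + 2 * P + 7 * m" using m by simp
        then show ?thesis by (simp only: eq P_def)
      qed
      then have "(1 + norm z) ^ ?p \<le> ((2 * L + 7) * (1 + m)) ^ ?p"
        by (intro power_mono) auto
      also have "\<dots> \<le> C * (1 + m) ^ ?p"
        unfolding power_mult_distrib using Cge m by (intro mult_right_mono) auto
      finally have "1 \<le> C * (1 + m) ^ ?p * (1 / (1 + norm z) ^ ?p)"
        by (simp add: add_pos_nonneg)
      then have ge: "ennreal 1 \<le> ennreal (C * (1 + m) ^ ?p * (1 / (1 + norm z) ^ ?p))" by (rule ennreal_leI)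
      have "emeasure M ?A \<le> ennreal 1" by (simp add: emeasure_le_1)
      then show ?thesis using ge by (rule order.trans)
    qed
  qed
qed

end

section \<open>Overlaps and segment means\<close>

lemma heat_le_heat_0: "0 < s \<Longrightarrow> heat s (z::'a::euclidean_space) \<le> 1 / sqrt (2 * pi * s) ^ DIM('a)"
  unfolding heat_def by (intro divide_right_mono) auto

text \<open>Lowering the variance can only lower the exponential; the whole loss sits in the
  normalising constant.\<close>

lemma heat_compare:
  fixes z :: "'a::euclidean_space"
  assumes "0 < k" "0 < q" "q \<le> 1"
  shows "heat (k * q) z \<le> (1 / sqrt q) ^ DIM('a) * heat k z"
proof -
  have "k * q \<le> k" using assms by (simp add: mult_le_cancel_left1)
  then have "(norm z)\<^sup>2 / (2 * k) \<le> (norm z)\<^sup>2 / (2 * (k * q))"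
    using assms by (intro divide_left_mono) auto
  then have "exp (- (norm z)\<^sup>2 / (2 * (k * q))) \<le> exp (- (norm z)\<^sup>2 / (2 * k))" by simp
  then show ?thesis
    unfolding heat_def using assms
    by (simp add: real_sqrt_mult power_mult_distrib power_divide field_simps)
qed

lemma measurable_pair_components:
  "0 \<le> s \<Longrightarrow> (\<lambda>p. fst p s) \<in> borel_measurable (path_space \<Otimes>\<^sub>M N)"
  "0 \<le> s \<Longrightarrow> (\<lambda>p. snd p s) \<in> borel_measurable (N \<Otimes>\<^sub>M path_space)"
  using measurable_path_component[of s fst "path_space \<Otimes>\<^sub>M N"]
    measurable_path_component[of s snd "N \<Otimes>\<^sub>M path_space"] by auto

text \<open>\<open>K \<noteq> {}\<close> matters for the encoding: \<open>infdist\<close> to the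
  empty set is \<open>0\<close>, so \<open>hitq\<close> would hold for the empty set whenever a
  rational time is tested.\<close>

locale brownian_motion_and_compact = standard_brownian_motion M B
  for M :: "'w measure" and B :: "real \<Rightarrow> 'w \<Rightarrow> 'a::euclidean_space" +
  fixes K :: "'a set" and R :: real
  assumes dim: "3 \<le> DIM('a)" and compact_K: "compact K" and K_nonempty: "K \<noteq> {}" and K_ball: "K \<subseteq> ball 0 R"
begin

abbreviation drift :: "'a \<Rightarrow> real \<Rightarrow> 'w \<Rightarrow> 'a" where
  "drift a s \<omega> \<equiv> B s \<omega> + s *\<^sub>R a"

definition bridge_mean :: "real \<Rightarrow> ((real \<Rightarrow> 'a) \<Rightarrow> ennreal) \<Rightarrow> 'a \<Rightarrow> ennreal" where
  "bridge_mean k F u = (\<integral>\<^sup>+\<omega>. F (traj (stop k (brownian_bridge B k u)) \<omega>) \<partial>M)"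

lemma measurable_bridge: "0 \<le> s \<Longrightarrow> 0 \<le> k \<Longrightarrow> brownian_bridge B k u s \<in> borel_measurable M"
  unfolding brownian_bridge_def[abs_def]
  by (intro borel_measurable_add borel_measurable_scaleR borel_measurable_diff measurable_BM) auto

lemma measurable_drift: "0 \<le> s \<Longrightarrow> drift a s \<in> borel_measurable M"
  by (intro borel_measurable_add measurable_BM) auto

text \<open>The decay exponent used from here on is \<open>2 * N\<close> with
  \<open>N = DIM('a) + 6\<close>: large enough for \<open>hit_tail\<close>, and integrable with
  enough powers to spare for the later weights of polynomial growth.\<close>

lemma six_le_exponent: "6 \<le> DIM('a) + 6" by simp

lemma weight_integral:
  obtains C where "0 \<le> C" "(\<integral>\<^sup>+z. ennreal (1 / (1 + norm (z::'a)) ^ (2 * (DIM('a) + 6))) \<partial>lborel) = ennreal C"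
  by (rule nn_integral_inverse_power_norm_finite[where 'a='a, of "2 * (DIM('a) + 6)"]) auto

text \<open>The endpoint \<open>u\<close> enters \<open>hit_tail\<close> as the slack
  \<open>m\<close>, hence the polynomial growth in \<open>u\<close>; a Gaussian weight in
  \<open>u\<close> will absorb it.\<close>

lemma bridge_mean_bound:
  assumes "1 \<le> k"
  obtains C where "0 \<le> C" "\<And>u. bridge_mean k (vol (hitq K 0 1)) u \<le> ennreal (C * (1 + norm u) ^ (2 * (DIM('a) + 6)))"
proof -
  have k: "0 < k" "1 \<le> k" "0 \<le> (1::real)" using assms by auto
  show ?thesis
  proof (rule hit_tail[OF k six_le_exponent K_ball K_nonempty])
  fix C assume C: "0 \<le> C" and tail: "\<And>X z m. 0 \<le> m \<Longrightarrow> (\<And>s. 0 \<le> s \<Longrightarrow> X s \<in> borel_measurable M) \<Longrightarrow>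
      (\<And>\<omega> r. \<omega> \<in> space M \<Longrightarrow> (\<And>s. s \<in> {0..k} \<Longrightarrow> norm (B s \<omega>) \<le> r) \<Longrightarrow>
         (\<And>s. s \<in> {0..1} \<Longrightarrow> norm (X s \<omega>) \<le> 2 * r + m)) \<Longrightarrow>
      emeasure M {\<omega>\<in>space M. hitq K 0 1 (\<lambda>s. z + X s \<omega>)} \<le> ennreal (C * (1 + m) ^ (2 * (DIM('a) + 6)) * (1 / (1 + norm z) ^ (2 * (DIM('a) + 6))))"
  obtain D where D: "0 \<le> D" "(\<integral>\<^sup>+z. ennreal (1 / (1 + norm (z::'a)) ^ (2 * (DIM('a) + 6))) \<partial>lborel) = ennreal D"
    by (rule weight_integral)
  have "bridge_mean k (vol (hitq K 0 1)) u \<le> ennreal (C * D * (1 + norm u) ^ (2 * (DIM('a) + 6)))" for u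
  proof -
    let ?X = "stop k (brownian_bridge B k u)"
    have Xm: "?X s \<in> borel_measurable M" if "0 \<le> s" for s
      unfolding stop_def[abs_def] using that k by (intro measurable_bridge) auto
    have Xb: "norm (?X s \<omega>) \<le> 2 * r + norm u"
      if "\<omega> \<in> space M" "\<And>s. s \<in> {0..k} \<Longrightarrow> norm (B s \<omega>) \<le> r" "s \<in> {0..1}" for \<omega> r s
    proof -
      have "norm (?X s \<omega>) = norm (B s \<omega> + (s / k) *\<^sub>R (u - B k \<omega>))"
        using that k by (simp add: stop_def brownian_bridge_def)
      also have "\<dots> \<le> norm (B s \<omega>) + (s / k) * norm (u - B k \<omega>)"
        using that k by (intro order.trans[OF norm_triangle_ineq]) auto
      also have "\<dots> \<le> r + 1 * (norm u + r)"
      proof (intro add_mono mult_mono)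
        show "norm (B s \<omega>) \<le> r" using that k by auto
        show "norm (u - B k \<omega>) \<le> norm u + r"
          using that(2)[of k] k norm_triangle_ineq4[of u "B k \<omega>"] by auto
      qed (use that k in \<open>auto simp: divide_le_eq\<close>)
      finally show ?thesis by simp
    qed
    have "bridge_mean k (vol (hitq K 0 1)) u = (\<integral>\<^sup>+z. emeasure M {\<omega>\<in>space M. hitq K 0 1 (\<lambda>s. z + ?X s \<omega>)} \<partial>lborel)"
      unfolding bridge_mean_def using Xm by (intro nn_integral_vol sigma_finite_M path_event_hitq) auto
    also have "\<dots> \<le> (\<integral>\<^sup>+z. ennreal (C * (1 + norm u) ^ (2 * (DIM('a) + 6))) * ennreal (1 / (1 + norm (z::'a)) ^ (2 * (DIM('a) + 6))) \<partial>lborel)"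
    proof (intro nn_integral_mono)
      fix z :: 'a
      have "emeasure M {\<omega>\<in>space M. hitq K 0 1 (\<lambda>s. z + ?X s \<omega>)} \<le> ennreal (C * (1 + norm u) ^ (2 * (DIM('a) + 6)) * (1 / (1 + norm z) ^ (2 * (DIM('a) + 6))))"
        by (rule tail) (use Xm Xb in auto)
      then show "emeasure M {\<omega>\<in>space M. hitq K 0 1 (\<lambda>s. z + ?X s \<omega>)}
        \<le> ennreal (C * (1 + norm u) ^ (2 * (DIM('a) + 6))) * ennreal (1 / (1 + norm z) ^ (2 * (DIM('a) + 6)))"
        by (subst (asm) ennreal_mult') (use C in simp_all)
    qed
    also have "\<dots> = ennreal (C * (1 + norm u) ^ (2 * (DIM('a) + 6))) * ennreal D"
      unfolding D(2)[symmetric] by (rule nn_integral_cmult) measurable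
    finally show ?thesis using C D by (simp add: mult_ac flip: ennreal_mult'')
  qed
  then show ?thesis using that[of "C * D"] C D by auto
  qed
qed

text \<open>A drift with \<open>norm a \<le> 1\<close> displaces the path by at most
  \<open>b\<close>, so one constant serves all these drifts.\<close>

lemma drift_volume_bound:
  assumes b: "0 < b"
  obtains C where "0 \<le> C" "\<And>a. norm a \<le> 1 \<Longrightarrow> (\<integral>\<^sup>+\<omega>. vol (hitq K 0 b) (traj (drift a) \<omega>) \<partial>M) \<le> ennreal C"
proof -
  have k: "0 < b" "b \<le> b" "0 \<le> b" using assms by auto
  show ?thesis
  proof (rule hit_tail[OF k six_le_exponent K_ball K_nonempty])
  fix C assume C: "0 \<le> C" and tail: "\<And>X z m. 0 \<le> m \<Longrightarrow> (\<And>s. 0 \<le> s \<Longrightarrow> X s \<in> borel_measurable M) \<Longrightarrow>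
      (\<And>\<omega> r. \<omega> \<in> space M \<Longrightarrow> (\<And>s. s \<in> {0..b} \<Longrightarrow> norm (B s \<omega>) \<le> r) \<Longrightarrow>
         (\<And>s. s \<in> {0..b} \<Longrightarrow> norm (X s \<omega>) \<le> 2 * r + m)) \<Longrightarrow>
      emeasure M {\<omega>\<in>space M. hitq K 0 b (\<lambda>s. z + X s \<omega>)} \<le> ennreal (C * (1 + m) ^ (2 * (DIM('a) + 6)) * (1 / (1 + norm z) ^ (2 * (DIM('a) + 6))))"
  obtain D where D: "0 \<le> D" "(\<integral>\<^sup>+z. ennreal (1 / (1 + norm (z::'a)) ^ (2 * (DIM('a) + 6))) \<partial>lborel) = ennreal D"
    by (rule weight_integral)
  have "(\<integral>\<^sup>+\<omega>. vol (hitq K 0 b) (traj (drift a) \<omega>) \<partial>M) \<le> ennreal (C * D * (1 + b) ^ (2 * (DIM('a) + 6)))" if a: "norm a \<le> 1" for a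
  proof -
    have Xb: "norm (drift a s \<omega>) \<le> 2 * r + b"
      if "\<omega> \<in> space M" and r: "\<And>s. s \<in> {0..b} \<Longrightarrow> norm (B s \<omega>) \<le> r" and s: "s \<in> {0..b}" for \<omega> r s
    proof -
      have "norm (drift a s \<omega>) \<le> norm (B s \<omega>) + s * norm a"
        using s by (intro order.trans[OF norm_triangle_ineq]) auto
      also have "\<dots> \<le> r + b * 1" using r[OF s] s a by (intro add_mono mult_mono) auto
      also have "0 \<le> r" using r[OF s] norm_ge_zero order.trans by blast
      then have "r + b * 1 \<le> 2 * r + b" by simp
      finally show ?thesis .
    qed
    have "(\<integral>\<^sup>+\<omega>. vol (hitq K 0 b) (traj (drift a) \<omega>) \<partial>M) = (\<integral>\<^sup>+z. emeasure M {\<omega>\<in>space M. hitq K 0 b (\<lambda>s. z + drift a s \<omega>)} \<partial>lborel)"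
      by (intro nn_integral_vol sigma_finite_M path_event_hitq measurable_drift) auto
    also have "\<dots> \<le> (\<integral>\<^sup>+z. ennreal (C * (1 + b) ^ (2 * (DIM('a) + 6))) * ennreal (1 / (1 + norm (z::'a)) ^ (2 * (DIM('a) + 6))) \<partial>lborel)"
    proof (intro nn_integral_mono)
      fix z :: 'a
      have "emeasure M {\<omega>\<in>space M. hitq K 0 b (\<lambda>s. z + drift a s \<omega>)} \<le> ennreal (C * (1 + b) ^ (2 * (DIM('a) + 6)) * (1 / (1 + norm z) ^ (2 * (DIM('a) + 6))))"
        by (rule tail[OF _ measurable_drift Xb]) (use b in auto)
      then show "emeasure M {\<omega>\<in>space M. hitq K 0 b (\<lambda>s. z + drift a s \<omega>)}
        \<le> ennreal (C * (1 + b) ^ (2 * (DIM('a) + 6))) * ennreal (1 / (1 + norm z) ^ (2 * (DIM('a) + 6)))"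
        by (subst (asm) ennreal_mult') (use C b in simp_all)
    qed
    also have "\<dots> = ennreal (C * (1 + b) ^ (2 * (DIM('a) + 6))) * ennreal D"
      unfolding D(2)[symmetric] by (rule nn_integral_cmult) measurable
    finally show ?thesis using C D b by (simp add: mult_ac flip: ennreal_mult'')
  qed
  then show ?thesis using that[of "C * D * (1 + b) ^ (2 * (DIM('a) + 6))"] C D b by auto
  qed
qed

lemma hit_prob_bound:
  obtains C where "0 \<le> C" "\<And>z. emeasure M {\<omega>\<in>space M. hitq K 0 1 (\<lambda>s. z + B s \<omega>)} \<le> ennreal (C * (1 / (1 + norm z) ^ (2 * (DIM('a) + 6))))"
proof -
  show ?thesis
  proof (rule hit_tail[OF zero_less_one order.refl zero_le_one six_le_exponent K_ball K_nonempty])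
  fix C assume C: "0 \<le> C" and tail: "\<And>X z m. 0 \<le> m \<Longrightarrow> (\<And>s. 0 \<le> s \<Longrightarrow> X s \<in> borel_measurable M) \<Longrightarrow>
      (\<And>\<omega> r. \<omega> \<in> space M \<Longrightarrow> (\<And>s. s \<in> {0..1} \<Longrightarrow> norm (B s \<omega>) \<le> r) \<Longrightarrow>
         (\<And>s. s \<in> {0..1} \<Longrightarrow> norm (X s \<omega>) \<le> 2 * r + m)) \<Longrightarrow>
      emeasure M {\<omega>\<in>space M. hitq K 0 1 (\<lambda>s. z + X s \<omega>)} \<le> ennreal (C * (1 + m) ^ (2 * (DIM('a) + 6)) * (1 / (1 + norm z) ^ (2 * (DIM('a) + 6))))"
  have "emeasure M {\<omega>\<in>space M. hitq K 0 1 (\<lambda>s. z + B s \<omega>)} \<le> ennreal (C * (1 + 0) ^ (2 * (DIM('a) + 6)) * (1 / (1 + norm z) ^ (2 * (DIM('a) + 6))))" for z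
  proof (rule tail)
    fix \<omega> r s assume "\<omega> \<in> space M" and r: "\<And>s. s \<in> {0..1} \<Longrightarrow> norm (B s \<omega>) \<le> r" and s: "s \<in> {0..(1::real)}"
    have "0 \<le> r" using r[OF s] norm_ge_zero order.trans by blast
    with r[OF s] show "norm (B s \<omega>) \<le> 2 * r + 0" by simp
  qed (auto intro: measurable_BM)
  then show ?thesis using that[of C] C by simp
  qed
qed

definition overlap :: "nat \<Rightarrow> (real \<Rightarrow> 'a) \<Rightarrow> bool" where
  "overlap j w \<longleftrightarrow> hitq K 0 1 w \<and> hitq K (real j) (real j + 1) w"

lemma path_event_overlap: "path_event (overlap j)"
  unfolding overlap_def[abs_def] by (intro path_event_conj path_event_hitq) auto

text \<open>Between the two unit intervals lies a gap of length \<open>j - 1\<close>, over which the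
  density of the displacement is at most its value at \<open>0\<close>. Replacing the density by
  this constant decouples the two hits, and integration over the positions yields one factor for
  each.\<close>

lemma drift_overlap:
  assumes j: "2 \<le> j"
  shows "(\<integral>\<^sup>+\<omega>. vol (overlap j) (traj (drift a) \<omega>) \<partial>M)
    \<le> ennreal (1 / sqrt (2 * pi * (real j - 1)) ^ DIM('a)) * (\<integral>\<^sup>+\<omega>. vol (hitq K 0 1) (traj (drift a) \<omega>) \<partial>M)\<^sup>2"
proof -
  \<comment> \<open>The drift is built into \<open>I\<close>, so that the Markov property of the
    driftless \<open>B\<close> applies.\<close>
  define I where "I y w = (indicator (Collect (hitq K 0 1)) (\<lambda>s. y + (w s + s *\<^sub>R a)) :: ennreal)" for y :: 'a and w
  define \<psi> where "\<psi> y = (\<integral>\<^sup>+\<omega>. I y (\<lambda>s. B s \<omega>) \<partial>M)" for y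
  define U where "U = (\<integral>\<^sup>+\<omega>. vol (hitq K 0 1) (traj (drift a) \<omega>) \<partial>M)"
  define h where "h = ennreal (1 / sqrt (2 * pi * (real j - 1)) ^ DIM('a))"
  have I_meas: "(\<lambda>x. I (f x) (g x)) \<in> borel_measurable N"
    if f: "f \<in> borel_measurable N" and g: "\<And>s. 0 \<le> s \<Longrightarrow> (\<lambda>x. g x s) \<in> borel_measurable N" for N :: "'u measure" and f g
  proof -
    have "Measurable.pred N (\<lambda>x. hitq K 0 1 (\<lambda>s. f x + (g x s + s *\<^sub>R a)))"
      by (intro path_event_pred path_event_hitq borel_measurable_add f g) auto
    then show ?thesis unfolding I_def indicator_def mem_Collect_eq of_bool_def by measurable
  qed
  have I_cong: "I y w = I y w'" if "\<And>s. s \<in> {0..1} \<Longrightarrow> w s = w' s" for y w w'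
    unfolding I_def indicator_def mem_Collect_eq using that
    by (intro arg_cong[where f=of_bool] hitq_cong) auto
  have \<psi>m [measurable]: "\<psi> \<in> borel_measurable borel"
  proof -
    have "(\<lambda>p. I (fst p) (\<lambda>s. B s (snd p))) \<in> borel_measurable (borel \<Otimes>\<^sub>M M)"
      by (intro I_meas measurable_compose[OF measurable_snd measurable_BM]) auto
    then show ?thesis unfolding \<psi>_def by (intro borel_measurable_nn_integral) (simp add: case_prod_unfold)
  qed
  have \<psi>_eq: "\<psi> y = emeasure M {\<omega>\<in>space M. hitq K 0 1 (\<lambda>s. y + drift a s \<omega>)}" for y
  proof -
    have "Measurable.pred M (\<lambda>\<omega>. hitq K 0 1 (\<lambda>s. y + drift a s \<omega>))"
      by (intro path_event_pred path_event_hitq borel_measurable_add measurable_BM) auto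
    then have "{\<omega>\<in>space M. hitq K 0 1 (\<lambda>s. y + drift a s \<omega>)} \<in> sets M" by (simp add: pred_def)
    then have "emeasure M {\<omega>\<in>space M. hitq K 0 1 (\<lambda>s. y + drift a s \<omega>)}
       = (\<integral>\<^sup>+\<omega>. indicator {\<omega>\<in>space M. hitq K 0 1 (\<lambda>s. y + drift a s \<omega>)} \<omega> \<partial>M)" by simp
    also have "\<dots> = \<psi> y"
      unfolding \<psi>_def I_def by (intro nn_integral_cong) (simp add: indicator_def)
    finally show ?thesis by simp
  qed
  have U_eq: "U = (\<integral>\<^sup>+z. \<psi> z \<partial>lborel)"
    unfolding U_def \<psi>_eq by (intro nn_integral_vol sigma_finite_M path_event_hitq measurable_drift) auto
  have key: "emeasure M {\<omega>\<in>space M. overlap j (\<lambda>s. z + drift a s \<omega>)} \<le> \<psi> z * (h * U)" for z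
  proof -
    have "Measurable.pred M (\<lambda>\<omega>. overlap j (\<lambda>s. z + drift a s \<omega>))"
      by (intro path_event_pred path_event_overlap borel_measurable_add measurable_BM) auto
    then have "{\<omega>\<in>space M. overlap j (\<lambda>s. z + drift a s \<omega>)} \<in> sets M" by (simp add: pred_def)
    then have "emeasure M {\<omega>\<in>space M. overlap j (\<lambda>s. z + drift a s \<omega>)}
       = (\<integral>\<^sup>+\<omega>. indicator {\<omega>\<in>space M. overlap j (\<lambda>s. z + drift a s \<omega>)} \<omega> \<partial>M)" by simp
    also have "\<dots> = (\<integral>\<^sup>+\<omega>. I z (traj (stop (real j) B) \<omega>) *
        I (z + traj (stop (real j) B) \<omega> (real j) + real j *\<^sub>R a) (traj (restart (real j) B) \<omega>) \<partial>M)"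
    proof (intro nn_integral_cong)
      fix \<omega> assume \<omega>: "\<omega> \<in> space M"
      have 1: "hitq K (real j) (real j + 1) (\<lambda>s. z + drift a s \<omega>) \<longleftrightarrow>
        hitq K 0 1 (\<lambda>s. z + drift a (real j + s) \<omega>)"
        using hitq_shift[of "real j" K 0 1 "\<lambda>s. z + drift a s \<omega>"] by simp
      have 2: "hitq K 0 1 (\<lambda>s. z + drift a (real j + s) \<omega>) \<longleftrightarrow>
        hitq K 0 1 (\<lambda>s. z + traj (stop (real j) B) \<omega> (real j) + real j *\<^sub>R a + (traj (restart (real j) B) \<omega> s + s *\<^sub>R a))"
        by (intro hitq_cong) (simp add: stop_def restart_def algebra_simps)
      have 3: "I z (traj (stop (real j) B) \<omega>) = I z (\<lambda>s. B s \<omega>)"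
        by (intro I_cong) (use j in \<open>auto simp: stop_def\<close>)
      show "indicator {\<omega>\<in>space M. overlap j (\<lambda>s. z + drift a s \<omega>)} \<omega> = I z (traj (stop (real j) B) \<omega>) *
        I (z + traj (stop (real j) B) \<omega> (real j) + real j *\<^sub>R a) (traj (restart (real j) B) \<omega>)"
        unfolding 3 using \<omega> by (simp add: overlap_def 1 2 I_def indicator_def)
    qed
    also have "\<dots> = (\<integral>\<^sup>+\<omega>. \<integral>\<^sup>+\<omega>'. I z (traj (stop (real j) B) \<omega>) *
        I (z + traj (stop (real j) B) \<omega> (real j) + real j *\<^sub>R a) (traj B \<omega>') \<partial>M \<partial>M)"
    proof -
      have "(\<lambda>p. I z (fst p) * I (z + fst p (real j) + real j *\<^sub>R a) (snd p)) \<in> borel_measurable (path_space \<Otimes>\<^sub>M path_space)"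
        by (intro borel_measurable_times_ennreal I_meas borel_measurable_add measurable_pair_components) auto
      from markov[of "real j", OF _ this] show ?thesis by simp
    qed
    \<comment> \<open>The position at time \<open>j\<close> is split at time \<open>1\<close>, when
      the first hit is already decided; the next step makes the displacement over the gap
      independent of it.\<close>
    also have "\<dots> = (\<integral>\<^sup>+\<omega>. I z (traj (stop 1 B) \<omega>) * \<psi> (z + traj (stop 1 B) \<omega> 1 + traj (restart 1 B) \<omega> (real j - 1) + real j *\<^sub>R a) \<partial>M)"
    proof (intro nn_integral_cong)
      fix \<omega>
      have 1: "I z (traj (stop (real j) B) \<omega>) = I z (traj (stop 1 B) \<omega>)"
        by (intro I_cong) (use j in \<open>auto simp: stop_def\<close>)
      have 2: "z + traj (stop (real j) B) \<omega> (real j) + real j *\<^sub>R a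
        = z + traj (stop 1 B) \<omega> 1 + traj (restart 1 B) \<omega> (real j - 1) + real j *\<^sub>R a"
        using j by (simp add: stop_def restart_def)
      have 3: "(\<integral>\<^sup>+\<omega>'. I y (traj B \<omega>') \<partial>M) = \<psi> y" for y
        unfolding \<psi>_def by (intro nn_integral_cong I_cong) auto
      have "(\<integral>\<^sup>+\<omega>'. I z (traj (stop (real j) B) \<omega>) * I (z + traj (stop (real j) B) \<omega> (real j) + real j *\<^sub>R a) (traj B \<omega>') \<partial>M)
         = I z (traj (stop (real j) B) \<omega>) * (\<integral>\<^sup>+\<omega>'. I (z + traj (stop (real j) B) \<omega> (real j) + real j *\<^sub>R a) (traj B \<omega>') \<partial>M)"
        by (intro nn_integral_cmult I_meas) (auto intro: measurable_BM)
      then show "(\<integral>\<^sup>+\<omega>'. I z (traj (stop (real j) B) \<omega>) *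
        I (z + traj (stop (real j) B) \<omega> (real j) + real j *\<^sub>R a) (traj B \<omega>') \<partial>M)
        = I z (traj (stop 1 B) \<omega>) * \<psi> (z + traj (stop 1 B) \<omega> 1 + traj (restart 1 B) \<omega> (real j - 1) + real j *\<^sub>R a)"
        by (simp only: 1 2 3)
    qed
    also have "\<dots> = (\<integral>\<^sup>+\<omega>. \<integral>\<^sup>+\<omega>'. I z (traj (stop 1 B) \<omega>) * \<psi> (z + traj (stop 1 B) \<omega> 1 + traj B \<omega>' (real j - 1) + real j *\<^sub>R a) \<partial>M \<partial>M)"
    proof -
      have "(\<lambda>p. I z (fst p) * \<psi> (z + fst p 1 + snd p (real j - 1) + real j *\<^sub>R a)) \<in> borel_measurable (path_space \<Otimes>\<^sub>M path_space)"
        using j by (intro borel_measurable_times_ennreal I_meas measurable_compose[OF _ \<psi>m] borel_measurable_add measurable_pair_components) auto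
      from markov[of 1, OF _ this] show ?thesis by simp
    qed
    also have "\<dots> \<le> (\<integral>\<^sup>+\<omega>. I z (\<lambda>s. B s \<omega>) * (h * U) \<partial>M)"
    proof (rule nn_integral_mono)
      fix \<omega>
      let ?c = "z + traj (stop 1 B) \<omega> 1 + real j *\<^sub>R a"
      have 1: "I z (traj (stop 1 B) \<omega>) = I z (\<lambda>s. B s \<omega>)"
        by (intro I_cong) (auto simp: stop_def)
      have "(\<integral>\<^sup>+\<omega>'. I z (traj (stop 1 B) \<omega>) * \<psi> (z + traj (stop 1 B) \<omega> 1 + traj B \<omega>' (real j - 1) + real j *\<^sub>R a) \<partial>M)
        = (\<integral>\<^sup>+\<omega>'. I z (traj (stop 1 B) \<omega>) * \<psi> (?c + B (real j - 1) \<omega>') \<partial>M)"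
        using j by (intro nn_integral_cong) (simp add: ac_simps)
      also have "\<dots> = I z (traj (stop 1 B) \<omega>) * (\<integral>\<^sup>+\<omega>'. \<psi> (?c + B (real j - 1) \<omega>') \<partial>M)"
        using j by (intro nn_integral_cmult measurable_compose[OF _ \<psi>m] borel_measurable_add measurable_BM) auto
      also have "(\<integral>\<^sup>+\<omega>'. \<psi> (?c + B (real j - 1) \<omega>') \<partial>M) = (\<integral>\<^sup>+v. ennreal (heat (real j - 1) v) * \<psi> (?c + v) \<partial>lborel)"
        using j by (intro nn_integral_BM) auto
      \<comment> \<open>The only inequality that loses anything: the kernel over the gap is replaced
        by its maximum.\<close>
      also have "\<dots> \<le> (\<integral>\<^sup>+v. h * \<psi> (?c + v) \<partial>lborel)"
        unfolding h_def using j by (intro nn_integral_mono mult_right_mono ennreal_leI heat_le_heat_0) auto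
      also have "\<dots> = h * (\<integral>\<^sup>+v. \<psi> (?c + v) \<partial>lborel)" by (rule nn_integral_cmult) measurable
      also have "(\<integral>\<^sup>+v. \<psi> (?c + v) \<partial>lborel) = U" unfolding U_eq by (rule nn_integral_lborel_shift) measurable
      finally show "(\<integral>\<^sup>+\<omega>'. I z (traj (stop 1 B) \<omega>) * \<psi> (z + traj (stop 1 B) \<omega> 1 + traj B \<omega>' (real j - 1) + real j *\<^sub>R a) \<partial>M)
         \<le> I z (\<lambda>s. B s \<omega>) * (h * U)"
        by (simp add: 1 mult_left_mono)
    qed
    also have "\<dots> = \<psi> z * (h * U)"
      unfolding \<psi>_def by (intro nn_integral_multc I_meas) (auto intro: measurable_BM)
    finally show ?thesis .
  qed
  have "(\<integral>\<^sup>+\<omega>. vol (overlap j) (traj (drift a) \<omega>) \<partial>M) = (\<integral>\<^sup>+z. emeasure M {\<omega>\<in>space M. overlap j (\<lambda>s. z + drift a s \<omega>)} \<partial>lborel)"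
    by (intro nn_integral_vol sigma_finite_M path_event_overlap measurable_drift) auto
  also have "\<dots> \<le> (\<integral>\<^sup>+z. \<psi> z * (h * U) \<partial>lborel)" by (intro nn_integral_mono key)
  also have "\<dots> = U * (h * U)" unfolding U_eq by (rule nn_integral_multc) measurable
  finally show ?thesis unfolding h_def[symmetric] U_def[symmetric] by (simp add: power2_eq_square mult_ac)
qed

end

text \<open>\<open>bridge_segment\<close> and \<open>drift_decomposition\<close> speak of paths
  stopped at \<open>k\<close>; locality is what makes an event of the unstopped path accessible to
  them.\<close>

definition local_event :: "real \<Rightarrow> ((real \<Rightarrow> 'a::euclidean_space) \<Rightarrow> bool) \<Rightarrow> bool" where
  "local_event k Q \<longleftrightarrow> path_event Q \<and> (\<forall>w w'. (\<forall>s\<in>{0..k}. w s = w' s) \<longrightarrow> Q w = Q w')"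

lemma local_event_path_event: "local_event k Q \<Longrightarrow> path_event Q"
  by (simp add: local_event_def)

lemma local_event_cong:
  assumes "local_event k Q" "\<And>s. s \<in> {0..k} \<Longrightarrow> w s = w' s" shows "Q w = Q w'"
proof -
  have "\<forall>w w'. (\<forall>s\<in>{0..k}. w s = w' s) \<longrightarrow> Q w = Q w'"
    using assms(1) unfolding local_event_def by (rule conjunct2)
  from spec[OF spec[OF this, of w], of w'] assms(2) show ?thesis by blast
qed

lemma vol_local:
  assumes "local_event k Q" "\<And>s. s \<in> {0..k} \<Longrightarrow> w s = w' s" shows "vol Q w = vol Q w'"
proof -
  have "Q (\<lambda>s. z + w s) = Q (\<lambda>s. z + w' s)" for z
    by (rule local_event_cong[OF assms(1)]) (simp add: assms(2))
  then show ?thesis unfolding vol_def by (simp add: indicator_def)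
qed

lemma local_eventI:
  assumes "path_event Q" "\<And>w w'. (\<And>s. s \<in> {0..k} \<Longrightarrow> w s = w' s) \<Longrightarrow> Q w = Q w'"
  shows "local_event k Q"
  unfolding local_event_def
proof (intro conjI allI impI assms(1))
  fix w w' :: "real \<Rightarrow> 'a" assume "\<forall>s\<in>{0..k}. w s = w' s"
  then show "Q w = Q w'" by (intro assms(2)) simp
qed

lemma local_event_hitq: "0 \<le> a \<Longrightarrow> b \<le> k \<Longrightarrow> local_event k (hitq K a b)"
  by (rule local_eventI, erule path_event_hitq, rule hitq_cong) simp

lemma local_event_conj:
  assumes "local_event k P" "local_event k Q" shows "local_event k (\<lambda>w. P w \<and> Q w)"
proof (rule local_eventI)
  show "path_event (\<lambda>w. P w \<and> Q w)" using assms by (intro path_event_conj local_event_path_event)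
  fix w w' :: "real \<Rightarrow> 'a" assume eq: "\<And>s. s \<in> {0..k} \<Longrightarrow> w s = w' s"
  show "(P w \<and> Q w) = (P w' \<and> Q w')"
    using local_event_cong[OF assms(1) eq] local_event_cong[OF assms(2) eq] by simp
qed

lemma local_event_not:
  assumes "local_event k P" shows "local_event k (\<lambda>w. \<not> P w)"
proof (rule local_eventI)
  show "path_event (\<lambda>w. \<not> P w)" using assms by (intro path_event_not local_event_path_event)
  fix w w' :: "real \<Rightarrow> 'a" assume eq: "\<And>s. s \<in> {0..k} \<Longrightarrow> w s = w' s"
  show "(\<not> P w) = (\<not> P w')"
    using local_event_cong[OF assms eq] by simp
qed

lemma vol_shift_eq: "vol (\<lambda>w. Q (\<lambda>s. w (i + s))) w = vol Q (\<lambda>s. w (i + s))"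
  by (simp add: vol_def indicator_def)

lemma vol_indicator_bound:
  fixes P :: "nat \<Rightarrow> (real \<Rightarrow> 'a::euclidean_space) \<Rightarrow> bool"
  assumes "\<And>w. Q w \<Longrightarrow> (\<exists>i<n. P i w) \<or> P' w" "\<And>i. path_event (P i)" "path_event P'"
  shows "vol Q w \<le> (\<Sum>i<n. vol (P i) w) + vol P' w"
proof -
  note [measurable] = path_event_slice_measurable[OF assms(2)] path_event_slice_measurable[OF assms(3)]
  have "vol Q w \<le> (\<integral>\<^sup>+z. (\<Sum>i<n. indicator (Collect (P i)) (\<lambda>s. z + w s)) + indicator (Collect P') (\<lambda>s. z + w s) \<partial>lborel)"
    unfolding vol_def
  proof (intro nn_integral_mono)
    fix z
    show "indicator (Collect Q) (\<lambda>s. z + w s) \<le>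
      (\<Sum>i<n. indicator (Collect (P i)) (\<lambda>s. z + w s)) + (indicator (Collect P') (\<lambda>s. z + w s) :: ennreal)"
    proof (cases "Q (\<lambda>s. z + w s)")
      case True
      from assms(1)[OF this] show ?thesis
      proof
        assume "\<exists>i<n. P i (\<lambda>s. z + w s)"
        then obtain i where i: "i < n" "P i (\<lambda>s. z + w s)" by auto
        have "(1::ennreal) = indicator (Collect (P i)) (\<lambda>s. z + w s)" using i by simp
        also have "\<dots> \<le> (\<Sum>i<n. indicator (Collect (P i)) (\<lambda>s. z + w s))"
          using i by (intro member_le_sum) auto
        finally show ?thesis using True by (simp add: add_increasing2)
      qed (simp add: True add_increasing)
    qed simp
  qed
  also have "\<dots> = (\<Sum>i<n. vol (P i) w) + vol P' w"
    unfolding vol_def by (simp add: nn_integral_add nn_integral_sum)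
  finally show ?thesis .
qed

text \<open>By \<open>real n + real m \<le> T\<close>, the look-ahead window of every unit interval
  before \<open>n\<close> ends by time \<open>T\<close>, so the absence of visits up to
  \<open>T\<close> leaves the window clear. The induction peels off the last unit interval.\<close>

lemma hitq_last_visit:
  assumes "hitq K 0 T w" "real n + real m \<le> T" "\<not> hitq K (real n) T w"
  shows "\<exists>i<n. hitq K (real i) (real i + 1) w \<and> \<not> hitq K (real i + 1) (real i + 1 + real m) w"
  using assms(2,3)
proof (induction n)
  case 0
  then show ?case using assms(1) by simp
next
  case (Suc n)
  show ?case
  proof (cases "hitq K (real n) T w")
    case True
    then have "hitq K (real n) (real n + 1) w"
      using hitq_Un[of "real n" "real n + 1" T K w] Suc.prems by (simp add: add.commute)
    moreover have "\<not> hitq K (real n + 1) (real n + 1 + real m) w"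
      using Suc.prems hitq_mono[of K "real n + 1" "real n + 1 + real m" w "real n + 1" T] by (auto simp: add_ac)
    ultimately show ?thesis by blast
  next
    case False
    then show ?thesis using Suc.IH Suc.prems by (auto intro: less_SucI)
  qed
qed

lemma hitq_unit:
  assumes "hitq K (real a) (real b) w" "a < b"
  shows "\<exists>l. a \<le> l \<and> l < b \<and> hitq K (real l) (real l + 1) w"
  using assms
proof (induction b)
  case (Suc b)
  show ?case
  proof (cases "a = b")
    case True
    then show ?thesis using Suc.prems by (auto simp: add.commute)
  next
    case False
    then have ab: "a < b" using Suc.prems by simp
    then have "hitq K (real a) (real b) w \<or> hitq K (real b) (real b + 1) w"
      using Suc.prems hitq_Un[of "real a" "real b" "real b + 1" K w] by (auto simp: add.commute)
    then show ?thesis using Suc.IH ab by (meson less_Suc_eq less_imp_le)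
  qed
qed simp

section \<open>Counting covered points by unit intervals, and means over one segment\<close>

context brownian_motion_and_compact
begin

text \<open>A last visit with finite look-ahead: an event of fixed length, as
  \<open>bridge_segment_vol\<close> requires, at the price that one point may be counted several
  times.\<close>

definition fresh_visit :: "nat \<Rightarrow> (real \<Rightarrow> 'a) \<Rightarrow> bool" where
  "fresh_visit m w \<longleftrightarrow> hitq K 0 1 w \<and> \<not> hitq K 1 (1 + real m) w"

lemma local_fresh_visit: "local_event (1 + real m) (fresh_visit m)"
  unfolding fresh_visit_def[abs_def] by (intro local_event_conj local_event_not local_event_hitq) auto

lemma local_overlap: "local_event (real j + 1) (overlap j)"
  unfolding overlap_def[abs_def] by (intro local_event_conj local_event_hitq) auto

lemma fresh_visit_shift:
  "fresh_visit m (\<lambda>s. w (real i + s)) \<longleftrightarrow> hitq K (real i) (real i + 1) w \<and> \<not> hitq K (real i + 1) (real i + 1 + real m) w"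
  using hitq_shift[of "real i" K 0 1 w] hitq_shift[of "real i" K 1 "1 + real m" w]
  by (simp add: fresh_visit_def add_ac)

lemma overlap_shift:
  "overlap j (\<lambda>s. w (real i + s)) \<longleftrightarrow> hitq K (real i) (real i + 1) w \<and> hitq K (real (i + j)) (real (i + j) + 1) w"
  using hitq_shift[of "real i" K 0 1 w] hitq_shift[of "real i" K "real j" "real j + 1" w]
  by (simp add: overlap_def add_ac)

lemma path_event_fresh_shift: "path_event (\<lambda>w. fresh_visit m (\<lambda>s. w (real i + s)))"
  by (intro path_event_shift local_event_path_event[OF local_fresh_visit]) simp

lemma path_event_overlap_shift: "path_event (\<lambda>w. overlap j (\<lambda>s. w (real i + s)))"
  by (intro path_event_shift path_event_overlap) simp

text \<open>If \<open>K\<close> is not hit after \<open>n\<close>, the last visited unit interval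
  carries a fresh visit; hits after \<open>n\<close> go into the last term.\<close>

lemma vol_upper:
  assumes "real n + real m \<le> T"
  shows "vol (hitq K 0 T) w \<le> (\<Sum>i<n. vol (\<lambda>w. fresh_visit m (\<lambda>s. w (real i + s))) w)
     + vol (\<lambda>w. hitq K 0 (T - real n) (\<lambda>s. w (real n + s))) w"
proof (rule vol_indicator_bound)
  fix w assume "hitq K 0 T w"
  with hitq_last_visit[OF this assms]
  show "(\<exists>i<n. fresh_visit m (\<lambda>s. w (real i + s))) \<or> hitq K 0 (T - real n) (\<lambda>s. w (real n + s))"
    using hitq_shift[of "real n" K 0 "T - real n" w] by (auto simp: fresh_visit_shift)
qed (intro path_event_fresh_shift path_event_shift path_event_hitq; simp)+

text \<open>A fresh visit that is not the last visit before \<open>n\<close> is followed by a clear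
  window of length \<open>m\<close> and then by another visit, so it takes part in an overlap at
  distance more than \<open>m\<close>. True last visits are unique, and each implies a hit.\<close>

lemma vol_lower:
  shows "(\<Sum>i<n. vol (\<lambda>w. fresh_visit m (\<lambda>s. w (real i + s))) w)
    \<le> vol (hitq K 0 (real n)) w + (\<Sum>i<n. \<Sum>j\<in>{Suc m..<n - i}. vol (\<lambda>w. overlap j (\<lambda>s. w (real i + s))) w)"
proof -
  let ?I = "\<lambda>Q z. indicator (Collect Q) (\<lambda>s. z + w s) :: ennreal"
  note [measurable] = path_event_slice_measurable[OF path_event_fresh_shift]
    path_event_slice_measurable[OF path_event_overlap_shift] path_event_slice_measurable[OF path_event_hitq]
  have pt: "(\<Sum>i<n. indicator (Collect (\<lambda>w. fresh_visit m (\<lambda>s. w (real i + s)))) w)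
     \<le> indicator (Collect (hitq K 0 (real n))) w
      + (\<Sum>i<n. \<Sum>j\<in>{Suc m..<n - i}. indicator (Collect (\<lambda>w. overlap j (\<lambda>s. w (real i + s)))) w :: ennreal)" for w
  proof -
    \<comment> \<open>The true last visit: the look-ahead reaches to time \<open>n\<close>, so that
      at most one \<open>i\<close> qualifies.\<close>
    define L where "L i \<longleftrightarrow> hitq K (real i) (real i + 1) w \<and> \<not> hitq K (real i + 1) (real n) w" for i
    have one: "(\<Sum>i<n. of_bool (L i)) \<le> (indicator (Collect (hitq K 0 (real n))) w :: ennreal)"
    proof (cases "\<exists>i<n. L i")
      case True
      then obtain i where i: "i < n" "L i" by auto
      have un: "j = i" if "j < n" "L j" for j
      proof (rule ccontr)
        assume "j \<noteq> i"
        then consider "j < i" | "i < j" by linarith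
        then show False
        proof cases
          case 1
          then have "hitq K (real j + 1) (real n) w"
            using i unfolding L_def by (auto elim!: hitq_mono)
          then show False using that by (simp add: L_def)
        next
          case 2
          then have "hitq K (real i + 1) (real n) w"
            using that unfolding L_def by (auto elim!: hitq_mono)
          then show False using i by (simp add: L_def)
        qed
      qed
      have "(\<Sum>j<n. of_bool (L j)) = (\<Sum>j<n. if j = i then 1 else 0 :: ennreal)"
      proof (rule sum.cong[OF refl])
        fix j assume "j \<in> {..<n}"
        then show "of_bool (L j) = (if j = i then 1 else 0 :: ennreal)"
          using un[of j] i(2) by (cases "L j") auto
      qed
      also have "\<dots> = 1" using i by simp
      finally have eq: "(\<Sum>j<n. of_bool (L j)) = (1 :: ennreal)" .
      have "hitq K 0 (real n) w" using i unfolding L_def by (auto elim!: hitq_mono)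
      then show ?thesis unfolding eq by simp
    qed simp
    have two: "indicator (Collect (\<lambda>w. fresh_visit m (\<lambda>s. w (real i + s)))) w
      \<le> (of_bool (L i) + (\<Sum>j\<in>{Suc m..<n - i}. indicator (Collect (\<lambda>w. overlap j (\<lambda>s. w (real i + s)))) w) :: ennreal)"
      if i: "i < n" for i
    proof (cases "fresh_visit m (\<lambda>s. w (real i + s)) \<and> \<not> L i")
      case True
      then have h: "hitq K (real i) (real i + 1) w" "\<not> hitq K (real i + 1) (real i + 1 + real m) w" "hitq K (real i + 1) (real n) w"
        by (auto simp: fresh_visit_shift L_def)
      have im: "i + 1 + m < n"
      proof (rule ccontr)
        assume "\<not> ?thesis"
        then have "real n \<le> real i + 1 + real m" by linarith
        then show False using h hitq_mono[OF h(3), of "real i + 1" "real i + 1 + real m"] by simp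
      qed
      \<comment> \<open>The later visit before \<open>n\<close> cannot fall into the clear window,
        so it lies in a unit interval \<open>l\<close> with
        \<open>l - i \<ge> Suc m\<close>.\<close>
      then have "hitq K (real (i + 1 + m)) (real n) w"
        using h hitq_Un[of "real i + 1" "real i + 1 + real m" "real n" K w] by (simp add: add_ac)
      then obtain l where l: "i + 1 + m \<le> l" "l < n" "hitq K (real l) (real l + 1) w"
        using hitq_unit im by blast
      define j where "j = l - i"
      have j: "j \<in> {Suc m..<n - i}" "l = i + j" using l by (auto simp: j_def)
      then have "overlap j (\<lambda>s. w (real i + s))" unfolding overlap_shift using h l by simp
      then have "(1::ennreal) = indicator (Collect (\<lambda>w. overlap j (\<lambda>s. w (real i + s)))) w" by simp
      also have "\<dots> \<le> (\<Sum>j\<in>{Suc m..<n - i}. indicator (Collect (\<lambda>w. overlap j (\<lambda>s. w (real i + s)))) w)"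
        using j by (intro member_le_sum) auto
      finally show ?thesis using True by simp
    qed (auto simp: add_increasing2 indicator_def)
    have "(\<Sum>i<n. indicator (Collect (\<lambda>w. fresh_visit m (\<lambda>s. w (real i + s)))) w)
      \<le> (\<Sum>i<n. of_bool (L i) + (\<Sum>j\<in>{Suc m..<n - i}. indicator (Collect (\<lambda>w. overlap j (\<lambda>s. w (real i + s)))) w) :: ennreal)"
      using two by (intro sum_mono) auto
    also have "\<dots> = (\<Sum>i<n. of_bool (L i)) + (\<Sum>i<n. \<Sum>j\<in>{Suc m..<n - i}. indicator (Collect (\<lambda>w. overlap j (\<lambda>s. w (real i + s)))) w)"
      by (rule sum.distrib)
    finally show ?thesis using one by (meson add_right_mono order.trans)
  qed
  have "(\<Sum>i<n. vol (\<lambda>w. fresh_visit m (\<lambda>s. w (real i + s))) w)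
    = (\<integral>\<^sup>+z. (\<Sum>i<n. ?I (\<lambda>w. fresh_visit m (\<lambda>s. w (real i + s))) z) \<partial>lborel)"
    unfolding vol_def by (rule nn_integral_sum[symmetric]) measurable
  also have "\<dots> \<le> (\<integral>\<^sup>+z. ?I (hitq K 0 (real n)) z + (\<Sum>i<n. \<Sum>j\<in>{Suc m..<n - i}. ?I (\<lambda>w. overlap j (\<lambda>s. w (real i + s))) z) \<partial>lborel)"
    by (intro nn_integral_mono pt)
  also have "\<dots> = vol (hitq K 0 (real n)) w + (\<Sum>i<n. \<Sum>j\<in>{Suc m..<n - i}. vol (\<lambda>w. overlap j (\<lambda>s. w (real i + s))) w)"
    unfolding vol_def by (simp add: nn_integral_add nn_integral_sum)
  finally show ?thesis .
qed

text \<open>One function for both processes: \<open>q = 1\<close> is the motion with drift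
  \<open>a\<close>, while \<open>a = x / t\<close> and \<open>q = 1 - k / t\<close> give a segment
  of the bridge. The limit \<open>t \<rightarrow> \<infinity>\<close> thereby becomes continuity at
  \<open>a = 0\<close>, \<open>q = 1\<close>.\<close>

definition segment_mean :: "real \<Rightarrow> ((real \<Rightarrow> 'a) \<Rightarrow> ennreal) \<Rightarrow> 'a \<Rightarrow> real \<Rightarrow> ennreal" where
  "segment_mean k F a q = (\<integral>\<^sup>+u. ennreal (heat (k * q) (u - k *\<^sub>R a)) * bridge_mean k F u \<partial>lborel)"

lemma measurable_bridge_mean:
  "0 \<le> k \<Longrightarrow> F \<in> borel_measurable path_space \<Longrightarrow> bridge_mean k F \<in> borel_measurable borel"
  unfolding bridge_mean_def[abs_def] by (rule measurable_nn_integral_bridge)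

text \<open>Translation invariance of \<open>vol\<close> discards the position of the bridge at time
  \<open>i\<close>; what remains is the restarted bridge of \<open>bridge_segment\<close>.\<close>

lemma bridge_segment_vol:
  assumes "0 \<le> i" "0 < k" "k < t" "i + k \<le> t" and Q: "local_event k Q"
  shows "(\<integral>\<^sup>+\<omega>. vol (\<lambda>w. Q (\<lambda>s. w (i + s))) (traj (brownian_bridge B t x) \<omega>) \<partial>M) = segment_mean k (vol Q) ((1 / t) *\<^sub>R x) (1 - k / t)"
proof -
  note pQ = local_event_path_event[OF Q]
  have "(\<integral>\<^sup>+\<omega>. vol (\<lambda>w. Q (\<lambda>s. w (i + s))) (traj (brownian_bridge B t x) \<omega>) \<partial>M)
    = (\<integral>\<^sup>+\<omega>. vol Q (traj (stop k (restart i (brownian_bridge B t x))) \<omega>) \<partial>M)"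
  proof (rule nn_integral_cong)
    fix \<omega>
    have "vol Q (\<lambda>s. traj (brownian_bridge B t x) \<omega> (i + s))
      = vol Q (\<lambda>s. brownian_bridge B t x i \<omega> + restart i (brownian_bridge B t x) s \<omega>)"
      using assms(1) by (intro vol_cong pQ) (simp add: restart_def)
    also have "\<dots> = vol Q (\<lambda>s. restart i (brownian_bridge B t x) s \<omega>)" by (rule vol_translate[OF pQ])
    also have "\<dots> = vol Q (traj (stop k (restart i (brownian_bridge B t x))) \<omega>)"
      by (rule vol_local[OF Q]) (simp add: stop_def)
    finally show "vol (\<lambda>w. Q (\<lambda>s. w (i + s))) (traj (brownian_bridge B t x) \<omega>) = vol Q (traj (stop k (restart i (brownian_bridge B t x))) \<omega>)"
      unfolding vol_shift_eq .
  qed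
  also have "\<dots> = segment_mean k (vol Q) ((1 / t) *\<^sub>R x) (1 - k / t)"
    unfolding segment_mean_def bridge_mean_def
    using bridge_segment[OF assms(1-4) vol_measurable[OF pQ], of x] by simp
  finally show ?thesis .
qed

lemma drift_segment_vol:
  assumes "0 < k" and Q: "local_event k Q"
  shows "(\<integral>\<^sup>+\<omega>. vol Q (traj (drift a) \<omega>) \<partial>M) = segment_mean k (vol Q) a 1"
proof -
  have "(\<integral>\<^sup>+\<omega>. vol Q (traj (drift a) \<omega>) \<partial>M) = (\<integral>\<^sup>+\<omega>. vol Q (traj (stop k (drift a)) \<omega>) \<partial>M)"
    by (intro nn_integral_cong vol_local[OF Q]) (simp add: stop_def)
  then show ?thesis
    using drift_decomposition[OF assms(1) vol_measurable[OF local_event_path_event[OF Q]], of a]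
    by (simp add: segment_mean_def bridge_mean_def)
qed

lemma BM_segment_vol:
  assumes "0 < k" and Q: "local_event k Q"
  shows "(\<integral>\<^sup>+\<omega>. vol Q (traj B \<omega>) \<partial>M) = segment_mean k (vol Q) 0 1"
  using drift_segment_vol[OF assms, of 0] by simp

text \<open>\<open>heat_compare\<close> under the integral. The constant is uniform as long as
  \<open>q\<close> stays above \<open>q0\<close>, that is, as long as the segment leaves a fixed
  fraction of the bridge free.\<close>

lemma segment_mean_le:
  assumes k: "0 < k" and q: "0 < q0" "q0 \<le> q" "q \<le> 1" and F: "F \<in> borel_measurable path_space"
  shows "segment_mean k F a q \<le> ennreal ((1 / sqrt q0) ^ DIM('a)) * segment_mean k F a 1"
proof -
  have [measurable]: "bridge_mean k F \<in> borel_measurable borel"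
    using k F by (intro measurable_bridge_mean) auto
  have q': "0 < q" using q by simp
  have "(1 / sqrt q) ^ DIM('a) \<le> (1 / sqrt q0) ^ DIM('a)"
    using q by (intro power_mono divide_left_mono mult_pos_pos) auto
  have "segment_mean k F a q \<le> (\<integral>\<^sup>+u. ennreal ((1 / sqrt q0) ^ DIM('a)) * (ennreal (heat (k * 1) (u - k *\<^sub>R a)) * bridge_mean k F u) \<partial>lborel)"
    unfolding segment_mean_def
  proof (intro nn_integral_mono)
    fix u :: 'a
    have "heat (k * q) (u - k *\<^sub>R a) \<le> (1 / sqrt q) ^ DIM('a) * heat k (u - k *\<^sub>R a)"
      using k q' q by (intro heat_compare) auto
    also have "\<dots> \<le> (1 / sqrt q0) ^ DIM('a) * heat k (u - k *\<^sub>R a)"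
      using k \<open>(1 / sqrt q) ^ DIM('a) \<le> (1 / sqrt q0) ^ DIM('a)\<close> by (intro mult_right_mono) auto
    finally have "ennreal (heat (k * q) (u - k *\<^sub>R a)) \<le> ennreal ((1 / sqrt q0) ^ DIM('a)) * ennreal (heat k (u - k *\<^sub>R a))"
      using k q by (simp add: ennreal_leI flip: ennreal_mult'')
    then show "ennreal (heat (k * q) (u - k *\<^sub>R a)) * bridge_mean k F u \<le>
        ennreal ((1 / sqrt q0) ^ DIM('a)) * (ennreal (heat (k * 1) (u - k *\<^sub>R a)) * bridge_mean k F u)"
      by (simp add: mult_right_mono flip: mult.assoc)
  qed
  also have "\<dots> = ennreal ((1 / sqrt q0) ^ DIM('a)) * segment_mean k F a 1"
    unfolding segment_mean_def by (rule nn_integral_cmult) measurable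
  finally show ?thesis .
qed

text \<open>With \<open>v = u - k *\<^sub>R a\<close>, the bound
  \<open>(norm u)\<^sup>2 \<le> 2 * (norm v)\<^sup>2 + 2 * k\<^sup>2\<close> puts the Gaussian in
  \<open>v\<close> below \<open>exp (k / 2)\<close> times a Gaussian in \<open>u\<close> with twice
  the variance. This one absorbs two polynomial factors, one for the growth of bridge means and one
  for integrability.\<close>

lemma heat_dominated:
  assumes k: "0 < k"
  obtains A where "0 \<le> A" "\<And>a q u. norm a \<le> 1 \<Longrightarrow> 1 / 2 \<le> q \<Longrightarrow> q \<le> 1 \<Longrightarrow>
     heat (k * q) (u - k *\<^sub>R a) * (1 + norm u) ^ (2 * (DIM('a) + 6)) \<le> A * (1 / (1 + norm (u::'a)) ^ (2 * (DIM('a) + 6)))"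
proof -
  let ?p = "2 * (DIM('a) + 6)"
  define A1 where "A1 = (1 / sqrt (1 / 2)) ^ DIM('a) * (1 / sqrt (2 * pi * k) ^ DIM('a)) * exp (k / 2)"
  define A2 where "A2 = (real (?p + ?p) + 1) ^ (?p + ?p) * exp (1 / (4 * (1 / (4 * k))))"
  have A1: "0 \<le> A1" using k by (simp add: A1_def)
  have A2: "0 \<le> A2" by (simp add: A2_def)
  have "heat (k * q) (u - k *\<^sub>R a) * (1 + norm u) ^ ?p \<le> (A1 * A2) * (1 / (1 + norm u) ^ ?p)"
    if a: "norm a \<le> 1" and q: "1 / 2 \<le> q" "q \<le> 1" for a u :: 'a and q
  proof -
    define v where "v = u - k *\<^sub>R a"
    have "norm u \<le> norm v + norm (k *\<^sub>R a)" 
      using norm_triangle_ineq[of v "k *\<^sub>R a"] by (simp add: v_def)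
    also have "\<dots> \<le> norm v + k" using a k by (simp add: mult_left_le)
    finally have "(norm u)\<^sup>2 \<le> (norm v + k)\<^sup>2" by (intro power_mono) auto
    also have "\<dots> \<le> 2 * (norm v)\<^sup>2 + 2 * k\<^sup>2"
      using sum_squares_bound[of "norm v" k] by (simp add: power2_sum)
    finally have "(norm u)\<^sup>2 / (4 * k) \<le> (2 * (norm v)\<^sup>2 + 2 * k\<^sup>2) / (4 * k)"
      using k by (intro divide_right_mono) auto
    also have "\<dots> = (norm v)\<^sup>2 / (2 * k) + k / 2"
      using k by (simp add: field_simps power2_eq_square)
    finally have e: "exp (- (norm v)\<^sup>2 / (2 * k)) \<le> exp (k / 2) * exp (- (1 / (4 * k)) * (norm u)\<^sup>2)"
      by (simp flip: exp_add)
    have "heat (k * q) v \<le> (1 / sqrt q) ^ DIM('a) * heat k v"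
      using k q by (intro heat_compare) auto
    also have "\<dots> \<le> (1 / sqrt (1 / 2)) ^ DIM('a) * heat k v"
      using k q by (intro mult_right_mono power_mono divide_left_mono mult_pos_pos) auto
    also have "heat k v \<le> exp (k / 2) * exp (- (1 / (4 * k)) * (norm u)\<^sup>2) / sqrt (2 * pi * k) ^ DIM('a)"
      unfolding heat_def using e k by (intro divide_right_mono) auto
    finally have h: "heat (k * q) v \<le> A1 * exp (- (1 / (4 * k)) * (norm u)\<^sup>2)"
      by (simp add: A1_def mult_ac mult_left_mono)
    have "heat (k * q) v * (1 + norm u) ^ ?p * (1 + norm u) ^ ?p \<le> A1 * exp (- (1 / (4 * k)) * (norm u)\<^sup>2) * (1 + norm u) ^ ?p * (1 + norm u) ^ ?p"
      using h by (intro mult_right_mono) auto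
    also have "\<dots> = A1 * ((1 + norm u) ^ (?p + ?p) * exp (- (1 / (4 * k)) * (norm u)\<^sup>2))"
      unfolding power_add by (simp only: mult_ac)
    also have "\<dots> \<le> A1 * A2" unfolding A2_def using k A1 by (intro mult_left_mono power_exp_bound) auto
    finally have "heat (k * q) v * (1 + norm u) ^ ?p * (1 + norm u) ^ ?p \<le> A1 * A2" .
    then have "heat (k * q) v * (1 + norm u) ^ ?p \<le> A1 * A2 / (1 + norm u) ^ ?p"
    proof (subst pos_le_divide_eq)
      show "0 < (1 + norm u) ^ ?p" by (intro zero_less_power add_pos_nonneg) auto
    qed
    then show ?thesis by (simp add: v_def)
  qed
  then show ?thesis using that[of "A1 * A2"] A1 A2 by simp
qed

text \<open>Dominated convergence with the majorant from \<open>heat_dominated\<close>. As it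
  concerns sequences, a failure of continuity is first turned into sequences of drifts and variance
  factors.\<close>

lemma segment_mean_continuous:
  assumes k: "0 < k" and F: "F \<in> borel_measurable path_space" and C: "0 \<le> C"
    and bd: "\<And>u. bridge_mean k F u \<le> ennreal (C * (1 + norm u) ^ (2 * (DIM('a) + 6)))" and \<epsilon>: "0 < \<epsilon>"
  shows "\<exists>\<delta>>0. \<forall>a q. norm a < \<delta> \<longrightarrow> 1 - \<delta> < q \<longrightarrow> q \<le> 1 \<longrightarrow>
     segment_mean k F a q < \<infinity> \<and> \<bar>enn2real (segment_mean k F a q) - enn2real (segment_mean k F 0 1)\<bar> < \<epsilon>"
proof -
  let ?p = "2 * (DIM('a) + 6)"
  have bm [measurable]: "bridge_mean k F \<in> borel_measurable borel"
    using k F by (intro measurable_bridge_mean) auto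
  define g where "g u = enn2real (bridge_mean k F u)" for u
  have [measurable]: "g \<in> borel_measurable borel" unfolding g_def by measurable
  have g0: "0 \<le> g u" for u by (simp add: g_def)
  have gb: "g u \<le> C * (1 + norm u) ^ ?p" for u
    unfolding g_def using bd[of u] C by (intro enn2real_leI) auto
  have gE: "bridge_mean k F u = ennreal (g u)" for u
    unfolding g_def using bd[of u] by (simp add: ennreal_enn2real_if top_unique) (metis ennreal_neq_top top_unique)
  obtain A where A: "0 \<le> A" and hd: "\<And>a q u. norm a \<le> 1 \<Longrightarrow> 1 / 2 \<le> q \<Longrightarrow> q \<le> 1 \<Longrightarrow>
     heat (k * q) (u - k *\<^sub>R a) * (1 + norm u) ^ ?p \<le> A * (1 / (1 + norm (u::'a)) ^ ?p)"
    using heat_dominated[OF k] by blast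
  define D where "D u = C * A * (1 / (1 + norm (u::'a)) ^ ?p)" for u
  have Di: "integrable lborel D"
    unfolding D_def by (intro integrable_mult_right integrable_inverse_power_norm) auto
  have dom: "norm (heat (k * q) (u - k *\<^sub>R a) * g u) \<le> D u" if "norm a \<le> 1" "1 / 2 \<le> q" "q \<le> 1" for a q u
  proof -
    have "norm (heat (k * q) (u - k *\<^sub>R a) * g u) = heat (k * q) (u - k *\<^sub>R a) * g u"
      using k that g0 by simp
    also have "\<dots> \<le> heat (k * q) (u - k *\<^sub>R a) * (C * (1 + norm u) ^ ?p)"
      using k that gb by (intro mult_left_mono) auto
    also have "\<dots> = C * (heat (k * q) (u - k *\<^sub>R a) * (1 + norm u) ^ ?p)" by simp
    also have "\<dots> \<le> C * (A * (1 / (1 + norm u) ^ ?p))" by (intro mult_left_mono hd that C)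
    finally show ?thesis by (simp only: D_def mult.assoc)
  qed
  define Jr where "Jr a q = integral\<^sup>L lborel (\<lambda>u. heat (k * q) (u - k *\<^sub>R a) * g u)" for a q
  have J: "segment_mean k F a q = ennreal (Jr a q) \<and> enn2real (segment_mean k F a q) = Jr a q"
    if "norm a \<le> 1" "1 / 2 \<le> q" "q \<le> 1" for a q
  proof -
    have int: "integrable lborel (\<lambda>u. heat (k * q) (u - k *\<^sub>R a) * g u)"
    proof (rule Bochner_Integration.integrable_bound[OF Di])
      show "AE u in lborel. norm (heat (k * q) (u - k *\<^sub>R a) * g u) \<le> norm (D u)"
        by (intro AE_I2 order.trans[OF dom[OF that]]) simp
    qed measurable
    have nn: "0 \<le> heat (k * q) (u - k *\<^sub>R a) * g u" for u using k that g0 by auto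
    have "segment_mean k F a q = (\<integral>\<^sup>+u. ennreal (heat (k * q) (u - k *\<^sub>R a) * g u) \<partial>lborel)"
      unfolding segment_mean_def gE using k that g0 by (simp add: ennreal_mult)
    also have "\<dots> = ennreal (Jr a q)"
      unfolding Jr_def by (rule nn_integral_eq_integral[OF int]) (use nn in auto)
    finally have eq: "segment_mean k F a q = ennreal (Jr a q)" .
    have "0 \<le> Jr a q" unfolding Jr_def by (intro integral_nonneg_AE AE_I2 nn)
    then show ?thesis using eq by simp
  qed
  show ?thesis
  proof (rule ccontr)
    assume neg: "\<not> ?thesis"
    \<comment> \<open>The radius \<open>1 / (n + 2)\<close> keeps every term within
      \<open>norm a \<le> 1\<close> and \<open>1 / 2 \<le> q\<close>, where the majorant is
      valid.\<close>
    have "\<exists>a q. norm a < 1 / (real n + 2) \<and> 1 - 1 / (real n + 2) < q \<and> q \<le> 1 \<and> \<epsilon> \<le> \<bar>Jr a q - Jr 0 1\<bar>" for n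
    proof -
      have "0 < 1 / (real n + 2)" by simp
      with neg obtain a q where aq: "norm a < 1 / (real n + 2)" "1 - 1 / (real n + 2) < q" "q \<le> 1"
        and bad: "\<not> (segment_mean k F a q < \<infinity> \<and> \<bar>enn2real (segment_mean k F a q) - enn2real (segment_mean k F 0 1)\<bar> < \<epsilon>)"
        by blast
      have "1 / (real n + 2) \<le> 1 / 2" by (intro divide_left_mono) auto
      then have "norm a \<le> 1" "1 / 2 \<le> q" using aq by linarith+
      then have "\<epsilon> \<le> \<bar>Jr a q - Jr 0 1\<bar>" using bad J[of a q] J[of 0 1] aq by auto
      then show ?thesis using aq by blast
    qed
    then obtain a q where aq: "\<And>n. norm (a n) < 1 / (real n + 2)" "\<And>n. 1 - 1 / (real n + 2) < q n" "\<And>n. q n \<le> 1"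
      and bad: "\<And>n. \<epsilon> \<le> \<bar>Jr (a n) (q n) - Jr 0 1\<bar>"
      by metis
    have lim0: "(\<lambda>n. 1 / (real n + 2)) \<longlonglongrightarrow> 0" by real_asymp
    have la: "a \<longlonglongrightarrow> 0"
      by (rule Lim_null_comparison[OF _ lim0]) (use aq(1) in \<open>auto intro!: always_eventually less_imp_le\<close>)
    have lq: "q \<longlonglongrightarrow> 1"
    proof (rule tendsto_sandwich)
      show "(\<lambda>n. 1 - 1 / (real n + 2)) \<longlonglongrightarrow> 1" by real_asymp
      show "(\<lambda>n. 1) \<longlonglongrightarrow> (1::real)" by simp
    qed (use aq in \<open>auto intro!: always_eventually less_imp_le\<close>)
    have le: "1 / (real n + 2) \<le> 1 / 2" for n by (intro divide_left_mono) auto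
    have bnd: "norm (a n) \<le> 1" "1 / 2 \<le> q n" for n
      using aq(1)[of n] aq(2)[of n] le[of n] by linarith+
    have "(\<lambda>n. Jr (a n) (q n)) \<longlonglongrightarrow> Jr 0 1"
      unfolding Jr_def
    proof (rule integral_dominated_convergence[OF _ _ Di])
      show "AE u in lborel. (\<lambda>n. heat (k * q n) (u - k *\<^sub>R a n) * g u) \<longlonglongrightarrow> heat (k * 1) (u - k *\<^sub>R 0) * g u"
        unfolding heat_def using k by (intro AE_I2 tendsto_intros la lq) auto
      show "AE u in lborel. norm (heat (k * q n) (u - k *\<^sub>R a n) * g u) \<le> D u" for n
        using dom[OF bnd aq(3)] by auto
    qed measurable
    then have "(\<lambda>n. \<bar>Jr (a n) (q n) - Jr 0 1\<bar>) \<longlonglongrightarrow> \<bar>Jr 0 1 - Jr 0 1\<bar>" by (intro tendsto_intros)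
    then have "\<epsilon> \<le> \<bar>Jr 0 1 - Jr 0 1\<bar>" by (rule LIMSEQ_le_const) (use bad in auto)
    then show False using \<epsilon> by simp
  qed
qed

end

section \<open>Asymptotics of the bridge volume\<close>

context brownian_motion_and_compact
begin

definition heat_max :: "nat \<Rightarrow> real" where
  "heat_max j = 1 / sqrt (2 * pi * real j) ^ DIM('a)"

lemma heat_max_nonneg: "0 \<le> heat_max j"
  by (simp add: heat_max_def)

text \<open>The dimension enters here: \<open>3 \<le> DIM('a)\<close> makes these maxima summable,
  which gives both small overcounting and transience.\<close>

lemma heat_max_le: 
  assumes "1 \<le> j" shows "heat_max j \<le> real j powr (- 3 / 2)"
proof -
  have j: "1 \<le> sqrt (real j)" using assms by simp
  have "sqrt (real j) \<le> sqrt (2 * pi * real j)" using assms pi_ge_two by (intro real_sqrt_le_mono) simp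
  then have "sqrt (real j) ^ DIM('a) \<le> sqrt (2 * pi * real j) ^ DIM('a)" by (intro power_mono) auto
  moreover have "sqrt (real j) ^ 3 \<le> sqrt (real j) ^ DIM('a)" using dim j by (intro power_increasing) auto
  moreover have "sqrt (real j) ^ 3 = real j powr (3 / 2)"
    using assms by (simp add: powr_half_sqrt[symmetric] powr_powr flip: powr_realpow)
  ultimately have "real j powr (3 / 2) \<le> sqrt (2 * pi * real j) ^ DIM('a)" by linarith
  then have "heat_max j \<le> 1 / real j powr (3 / 2)"
    unfolding heat_max_def using assms by (intro divide_left_mono mult_pos_pos) auto
  then show ?thesis by (simp add: powr_minus_divide)
qed

lemma summable_heat_max: "summable heat_max"
proof (rule summable_comparison_test)
  show "\<exists>N. \<forall>n\<ge>N. norm (heat_max n) \<le> real n powr (- 3 / 2)"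
    using heat_max_le heat_max_nonneg by (intro exI[of _ 1]) auto
  show "summable (\<lambda>n. real n powr (- 3 / 2))" by (subst summable_real_powr_iff) simp
qed

definition visit_rate :: "nat \<Rightarrow> real" where
  "visit_rate m = enn2real (\<integral>\<^sup>+\<omega>. vol (fresh_visit m) (traj B \<omega>) \<partial>M)"

definition bridge_volume :: "real \<Rightarrow> 'a \<Rightarrow> ennreal" where
  "bridge_volume t x = (\<integral>\<^sup>+\<omega>. vol (hitq K 0 t) (traj (brownian_bridge B t x) \<omega>) \<partial>M)"

lemma measurable_vol_bridge:
  assumes "path_event Q" "0 \<le> t"
  shows "(\<lambda>\<omega>. vol Q (traj (brownian_bridge B t x) \<omega>)) \<in> borel_measurable M"
proof -
  have "traj (brownian_bridge B t x) \<in> measurable M path_space"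
    using assms(2) by (intro measurable_traj measurable_bridge)
  then show ?thesis using vol_measurable[OF assms(1)] by (rule measurable_compose)
qed

text \<open>\<open>vol_upper\<close> in the mean. All fresh visits occupy segments of the same
  length, so the \<open>n\<close> terms have the same mean.\<close>

lemma bridge_volume_upper:
  assumes "real n + real m \<le> t" "0 < n" "1 \<le> m" "1 + real m < t"
  shows "bridge_volume t x \<le> of_nat n * segment_mean (1 + real m) (vol (fresh_visit m)) ((1 / t) *\<^sub>R x) (1 - (1 + real m) / t)
    + segment_mean (t - real n) (vol (hitq K 0 (t - real n))) ((1 / t) *\<^sub>R x) (1 - (t - real n) / t)"
proof -
  let ?W = "traj (brownian_bridge B t x)"
  have t: "1 + real m \<le> t" "0 \<le> t" using assms by auto
  note m = measurable_vol_bridge[OF path_event_fresh_shift t(2)]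
  have pe: "path_event (\<lambda>w. hitq K 0 (t - real n) (\<lambda>s. w (real n + s)))"
    by (intro path_event_shift path_event_hitq) auto
  note m' = measurable_vol_bridge[OF pe t(2)]
  have "bridge_volume t x \<le> (\<integral>\<^sup>+\<omega>. (\<Sum>i<n. vol (\<lambda>w. fresh_visit m (\<lambda>s. w (real i + s))) (?W \<omega>))
     + vol (\<lambda>w. hitq K 0 (t - real n) (\<lambda>s. w (real n + s))) (?W \<omega>) \<partial>M)"
    unfolding bridge_volume_def by (intro nn_integral_mono vol_upper assms)
  also have "\<dots> = (\<Sum>i<n. \<integral>\<^sup>+\<omega>. vol (\<lambda>w. fresh_visit m (\<lambda>s. w (real i + s))) (?W \<omega>) \<partial>M)
     + (\<integral>\<^sup>+\<omega>. vol (\<lambda>w. hitq K 0 (t - real n) (\<lambda>s. w (real n + s))) (?W \<omega>) \<partial>M)"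
    using m m' by (simp add: nn_integral_add nn_integral_sum)
  also have "(\<Sum>i<n. \<integral>\<^sup>+\<omega>. vol (\<lambda>w. fresh_visit m (\<lambda>s. w (real i + s))) (?W \<omega>) \<partial>M)
    \<le> (\<Sum>i<n. segment_mean (1 + real m) (vol (fresh_visit m)) ((1 / t) *\<^sub>R x) (1 - (1 + real m) / t))"
  proof (intro sum_mono)
    fix i assume i: "i \<in> {..<n}"
    show "(\<integral>\<^sup>+\<omega>. vol (\<lambda>w. fresh_visit m (\<lambda>s. w (real i + s))) (?W \<omega>) \<partial>M)
      \<le> segment_mean (1 + real m) (vol (fresh_visit m)) ((1 / t) *\<^sub>R x) (1 - (1 + real m) / t)"
    proof -
      have "real i + (1 + real m) \<le> t" using i assms by auto
      then have "(\<integral>\<^sup>+\<omega>. vol (\<lambda>w. fresh_visit m (\<lambda>s. w (real i + s))) (?W \<omega>) \<partial>M)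
        = segment_mean (1 + real m) (vol (fresh_visit m)) ((1 / t) *\<^sub>R x) (1 - (1 + real m) / t)"
        using assms by (intro bridge_segment_vol local_fresh_visit) auto
      then show ?thesis by simp
    qed
  qed
  also have "(\<integral>\<^sup>+\<omega>. vol (\<lambda>w. hitq K 0 (t - real n) (\<lambda>s. w (real n + s))) (?W \<omega>) \<partial>M)
    = segment_mean (t - real n) (vol (hitq K 0 (t - real n))) ((1 / t) *\<^sub>R x) (1 - (t - real n) / t)"
    using assms by (intro bridge_segment_vol local_event_hitq) auto
  finally show ?thesis by (simp add: add_right_mono)
qed

text \<open>The overlap terms of \<open>vol_lower\<close> measure the overcounting. Only the first
  \<open>n\<close> time units are used, where \<open>n \<le> (1 - \<eta>) * t\<close>, so every
  overlap leaves a fraction \<open>\<eta>\<close> of the bridge free and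
  \<open>segment_mean_le\<close> applies with \<open>q0 = \<eta>\<close>.\<close>

lemma bridge_volume_lower:
  assumes "real n + real m \<le> t" "1 + real m < t" "1 \<le> m" and \<eta>: "0 < \<eta>" "\<eta> \<le> 1 - real n / t" and a: "norm ((1 / t) *\<^sub>R x) \<le> 1"
    and U: "0 \<le> U" "\<And>a. norm a \<le> 1 \<Longrightarrow> (\<integral>\<^sup>+\<omega>. vol (hitq K 0 1) (traj (drift a) \<omega>) \<partial>M) \<le> ennreal U"
  shows "of_nat n * segment_mean (1 + real m) (vol (fresh_visit m)) ((1 / t) *\<^sub>R x) (1 - (1 + real m) / t)
    \<le> bridge_volume t x + of_nat n * ennreal ((1 / sqrt \<eta>) ^ DIM('a) * U\<^sup>2 * (\<Sum>l. heat_max (l + m)))"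
proof -
  let ?W = "traj (brownian_bridge B t x)" and ?a = "(1 / t) *\<^sub>R x"
  define G where "G = (1 / sqrt \<eta>) ^ DIM('a) * U\<^sup>2"
  have G: "0 \<le> G" using \<eta> by (simp add: G_def)
  have t: "0 < t" using assms by linarith
  then have t0: "0 \<le> t" by simp
  have nt: "real n < t" using \<eta> t by (simp add: field_simps) (smt (verit) mult_pos_pos)
  note m1 = measurable_vol_bridge[OF path_event_fresh_shift t0]
  note m2 = measurable_vol_bridge[OF path_event_overlap_shift t0]
  note m3 = measurable_vol_bridge[OF path_event_hitq[OF order.refl] t0]
  have ov: "(\<integral>\<^sup>+\<omega>. vol (\<lambda>w. overlap j (\<lambda>s. w (real i + s))) (?W \<omega>) \<partial>M) \<le> ennreal (G * heat_max (j - 1))"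
    if i: "i < n" and j: "j \<in> {Suc m..<n - i}" for i j
  proof -
    have jn: "real j + 1 \<le> real n" "real i + (real j + 1) \<le> real n" "2 \<le> j" using i j assms by auto
    have q: "\<eta> \<le> 1 - (real j + 1) / t"
    proof -
      have "(real j + 1) / t \<le> real n / t" using jn t by (intro divide_right_mono) auto
      then show ?thesis using \<eta> by simp
    qed
    have "(\<integral>\<^sup>+\<omega>. vol (\<lambda>w. overlap j (\<lambda>s. w (real i + s))) (?W \<omega>) \<partial>M)
      = segment_mean (real j + 1) (vol (overlap j)) ?a (1 - (real j + 1) / t)"
      using jn nt by (intro bridge_segment_vol local_overlap) auto
    also have "\<dots> \<le> ennreal ((1 / sqrt \<eta>) ^ DIM('a)) * segment_mean (real j + 1) (vol (overlap j)) ?a 1"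
      using \<eta> q t by (intro segment_mean_le vol_measurable path_event_overlap) auto
    also have "segment_mean (real j + 1) (vol (overlap j)) ?a 1 = (\<integral>\<^sup>+\<omega>. vol (overlap j) (traj (drift ?a) \<omega>) \<partial>M)"
      by (intro drift_segment_vol[symmetric] local_overlap) auto
    also have "\<dots> \<le> ennreal (1 / sqrt (2 * pi * (real j - 1)) ^ DIM('a)) * (\<integral>\<^sup>+\<omega>. vol (hitq K 0 1) (traj (drift ?a) \<omega>) \<partial>M)\<^sup>2"
      using jn by (intro drift_overlap)
    also have "\<dots> \<le> ennreal (1 / sqrt (2 * pi * (real j - 1)) ^ DIM('a)) * (ennreal U)\<^sup>2"
      using U(2)[OF a] by (intro mult_left_mono power_mono) auto
    also have "\<dots> = ennreal (heat_max (j - 1) * U\<^sup>2)"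
      using U jn by (simp add: heat_max_def of_nat_diff ennreal_power flip: ennreal_mult'')
    finally have "(\<integral>\<^sup>+\<omega>. vol (\<lambda>w. overlap j (\<lambda>s. w (real i + s))) (?W \<omega>) \<partial>M)
       \<le> ennreal ((1 / sqrt \<eta>) ^ DIM('a)) * ennreal (heat_max (j - 1) * U\<^sup>2)"
      by (simp add: mult_left_mono)
    also have "\<dots> = ennreal (G * heat_max (j - 1))"
      using \<eta> heat_max_nonneg by (subst ennreal_mult'[symmetric]) (auto simp: G_def mult_ac)
    finally show ?thesis .
  qed
  \<comment> \<open>An overlap at distance \<open>j\<close> has a gap of length
    \<open>j - 1\<close>, so distances from \<open>Suc m\<close> on start the tail of
    \<open>heat_max\<close> at \<open>m\<close>.\<close>
  have tail: "(\<Sum>j\<in>{Suc m..<p}. heat_max (j - 1)) \<le> (\<Sum>l. heat_max (l + m))" for p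
  proof -
    have "(\<Sum>j\<in>{Suc m..<p}. heat_max (j - 1)) = (\<Sum>l\<in>{..<p - Suc m}. heat_max (l + m))"
      by (rule sum.reindex_bij_witness[of _ "\<lambda>l. l + Suc m" "\<lambda>j. j - Suc m"]) auto
    also have "\<dots> \<le> (\<Sum>l. heat_max (l + m))"
      using summable_heat_max heat_max_nonneg by (intro sum_le_suminf) (auto simp: summable_iff_shift)
    finally show ?thesis .
  qed
  have "of_nat n * segment_mean (1 + real m) (vol (fresh_visit m)) ?a (1 - (1 + real m) / t)
    = (\<Sum>i<n. \<integral>\<^sup>+\<omega>. vol (\<lambda>w. fresh_visit m (\<lambda>s. w (real i + s))) (?W \<omega>) \<partial>M)"
  proof -
    have "(\<Sum>i<n. \<integral>\<^sup>+\<omega>. vol (\<lambda>w. fresh_visit m (\<lambda>s. w (real i + s))) (?W \<omega>) \<partial>M)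
      = (\<Sum>i<n. segment_mean (1 + real m) (vol (fresh_visit m)) ?a (1 - (1 + real m) / t))"
      using assms by (intro sum.cong refl bridge_segment_vol local_fresh_visit) auto
    then show ?thesis by simp
  qed
  also have "\<dots> = (\<integral>\<^sup>+\<omega>. (\<Sum>i<n. vol (\<lambda>w. fresh_visit m (\<lambda>s. w (real i + s))) (?W \<omega>)) \<partial>M)"
    by (rule nn_integral_sum[symmetric]) (rule m1)
  also have "\<dots> \<le> (\<integral>\<^sup>+\<omega>. vol (hitq K 0 (real n)) (?W \<omega>) + (\<Sum>i<n. \<Sum>j\<in>{Suc m..<n - i}. vol (\<lambda>w. overlap j (\<lambda>s. w (real i + s))) (?W \<omega>)) \<partial>M)"
    by (intro nn_integral_mono vol_lower)
  also have "\<dots> = (\<integral>\<^sup>+\<omega>. vol (hitq K 0 (real n)) (?W \<omega>) \<partial>M)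
     + (\<Sum>i<n. \<Sum>j\<in>{Suc m..<n - i}. \<integral>\<^sup>+\<omega>. vol (\<lambda>w. overlap j (\<lambda>s. w (real i + s))) (?W \<omega>) \<partial>M)"
    using m2 m3 by (simp add: nn_integral_add nn_integral_sum)
  also have "\<dots> \<le> bridge_volume t x + (\<Sum>i<n. ennreal (G * (\<Sum>l. heat_max (l + m))))"
  proof (intro add_mono sum_mono)
    show "(\<integral>\<^sup>+\<omega>. vol (hitq K 0 (real n)) (?W \<omega>) \<partial>M) \<le> bridge_volume t x"
      unfolding bridge_volume_def using nt by (intro nn_integral_mono vol_mono) (auto elim: hitq_mono)
    fix i assume i: "i \<in> {..<n}"
    have "(\<Sum>j\<in>{Suc m..<n - i}. \<integral>\<^sup>+\<omega>. vol (\<lambda>w. overlap j (\<lambda>s. w (real i + s))) (?W \<omega>) \<partial>M)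
      \<le> (\<Sum>j\<in>{Suc m..<n - i}. ennreal (G * heat_max (j - 1)))"
      using i by (intro sum_mono ov) auto
    also have "\<dots> = ennreal (G * (\<Sum>j\<in>{Suc m..<n - i}. heat_max (j - 1)))"
      using G heat_max_nonneg by (subst sum_ennreal) (auto simp: sum_distrib_left)
    also have "\<dots> \<le> ennreal (G * (\<Sum>l. heat_max (l + m)))"
      using G tail by (intro ennreal_leI mult_left_mono) auto
    finally show "(\<Sum>j\<in>{Suc m..<n - i}. \<integral>\<^sup>+\<omega>. vol (\<lambda>w. overlap j (\<lambda>s. w (real i + s))) (?W \<omega>) \<partial>M)
      \<le> ennreal (G * (\<Sum>l. heat_max (l + m)))" .
  qed
  finally show ?thesis by (simp add: G_def)
qed

text \<open>Order of choices: \<open>\<eta>\<close> for the time given up at the end, then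
  \<open>m\<close> so large that the overcounting per unit time and the distance of
  \<open>visit_rate m\<close> from \<open>c\<close> are small, and only then \<open>\<delta>\<close>
  and \<open>T\<close>.\<close>

theorem bridge_volume_asymptotics:
  assumes lim: "visit_rate \<longlonglongrightarrow> c" and e: "0 < e"
  shows "\<exists>T>0. \<exists>\<delta>>0. \<forall>t x. t \<ge> T \<longrightarrow> norm x / t < \<delta> \<longrightarrow>
    bridge_volume t x < \<infinity> \<and> \<bar>enn2real (bridge_volume t x) / t - c\<bar> \<le> e"
proof -
  have c: "0 \<le> c" by (rule LIMSEQ_le_const[OF lim]) (auto simp: visit_rate_def)
  \<comment> \<open>Bounds each of four errors: of \<open>J\<close> against
    \<open>visit_rate m\<close>, of \<open>visit_rate m\<close> against \<open>c\<close>, of the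
    overlaps and of the last segment. The cap at \<open>1\<close> keeps \<open>J - e1\<close> below
    \<open>c + 2\<close>.\<close>
  define e1 where "e1 = min (e / 8) 1"
  have e1: "0 < e1" "e1 \<le> 1" "8 * e1 \<le> e" using e by (auto simp: e1_def)
  \<comment> \<open>The time given up, with rounding at most \<open>2 * \<eta> * t\<close>, costs at
    most \<open>2 * \<eta> * (c + 2) \<le> 4 * \<eta> * (c + 1) \<le> e / 2\<close>.\<close>
  define \<eta> where "\<eta> = min (1 / 2) (e / (8 * (c + 1)))"
  have \<eta>: "0 < \<eta>" "\<eta> \<le> 1 / 2"
  proof -
    show "0 < \<eta>" using e c by (auto simp: \<eta>_def)
    show "\<eta> \<le> 1 / 2" unfolding \<eta>_def by (rule min.cobounded1)
  qed
  have \<eta>c: "\<eta> * (c + 1) \<le> e / 8"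
  proof -
    have "\<eta> * (c + 1) \<le> e / (8 * (c + 1)) * (c + 1)" using c by (intro mult_right_mono) (auto simp: \<eta>_def)
    also have "\<dots> = e / 8"
    proof -
      have "e / (8 * x) * x = e / 8" if "x \<noteq> 0" for x using that by simp
      moreover have "c + 1 \<noteq> 0" using c by linarith
      ultimately show ?thesis .
    qed
    finally show ?thesis .
  qed
  obtain U where U: "0 \<le> U" "\<And>a. norm a \<le> 1 \<Longrightarrow> (\<integral>\<^sup>+\<omega>. vol (hitq K 0 1) (traj (drift a) \<omega>) \<partial>M) \<le> ennreal U"
    using drift_volume_bound[OF zero_less_one] by blast
  define G where "G = (1 / sqrt \<eta>) ^ DIM('a) * U\<^sup>2"
  have G: "0 \<le> G" using \<eta> by (simp add: G_def)
  have "0 < e1 / (G + 1)" using e1 G by simp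
  then obtain N1 where N1: "\<And>n. N1 \<le> n \<Longrightarrow> norm (\<Sum>l. heat_max (l + n)) < e1 / (G + 1)"
    using suminf_exist_split[OF _ summable_heat_max] by blast
  obtain N2 where N2: "\<And>m. N2 \<le> m \<Longrightarrow> \<bar>visit_rate m - c\<bar> < e1"
    using LIMSEQ_D[OF lim e1(1)] by (auto simp: real_norm_def)
  define m where "m = Suc (max N1 N2)"
  have m1: "1 \<le> m" and mN1: "N1 \<le> m" and mN2: "N2 \<le> m" by (simp_all add: m_def)
  define S where "S = (\<Sum>l. heat_max (l + m))"
  have S0: "0 \<le> S" unfolding S_def using summable_heat_max heat_max_nonneg
    by (intro suminf_nonneg) (auto simp: summable_iff_shift)
  have GS: "G * S \<le> e1"
  proof -
    have "S \<le> e1 / (G + 1)" using N1[OF mN1] unfolding S_def real_norm_def by linarith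
    then have "G * S \<le> G * (e1 / (G + 1))" using G by (intro mult_left_mono) auto
    also have "\<dots> \<le> e1" using G e1 by (simp add: field_simps)
    finally show ?thesis .
  qed
  have am: "\<bar>visit_rate m - c\<bar> < e1" by (rule N2[OF mN2])
  define k where "k = 1 + real m"
  have k: "0 < k" "1 \<le> k" by (auto simp: k_def)
  let ?F = "vol (fresh_visit m)"
  have F: "?F \<in> borel_measurable path_space"
    by (intro vol_measurable local_event_path_event[OF local_fresh_visit])
  obtain C0 where C0: "0 \<le> C0" "\<And>u. bridge_mean k (vol (hitq K 0 1)) u \<le> ennreal (C0 * (1 + norm u) ^ (2 * (DIM('a) + 6)))"
    using bridge_mean_bound[OF k(2)] by blast
  have C0': "bridge_mean k ?F u \<le> ennreal (C0 * (1 + norm u) ^ (2 * (DIM('a) + 6)))" for u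
  proof -
    have "bridge_mean k ?F u \<le> bridge_mean k (vol (hitq K 0 1)) u"
      unfolding bridge_mean_def by (intro nn_integral_mono vol_mono) (simp add: fresh_visit_def)
    then show ?thesis using C0(2) order.trans by blast
  qed
  obtain \<delta> where \<delta>: "0 < \<delta>" and cont: "\<And>a q. norm a < \<delta> \<Longrightarrow> 1 - \<delta> < q \<Longrightarrow> q \<le> 1 \<Longrightarrow>
     segment_mean k ?F a q < \<infinity> \<and> \<bar>enn2real (segment_mean k ?F a q) - enn2real (segment_mean k ?F 0 1)\<bar> < e1"
    using segment_mean_continuous[OF k(1) F C0(1) C0' e1(1)] by blast
  have rate: "enn2real (segment_mean k ?F 0 1) = visit_rate m"
    unfolding visit_rate_def using BM_segment_vol[OF k(1), of "fresh_visit m"] local_fresh_visit[of m] by (simp add: k_def)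
  obtain C where C: "0 \<le> C" "\<And>a. norm a \<le> 1 \<Longrightarrow> (\<integral>\<^sup>+\<omega>. vol (hitq K 0 k) (traj (drift a) \<omega>) \<partial>M) \<le> ennreal C"
    using drift_volume_bound[OF k(1)] by blast
  define C' where "C' = (1 / sqrt (1 / 2)) ^ DIM('a) * C"
  have C': "0 \<le> C'" using C by (simp add: C'_def)
  \<comment> \<open>In turn: a segment of length \<open>k\<close> takes up less than half of the
    time, the variance factor is within \<open>\<delta>\<close> of \<open>1\<close>, the last
    segment is negligible, rounding costs at most \<open>\<eta> * t\<close>, and the look-ahead fits
    into the time given up.\<close>
  define T where "T = Max {2 * k + 1, k / \<delta> + 1, C' / e1, 1 / \<eta>, real m / \<eta>}"
  have T: "2 * k + 1 \<le> T" "k / \<delta> + 1 \<le> T" "C' / e1 \<le> T" "1 / \<eta> \<le> T" "real m / \<eta> \<le> T"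
    unfolding T_def by (intro Max_ge; simp)+
  have main: "bridge_volume t x < \<infinity> \<and> \<bar>enn2real (bridge_volume t x) / t - c\<bar> \<le> e"
    if tT: "T \<le> t" and x: "norm x / t < min \<delta> 1" for t x
  proof -
    have t: "2 * k < t" "k / \<delta> < t" "C' / e1 \<le> t" "1 / \<eta> \<le> t" "real m / \<eta> \<le> t" using T tT by linarith+
    have t0: "0 < t" using t k by simp
    let ?a = "(1 / t) *\<^sub>R x" and ?q = "1 - k / t"
    have a: "norm ?a < \<delta>" "norm ?a \<le> 1" using x t0 by auto
    have q: "1 - \<delta> < ?q" "?q \<le> 1" using t(2) t0 \<delta> k by (auto simp: field_simps)
    define J where "J = enn2real (segment_mean k ?F ?a ?q)"
    have Jfin: "segment_mean k ?F ?a ?q = ennreal J" and Ja: "\<bar>J - visit_rate m\<bar> < e1"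
      using cont[OF a(1) q] unfolding J_def rate by (auto simp: ennreal_enn2real_if)
    have J0: "0 \<le> J" by (simp add: J_def)
    \<comment> \<open>Leaves a final stretch of length between \<open>m\<close> and
      \<open>m + 1\<close>, hence at most \<open>k\<close>.\<close>
    define n where "n = nat \<lfloor>t\<rfloor> - m"
    have mt: "m < nat \<lfloor>t\<rfloor>" using t k by (simp add: k_def) linarith
    have n: "real n + real m \<le> t" "t < real n + real m + 1" "0 < n"
    proof -
      have "real n = real (nat \<lfloor>t\<rfloor>) - real m" using mt by (simp add: n_def of_nat_diff)
      moreover have "real (nat \<lfloor>t\<rfloor>) = of_int \<lfloor>t\<rfloor>" using t0 by (simp add: of_nat_nat)
      ultimately show "real n + real m \<le> t" "t < real n + real m + 1" by linarith+
      show "0 < n" using mt by (simp add: n_def)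
    qed
    let ?l = "t - real n"
    have l: "0 < ?l" "?l \<le> k" "?l < t" using n m1 by (auto simp: k_def)
    have V1: "bridge_volume t x \<le> ennreal (real n * J + C')"
    proof -
      have "segment_mean ?l (vol (hitq K 0 ?l)) ?a (1 - ?l / t) \<le> ennreal ((1 / sqrt (1 / 2)) ^ DIM('a)) * segment_mean ?l (vol (hitq K 0 ?l)) ?a 1"
      proof (rule segment_mean_le[OF l(1)])
        have "?l / t \<le> k / t" using l t0 by (intro divide_right_mono) auto
        also have "\<dots> \<le> 1 / 2" using t t0 by (simp add: field_simps)
        finally show "1 / 2 \<le> 1 - ?l / t" by simp
        show "1 - ?l / t \<le> 1" using l t0 by simp
      qed (auto intro: vol_measurable path_event_hitq)
      also have "segment_mean ?l (vol (hitq K 0 ?l)) ?a 1 = (\<integral>\<^sup>+\<omega>. vol (hitq K 0 ?l) (traj (drift ?a) \<omega>) \<partial>M)"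
        using l by (intro drift_segment_vol[symmetric] local_event_hitq) auto
      also have "\<dots> \<le> (\<integral>\<^sup>+\<omega>. vol (hitq K 0 k) (traj (drift ?a) \<omega>) \<partial>M)"
        using l by (intro nn_integral_mono vol_mono) (auto elim: hitq_mono)
      also have "\<dots> \<le> ennreal C" by (rule C(2)[OF a(2)])
      finally have tl: "segment_mean ?l (vol (hitq K 0 ?l)) ?a (1 - ?l / t) \<le> ennreal C'"
        using C by (simp add: C'_def ennreal_mult' mult_left_mono)
      have "bridge_volume t x \<le> of_nat n * segment_mean k ?F ?a ?q + segment_mean ?l (vol (hitq K 0 ?l)) ?a (1 - ?l / t)"
        unfolding k_def using n m1 t k by (intro bridge_volume_upper) (auto simp: k_def)
      also have "\<dots> \<le> ennreal (real n * J) + ennreal C'"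
        unfolding Jfin using tl J0 by (intro add_mono) (auto simp: ennreal_mult' ennreal_of_nat_eq_real_of_nat)
      also have "\<dots> = ennreal (real n * J + C')" using J0 C' by (simp add: ennreal_plus)
      finally show ?thesis .
    qed
    then have fin: "bridge_volume t x < \<infinity>" by (auto simp: less_top[symmetric] top_unique)
    define V where "V = enn2real (bridge_volume t x)"
    have Vfin: "bridge_volume t x = ennreal V" using fin by (simp add: V_def ennreal_enn2real_if)
    have V0: "0 \<le> V" by (simp add: V_def)
    have up: "V \<le> real n * J + C'"
      using V1 J0 C' unfolding Vfin by (subst (asm) ennreal_le_iff) auto
    have "V / t \<le> J + e1"
    proof -
      have "real n * J \<le> t * J" using n J0 by (intro mult_right_mono) auto
      moreover have "C' \<le> t * e1" using t(3) e1 by (simp add: field_simps)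
      ultimately have "V \<le> (J + e1) * t" using up by (simp add: algebra_simps)
      then show ?thesis using t0 by (simp add: divide_le_eq)
    qed
    then have upper: "V / t - c \<le> e" using Ja am e1 by linarith
    \<comment> \<open>The unit intervals that are kept once the last fraction \<open>\<eta>\<close>
      is given up.\<close>
    define p where "p = nat \<lfloor>(1 - \<eta>) * t\<rfloor>"
    have p0: "0 \<le> (1 - \<eta>) * t" using \<eta> t0 by simp
    have p: "real p \<le> (1 - \<eta>) * t" "(1 - \<eta>) * t - 1 \<le> real p"
    proof -
      have "real p = of_int \<lfloor>(1 - \<eta>) * t\<rfloor>" using p0 by (simp add: p_def of_nat_nat)
      then show "real p \<le> (1 - \<eta>) * t" "(1 - \<eta>) * t - 1 \<le> real p" by linarith+
    qed
    have pm: "real p + real m \<le> t" using p(1) t(5) \<eta> by (simp add: field_simps)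
    have \<eta>p: "\<eta> \<le> 1 - real p / t" using p(1) t0 by (simp add: field_simps)
    have "of_nat p * segment_mean k ?F ?a ?q \<le> bridge_volume t x + of_nat p * ennreal (G * S)"
      unfolding G_def S_def k_def
      using bridge_volume_lower[OF pm _ m1 \<eta>(1) \<eta>p a(2) U] t k by (simp add: k_def)
    then have "ennreal (real p * J) \<le> ennreal (V + real p * (G * S))"
      unfolding Jfin Vfin using J0 V0 G S0
      by (simp add: ennreal_of_nat_eq_real_of_nat ennreal_plus flip: ennreal_mult'')
    then have low: "real p * J \<le> V + real p * (G * S)"
      using V0 G S0 by (subst (asm) ennreal_le_iff) auto
    \<comment> \<open>If \<open>J \<le> e1\<close> the left side is not positive; otherwise
      \<open>J - e1\<close> may be multiplied by the lower bound for \<open>p\<close>.\<close>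
    have "J - e1 - 2 * \<eta> * (c + 2) \<le> V / t"
    proof (cases "J \<le> e1")
      case True
      have "0 \<le> \<eta> * (c + 2)" using \<eta> c by simp
      moreover have "0 \<le> V / t" using V0 t0 by simp
      ultimately show ?thesis using True by linarith
    next
      case False
      have Jc: "J - e1 \<le> c + 2" using Ja am e1 by linarith
      have "real p * (J - e1) \<le> real p * (J - G * S)" using GS by (intro mult_left_mono) auto
      also have "\<dots> \<le> V" using low by (simp add: algebra_simps)
      finally have pv: "real p * (J - e1) \<le> V" .
      \<comment> \<open>The unit lost in rounding \<open>p\<close> is absorbed by a second
        \<open>\<eta> * t\<close>.\<close>
      have "1 \<le> \<eta> * t" using t(4) \<eta> by (simp add: field_simps)
      then have "(1 - 2 * \<eta>) * t \<le> real p" using p(2) by (simp add: algebra_simps)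
      then have "(1 - 2 * \<eta>) * t * (J - e1) \<le> V"
        using pv False by (meson less_imp_le mult_right_mono not_le diff_ge_0_iff_ge order.trans)
      then have "(1 - 2 * \<eta>) * (J - e1) \<le> V / t" using t0 by (simp add: pos_le_divide_eq mult_ac)
      moreover have "2 * \<eta> * (J - e1) \<le> 2 * \<eta> * (c + 2)" using \<eta> Jc by (intro mult_left_mono) auto
      ultimately show ?thesis by (simp add: algebra_simps)
    qed
    moreover have "2 * \<eta> * (c + 2) \<le> e / 2"
    proof -
      have "\<eta> * (c + 2) \<le> 2 * (\<eta> * (c + 1))" using \<eta> c by (simp add: algebra_simps)
      then show ?thesis using \<eta>c by simp
    qed
    ultimately have "c - e \<le> V / t" using Ja am e1 by linarith
    then have "\<bar>enn2real (bridge_volume t x) / t - c\<bar> \<le> e" using upper unfolding V_def by linarith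
    with fin show "bridge_volume t x < \<infinity> \<and> \<bar>enn2real (bridge_volume t x) / t - c\<bar> \<le> e" by blast
  qed
  have "0 < T" "0 < min \<delta> 1" using T(1) k \<delta> by auto
  with main show ?thesis by blast
qed

end

section \<open>The Green kernel\<close>

text \<open>
  The sum of the heat kernel over integer times is, after scaling by \<open>|w|^(d-2)\<close>, a Riemann sum
  of mesh \<open>1 / |w|^2\<close> for the integral of \<open>heat\<close> at a unit vector over all times, which is \<open>Green_one\<close>.
\<close>

lemma nn_integral_step_function:
  fixes h :: "real \<Rightarrow> real"
  assumes d: "0 < d" and h: "\<And>t. 0 < t \<Longrightarrow> 0 \<le> h t"
  shows "(\<integral>\<^sup>+t. ennreal (indicator {0<..} t * h (d * of_int \<lceil>t / d\<rceil>)) \<partial>lborel) = (\<Sum>i. ennreal (d * h (d * real (Suc i))))"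
proof -
  \<comment> \<open>Open on the left, so that each cell takes the value at its right end and the sum
    starts at time \<open>d\<close>, away from \<open>0\<close>.\<close>
  define I where "I i = {d * real i<..d * real (Suc i)}" for i
  have step: "ennreal (indicator {0<..} t * h (d * of_int \<lceil>t / d\<rceil>)) = (\<Sum>i. ennreal (h (d * real (Suc i))) * indicator (I i) t)" for t
  proof (cases "0 < t")
    case True
    define j where "j = nat (\<lceil>t / d\<rceil> - 1)"
    have "0 < t / d" using True d by simp
    then have c: "1 \<le> \<lceil>t / d\<rceil>" by simp
    then have j: "of_int \<lceil>t / d\<rceil> = real (Suc j)" by (simp add: j_def)
    have jI: "t \<in> I i \<longleftrightarrow> i = j" for i
    proof -
      have "t \<in> I i \<longleftrightarrow> real i < t / d \<and> t / d \<le> real (Suc i)"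
        using d by (simp add: I_def field_simps)
      also have "\<dots> \<longleftrightarrow> \<lceil>t / d\<rceil> = int (Suc i)"
        by (subst ceiling_eq_iff) (simp add: algebra_simps)
      also have "\<dots> \<longleftrightarrow> i = j" using j by linarith
      finally show ?thesis .
    qed
    have "(\<Sum>i. ennreal (h (d * real (Suc i))) * indicator (I i) t)
      = (\<Sum>i\<in>{j}. ennreal (h (d * real (Suc i))) * indicator (I i) t)"
      by (rule suminf_finite) (auto simp: jI indicator_def)
    also have "\<dots> = ennreal (h (d * real (Suc j)))" using jI by (simp add: indicator_def)
    finally show ?thesis using True by (simp add: j)
  next
    case False
    have "indicator (I i) t = (0::ennreal)" for i
    proof -
      have "0 \<le> d * real i" using d by simp
      then show ?thesis using False by (simp add: I_def)
    qed
    then show ?thesis using False by simp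
  qed
  have [measurable]: "I i \<in> sets borel" for i by (simp add: I_def)
  have "(\<integral>\<^sup>+t. ennreal (indicator {0<..} t * h (d * of_int \<lceil>t / d\<rceil>)) \<partial>lborel)
    = (\<Sum>i. \<integral>\<^sup>+t. ennreal (h (d * real (Suc i))) * indicator (I i) t \<partial>lborel)"
    unfolding step by (rule nn_integral_suminf) measurable
  also have "\<dots> = (\<Sum>i. ennreal (d * h (d * real (Suc i))))"
  proof (rule suminf_cong)
    fix i
    have "(\<integral>\<^sup>+t. ennreal (h (d * real (Suc i))) * indicator (I i) t \<partial>lborel) = ennreal (h (d * real (Suc i))) * emeasure lborel (I i)"
      by (rule nn_integral_cmult_indicator) simp
    also have "emeasure lborel (I i) = ennreal d"
      using d by (simp add: I_def algebra_simps)
    finally show "(\<integral>\<^sup>+t. ennreal (h (d * real (Suc i))) * indicator (I i) t \<partial>lborel) = ennreal (d * h (d * real (Suc i)))"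
      using d by (simp add: ennreal_mult' mult.commute)
  qed
  finally show ?thesis .
qed

text \<open>\<open>heat t\<close> at a vector of norm \<open>1\<close> in dimension
  \<open>n\<close>; by scaling it determines \<open>heat\<close> away from the origin.\<close>

definition unit_heat :: "nat \<Rightarrow> real \<Rightarrow> real" where
  "unit_heat n t = exp (- 1 / (2 * t)) / sqrt (2 * pi * t) ^ n"

lemma unit_heat_nonneg: "0 < t \<Longrightarrow> 0 \<le> unit_heat n t"
  by (simp add: unit_heat_def)

lemma measurable_unit_heat [measurable]: "unit_heat n \<in> borel_measurable borel"
  unfolding unit_heat_def by measurable

lemma Green_one_pos: "3 \<le> n \<Longrightarrow> 0 < Green_one n"
  unfolding Green_one_def Let_def by (intro divide_pos_pos Gamma_real_pos mult_pos_pos) auto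

text \<open>The substitution \<open>t = 1 / (2 * u)\<close> turns the integrand into a constant
  times \<open>u powr (\<nu> - 1) * exp (- u)\<close> with \<open>\<nu> = n / 2 - 1\<close>, which
  is Euler's integral for \<open>Gamma \<nu>\<close>; \<open>3 \<le> n\<close> makes
  \<open>\<nu>\<close> positive.\<close>

lemma nn_integral_unit_heat:
  assumes n: "3 \<le> n"
  shows "(\<integral>\<^sup>+t. ennreal (indicator {0<..} t * unit_heat n t) \<partial>lborel) = ennreal (Green_one n)"
proof -
  define \<nu> where "\<nu> = real n / 2 - 1"
  have \<nu>: "0 < \<nu>" using n by (simp add: \<nu>_def)
  let ?S = "{0<..} :: real set"
  let ?g = "\<lambda>u::real. 1 / (2 * u)" and ?g' = "\<lambda>u::real. - 1 / (2 * u\<^sup>2)"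
  let ?c = "1 / (2 * pi powr (\<nu> + 1))"
  have img: "?g ` ?S = ?S"
  proof safe
    fix y :: real assume "0 < y"
    then show "y \<in> ?g ` ?S" by (intro image_eqI[of _ _ "1 / (2 * y)"]) auto
  qed auto
  have eq: "\<bar>?g' u\<bar> * unit_heat n (?g u) = ?c * (u powr (\<nu> - 1) / exp u)" if u: "u \<in> ?S" for u
  proof -
    have u0: "0 < u" using u by simp
    have "sqrt (2 * pi * ?g u) ^ n = (pi / u) powr (\<nu> + 1)"
    proof -
      have "sqrt (2 * pi * ?g u) = (pi / u) powr (1 / 2)" using u0 by (simp add: powr_half_sqrt)
      then have "sqrt (2 * pi * ?g u) ^ n = ((pi / u) powr (1 / 2)) powr real n"
        using u0 by (simp add: powr_realpow)
      also have "\<dots> = (pi / u) powr (\<nu> + 1)" by (simp add: powr_powr \<nu>_def)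
      finally show ?thesis .
    qed
    also have "\<dots> = pi powr (\<nu> + 1) / u powr (\<nu> + 1)" using u0 by (simp add: powr_divide)
    finally have "\<bar>?g' u\<bar> * unit_heat n (?g u) = (1 / (2 * u\<^sup>2)) * (exp (- u) / (pi powr (\<nu> + 1) / u powr (\<nu> + 1)))"
      using u0 by (simp add: unit_heat_def)
    also have "\<dots> = ?c * (u powr (\<nu> + 1) / u\<^sup>2 * exp (- u))" using u0 by (simp add: field_simps)
    also have "u powr (\<nu> + 1) / u\<^sup>2 = u powr (\<nu> - 1)"
      using u0 by (simp add: powr_diff[of u "\<nu> + 1" 2, symmetric] flip: powr_numeral)
    finally show ?thesis by (simp add: exp_minus field_simps)
  qed
  have gi: "((\<lambda>t. t powr (\<nu> - 1) / exp t) has_integral Gamma \<nu>) ?S"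
  proof -
    have "((\<lambda>t. t powr (\<nu> - 1) / exp t) has_integral Gamma \<nu>) {0..} \<longleftrightarrow> ((\<lambda>t. t powr (\<nu> - 1) / exp t) has_integral Gamma \<nu>) ?S"
      by (rule has_integral_spike_set_eq) (auto intro: negligible_subset[of "{0}"])
    then show ?thesis using Gamma_integral_real[OF \<nu>] by simp
  qed
  have "((\<lambda>t. ?c * (t powr (\<nu> - 1) / exp t)) has_integral ?c * Gamma \<nu>) ?S"
    by (rule has_integral_mult_right[OF gi])
  then have hi: "((\<lambda>u. \<bar>?g' u\<bar> * unit_heat n (?g u)) has_integral ?c * Gamma \<nu>) ?S"
    by (rule has_integral_eq[rotated]) (simp only: eq)
  have nn: "(\<lambda>u. \<bar>?g' u\<bar> * unit_heat n (?g u)) absolutely_integrable_on ?S"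
  proof (rule nonnegative_absolutely_integrable_1)
    show "(\<lambda>u. \<bar>?g' u\<bar> * unit_heat n (?g u)) integrable_on ?S" using hi by blast
    fix u :: real assume "u \<in> ?S"
    then show "0 \<le> \<bar>?g' u\<bar> * unit_heat n (?g u)" by (simp add: unit_heat_def)
  qed
  have "unit_heat n absolutely_integrable_on ?g ` ?S \<and> integral (?g ` ?S) (unit_heat n) = ?c * Gamma \<nu>"
  proof (rule iffD1[OF has_absolute_integral_change_of_variables_1'[of ?S ?g ?g' "unit_heat n"]])
    show "?S \<in> sets lebesgue" by simp
    show "(?g has_field_derivative ?g' x) (at x within ?S)" if "x \<in> ?S" for x
      using that by (auto intro!: derivative_eq_intros simp: power2_eq_square)
    show "inj_on ?g ?S" by (auto intro!: inj_onI simp: field_simps)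
    show "(\<lambda>x. \<bar>?g' x\<bar> * unit_heat n (?g x)) absolutely_integrable_on ?S \<and> integral ?S (\<lambda>x. \<bar>?g' x\<bar> * unit_heat n (?g x)) = ?c * Gamma \<nu>"
      using nn hi by (auto simp: integral_unique)
  qed
  then have "(unit_heat n has_integral ?c * Gamma \<nu>) ?S"
    unfolding img by (metis has_integral_integral set_lebesgue_integral_eq_integral(1))
  from nn_integral_has_integral_lebesgue[OF _ this]
  have "(\<integral>\<^sup>+t. ennreal (indicator ?S t * unit_heat n t) \<partial>lborel) = ennreal (?c * Gamma \<nu>)"
    by (simp add: unit_heat_nonneg)
  also have "?c * Gamma \<nu> = Green_one n" by (simp add: Green_one_def \<nu>_def)
  finally show ?thesis .
qed

text \<open>In terms of \<open>v = 1 / sqrt (2 * t)\<close> the function is at most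
  \<open>v ^ n * exp (- v\<^sup>2)\<close>: near time \<open>0\<close> the exponential beats the
  power.\<close>

lemma unit_heat_bound:
  obtains A where "0 \<le> A" "\<And>t. 0 < t \<Longrightarrow> unit_heat n t \<le> A"
proof -
  define A where "A = (real n + 1) ^ n * exp (1 / (4 * 1))"
  have "unit_heat n t \<le> A" if t: "0 < t" for t
  proof -
    define v where "v = sqrt (1 / (2 * t))"
    have v: "0 \<le> v" "v\<^sup>2 = 1 / (2 * t)" using t by (auto simp: v_def)
    have "1 / sqrt (2 * pi * t) \<le> v"
      unfolding v_def real_sqrt_divide using t pi_ge_two
      by (simp add: real_sqrt_mult divide_simps)
    then have "(1 / sqrt (2 * pi * t)) ^ n \<le> (1 + norm v) ^ n" using t v by (intro power_mono) auto
    then have "(1 / sqrt (2 * pi * t)) ^ n * exp (- 1 * (norm v)\<^sup>2) \<le> (1 + norm v) ^ n * exp (- 1 * (norm v)\<^sup>2)"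
      by (rule mult_right_mono) simp
    moreover have "unit_heat n t = (1 / sqrt (2 * pi * t)) ^ n * exp (- 1 * (norm v)\<^sup>2)"
    proof -
      have "(norm v)\<^sup>2 = 1 / (2 * t)" using v(2) by simp
      then show ?thesis by (simp only: unit_heat_def) (simp add: power_divide)
    qed
    ultimately have "unit_heat n t \<le> (1 + norm v) ^ n * exp (- 1 * (norm v)\<^sup>2)" by simp
    also have "\<dots> \<le> A" unfolding A_def by (rule power_exp_bound) simp
    finally show ?thesis .
  qed
  moreover have "0 \<le> A" by (simp add: A_def)
  ultimately show ?thesis using that by blast
qed

text \<open>The later time \<open>s\<close> is where the step function samples; a bound in terms of
  \<open>t\<close> alone gives a majorant that is independent of the mesh.\<close>

lemma unit_heat_decay:
  assumes "3 \<le> n" "1 \<le> t" "t \<le> s"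
  shows "unit_heat n s \<le> t powr (- 3 / 2)"
proof -
  have s: "1 \<le> sqrt s" using assms by simp
  have "sqrt s \<le> sqrt (2 * pi * s)" using assms pi_ge_two by (intro real_sqrt_le_mono) simp
  then have "sqrt s ^ n \<le> sqrt (2 * pi * s) ^ n" using s by (intro power_mono) auto
  moreover have "sqrt s ^ 3 \<le> sqrt s ^ n" using assms s by (intro power_increasing) auto
  moreover have "sqrt t ^ 3 \<le> sqrt s ^ 3" using assms by (intro power_mono) auto
  moreover have "sqrt t ^ 3 = t powr (3 / 2)"
    using assms by (simp add: powr_half_sqrt[symmetric] powr_powr flip: powr_realpow)
  ultimately have "t powr (3 / 2) \<le> sqrt (2 * pi * s) ^ n" by linarith
  then have "unit_heat n s \<le> 1 / t powr (3 / 2)"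
    unfolding unit_heat_def using assms by (intro frac_le) auto
  then show ?thesis by (simp add: powr_minus_divide)
qed

text \<open>The time \<open>0\<close> is left out: in the last exit decomposition it contributes a
  separate term.\<close>

definition lattice_heat :: "'a::euclidean_space \<Rightarrow> real" where
  "lattice_heat w = (\<Sum>i. heat (real (Suc i)) w)"

lemma heat_eq_unit_heat:
  fixes w :: "'a::euclidean_space"
  assumes "w \<noteq> 0" "0 < s"
  shows "norm w ^ DIM('a) * heat s w = unit_heat DIM('a) (s / (norm w)\<^sup>2)"
  using assms by (simp add: heat_def unit_heat_def real_sqrt_divide power_divide field_simps)

text \<open>By \<open>heat_eq_unit_heat\<close>, the weighted sum is the integral of a step function
  of mesh \<open>1 / (norm w)\<^sup>2\<close>. One majorant \<open>D\<close> for all meshes yields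
  the limit, the uniform bound and, for \<open>w \<noteq> 0\<close>, summability.\<close>

lemma lattice_heat_limit_and_bound:
  assumes n: "3 \<le> DIM('a::euclidean_space)"
  shows "((\<lambda>w::'a. norm w ^ (DIM('a) - 2) * lattice_heat w) \<longlongrightarrow> Green_one DIM('a)) at_infinity"
    and "\<exists>C. \<forall>w::'a. norm w ^ (DIM('a) - 2) * lattice_heat w \<le> C"
    and "\<And>w::'a. summable (\<lambda>i. heat (real (Suc i)) w)"
proof -
  let ?n = "DIM('a)"
  obtain A where A: "0 \<le> A" "\<And>t. 0 < t \<Longrightarrow> unit_heat ?n t \<le> A" by (rule unit_heat_bound[of ?n]) blast
  \<comment> \<open>\<open>unit_heat_bound\<close> covers small times and
    \<open>unit_heat_decay\<close> large ones, where the exponent \<open>- 3 / 2\<close> is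
    integrable.\<close>
  define D where "D t = indicator {0..1} t * A + indicator {1..} t * t powr (- 3 / 2)" for t :: real
  have "integrable lborel (\<lambda>t::real. indicator {1..} t * t powr (- 3 / 2))"
  proof (rule integrableI_nonneg)
    have "((\<lambda>t::real. t powr (- 3 / 2)) has_integral - (1 powr (- 3 / 2 + 1)) / (- 3 / 2 + 1)) {1..}"
      by (rule has_integral_powr_to_inf) auto
    from nn_integral_has_integral_lebesgue[OF _ this]
    have "(\<integral>\<^sup>+t. ennreal (indicator {1..} t * t powr (- 3 / 2)) \<partial>lborel) = ennreal 2"
      by simp
    then show "(\<integral>\<^sup>+t. ennreal (indicator {1..} t * t powr (- 3 / 2)) \<partial>lborel) < \<infinity>" by simp
  qed (auto simp: indicator_def)
  then have Di: "integrable lborel D"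
    unfolding D_def by (intro Bochner_Integration.integrable_add integrable_mult_left) (auto simp: integrable_indicator_iff)
  \<comment> \<open>\<open>unit_heat\<close> sampled at the right end of the cell of length
    \<open>1 / r\<^sup>2\<close> that contains \<open>t\<close>.\<close>
  define s where "s r t = indicator {0<..} t * unit_heat ?n ((1 / r\<^sup>2) * of_int \<lceil>t / (1 / r\<^sup>2)\<rceil>)" for r t :: real
  have s_meas [measurable]: "s r \<in> borel_measurable lborel" for r unfolding s_def by measurable
  have ceil: "t \<le> (1 / r\<^sup>2) * of_int \<lceil>t / (1 / r\<^sup>2)\<rceil>" "(1 / r\<^sup>2) * of_int \<lceil>t / (1 / r\<^sup>2)\<rceil> \<le> t + 1 / r\<^sup>2" if "0 < r" for r t :: real
  proof -
    have "t / (1 / r\<^sup>2) \<le> of_int \<lceil>t / (1 / r\<^sup>2)\<rceil>" "of_int \<lceil>t / (1 / r\<^sup>2)\<rceil> \<le> t / (1 / r\<^sup>2) + 1" by linarith+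
    then show "t \<le> (1 / r\<^sup>2) * of_int \<lceil>t / (1 / r\<^sup>2)\<rceil>" "(1 / r\<^sup>2) * of_int \<lceil>t / (1 / r\<^sup>2)\<rceil> \<le> t + 1 / r\<^sup>2"
      using that by (auto simp: field_simps)
  qed
  have sb: "norm (s r t) \<le> D t" "0 \<le> s r t" if r: "0 < r" for r t
  proof -
    show "0 \<le> s r t"
      using ceil(1)[OF r, of t] by (auto simp: s_def indicator_def intro!: unit_heat_nonneg)
    then have "norm (s r t) = s r t" by simp
    also have "\<dots> \<le> D t"
    proof (cases "0 < t")
      case True
      let ?u = "(1 / r\<^sup>2) * of_int \<lceil>t / (1 / r\<^sup>2)\<rceil>"
      have u: "t \<le> ?u" by (rule ceil(1)[OF r])
      show ?thesis
      proof (cases "t \<le> 1")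
        case t1: True
        have "s r t = unit_heat ?n ?u" using True by (simp add: s_def)
        also have "\<dots> \<le> A" using u True by (intro A(2)) linarith
        also have "A \<le> D t" using True t1 by (simp add: D_def)
        finally show ?thesis .
      next
        case False
        have "s r t = unit_heat ?n ?u" using True by (simp add: s_def)
        also have "\<dots> \<le> t powr (- 3 / 2)" using u False n by (intro unit_heat_decay) auto
        also have "\<dots> \<le> D t" using False A by (simp add: D_def)
        finally show ?thesis .
      qed
    qed (use A in \<open>simp add: s_def D_def\<close>)
    finally show "norm (s r t) \<le> D t" .
  qed
  have lim: "((\<lambda>r. integral\<^sup>L lborel (s r)) \<longlongrightarrow> integral\<^sup>L lborel (\<lambda>t. indicator {0<..} t * unit_heat ?n t)) at_top"
  proof (rule integral_dominated_convergence_at_top[OF _ _ Di])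
    show "AE t in lborel. ((\<lambda>r. s r t) \<longlongrightarrow> indicator {0<..} t * unit_heat ?n t) at_top"
    proof (rule AE_I2)
      fix t :: real
      show "((\<lambda>r. s r t) \<longlongrightarrow> indicator {0<..} t * unit_heat ?n t) at_top"
      proof (cases "0 < t")
        case True
        have u: "((\<lambda>r. (1 / r\<^sup>2) * of_int \<lceil>t / (1 / r\<^sup>2)\<rceil>) \<longlongrightarrow> t) at_top"
        proof (rule tendsto_sandwich)
          show "\<forall>\<^sub>F r::real in at_top. t \<le> (1 / r\<^sup>2) * of_int \<lceil>t / (1 / r\<^sup>2)\<rceil>"
            using eventually_gt_at_top[of 0] by eventually_elim (rule ceil(1))
          show "\<forall>\<^sub>F r::real in at_top. (1 / r\<^sup>2) * of_int \<lceil>t / (1 / r\<^sup>2)\<rceil> \<le> t + 1 / r\<^sup>2"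
            using eventually_gt_at_top[of 0] by eventually_elim (rule ceil(2))
          show "((\<lambda>r::real. t + 1 / r\<^sup>2) \<longlongrightarrow> t) at_top" by real_asymp
          show "((\<lambda>r::real. t) \<longlongrightarrow> t) at_top" by simp
        qed
        have "isCont (unit_heat ?n) t" unfolding unit_heat_def[abs_def] using True by (intro continuous_intros) auto
        from isCont_tendsto_compose[OF this u] show ?thesis using True by (simp add: s_def)
      qed (simp add: s_def)
    qed
    show "\<forall>\<^sub>F r in at_top. AE t in lborel. norm (s r t) \<le> D t"
      using eventually_gt_at_top[of 0] by eventually_elim (use sb in auto)
  qed measurable
  have "integral\<^sup>L lborel (\<lambda>t. indicator {0<..} t * unit_heat ?n t) = Green_one ?n"
    using nn_integral_unit_heat[OF n] Green_one_pos[OF n]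
    by (subst integral_eq_nn_integral) (auto simp: indicator_def unit_heat_nonneg)
  note lim = lim[unfolded this]
  have sum: "summable (\<lambda>i. heat (real (Suc i)) w) \<and> norm w ^ (?n - 2) * lattice_heat w = integral\<^sup>L lborel (s (norm w))"
    if w: "w \<noteq> 0" for w :: 'a
  proof -
    let ?r = "norm w"
    have r: "0 < ?r" using w by simp
    have int: "integrable lborel (s ?r)"
      by (rule Bochner_Integration.integrable_bound[OF Di s_meas], intro AE_I2 order.trans[OF sb(1)[OF r]], simp)
    have summand: "(1 / ?r\<^sup>2) * unit_heat ?n ((1 / ?r\<^sup>2) * real (Suc i)) = ?r ^ (?n - 2) * heat (real (Suc i)) w" for i
    proof -
      have "?n - 2 + 2 = ?n" using n by simp
      from power_add[of ?r "?n - 2" 2, unfolded this] have "?r ^ ?n = ?r ^ (?n - 2) * ?r\<^sup>2" .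
      then show ?thesis using heat_eq_unit_heat[OF w, of "real (Suc i)"] r by (simp add: field_simps)
    qed
    have "ennreal (integral\<^sup>L lborel (s ?r)) = (\<integral>\<^sup>+t. ennreal (s ?r t) \<partial>lborel)"
      by (rule nn_integral_eq_integral[symmetric, OF int]) (use sb(2)[OF r] in auto)
    also have "\<dots> = (\<Sum>i. ennreal ((1 / ?r\<^sup>2) * unit_heat ?n ((1 / ?r\<^sup>2) * real (Suc i))))"
      unfolding s_def using r by (intro nn_integral_step_function) (auto intro: unit_heat_nonneg)
    also have "\<dots> = (\<Sum>i. ennreal (?r ^ (?n - 2) * heat (real (Suc i)) w))" by (simp only: summand)
    finally have eq: "(\<Sum>i. ennreal (?r ^ (?n - 2) * heat (real (Suc i)) w)) = ennreal (integral\<^sup>L lborel (s ?r))" by simp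
    have sm: "summable (\<lambda>i. ?r ^ (?n - 2) * heat (real (Suc i)) w)"
      by (rule summable_suminf_not_top) (use eq in auto)
    then have sm': "summable (\<lambda>i. heat (real (Suc i)) w)" using r by (simp add: summable_cmult_iff)
    have e: "ennreal (\<Sum>i. ?r ^ (?n - 2) * heat (real (Suc i)) w) = ennreal (integral\<^sup>L lborel (s ?r))"
      using eq suminf_ennreal2[OF _ sm] by simp
    have nn1: "0 \<le> integral\<^sup>L lborel (s ?r)" using sb(2)[OF r] by (intro integral_nonneg_AE) auto
    have nn2: "0 \<le> (\<Sum>i. ?r ^ (?n - 2) * heat (real (Suc i)) w)" by (intro suminf_nonneg sm) simp
    have "(\<Sum>i. ?r ^ (?n - 2) * heat (real (Suc i)) w) = integral\<^sup>L lborel (s ?r)"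
      by (rule iffD1[OF ennreal_inj[OF nn2 nn1] e])
    then show ?thesis using sm' suminf_mult[OF sm', of "?r ^ (?n - 2)"] by (simp add: lattice_heat_def)
  qed
  have "((\<lambda>w::'a. integral\<^sup>L lborel (s (norm w))) \<longlongrightarrow> Green_one ?n) at_infinity"
    using lim filterlim_norm_at_top by (rule filterlim_compose)
  then show "((\<lambda>w::'a. norm w ^ (?n - 2) * lattice_heat w) \<longlongrightarrow> Green_one ?n) at_infinity"
  proof (rule Lim_transform_eventually)
    show "\<forall>\<^sub>F w::'a in at_infinity. integral\<^sup>L lborel (s (norm w)) = norm w ^ (?n - 2) * lattice_heat w"
      unfolding eventually_at_infinity
    proof (intro exI allI impI)
      fix w :: 'a assume "1 \<le> norm w"
      then have "w \<noteq> 0" by auto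
      then show "integral\<^sup>L lborel (s (norm w)) = norm w ^ (?n - 2) * lattice_heat w" using sum by simp
    qed
  qed
  show "\<exists>C. \<forall>w::'a. norm w ^ (?n - 2) * lattice_heat w \<le> C"
  proof (intro exI allI)
    fix w :: 'a
    show "norm w ^ (?n - 2) * lattice_heat w \<le> integral\<^sup>L lborel D"
    proof (cases "w = 0")
      case True
      \<comment> \<open>At \<open>w = 0\<close> the weight vanishes, since its exponent
        \<open>DIM('a) - 2\<close> is positive.\<close>
      have "0 \<le> integral\<^sup>L lborel D" using A by (intro integral_nonneg_AE) (auto simp: D_def)
      then show ?thesis using True n by (simp add: power_0_left)
    next
      case False
      then have r: "0 < norm w" by simp
      have int: "integrable lborel (s (norm w))"
        by (rule Bochner_Integration.integrable_bound[OF Di s_meas], intro AE_I2 order.trans[OF sb(1)[OF r]], simp)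
      have "integral\<^sup>L lborel (s (norm w)) \<le> integral\<^sup>L lborel D"
        by (intro integral_mono int Di order.trans[OF abs_ge_self sb(1)[OF r, unfolded real_norm_def]])
      then show ?thesis using sum[OF False] by simp
    qed
  qed
  show "summable (\<lambda>i. heat (real (Suc i)) w)" for w :: 'a
  proof (cases "w = 0")
    case False then show ?thesis using sum by blast
  next
    case True
    show ?thesis
    proof (rule summable_comparison_test)
      show "\<exists>N. \<forall>i\<ge>N. norm (heat (real (Suc i)) w) \<le> real (Suc i) powr (- 3 / 2)"
      proof (intro exI allI impI)
        fix i :: nat
        have "sqrt (real (Suc i)) ^ 3 \<le> sqrt (2 * pi * real (Suc i)) ^ ?n"
        proof -
          have "sqrt (real (Suc i)) ^ 3 \<le> sqrt (real (Suc i)) ^ ?n" using n by (intro power_increasing) auto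
          also have "\<dots> \<le> sqrt (2 * pi * real (Suc i)) ^ ?n"
            using pi_ge_two by (intro power_mono real_sqrt_le_mono) (auto simp del: of_nat_Suc)
          finally show ?thesis .
        qed
        moreover have "sqrt (real (Suc i)) ^ 3 = real (Suc i) powr (3 / 2)"
          by (simp add: powr_half_sqrt[symmetric] powr_powr del: of_nat_Suc flip: powr_realpow)
        ultimately have "1 / sqrt (2 * pi * real (Suc i)) ^ ?n \<le> 1 / real (Suc i) powr (3 / 2)"
          by (intro divide_left_mono) auto
        then show "norm (heat (real (Suc i)) w) \<le> real (Suc i) powr (- 3 / 2)"
          using True by (simp add: heat_def powr_minus_divide del: of_nat_Suc)
      qed
      show "summable (\<lambda>i. real (Suc i) powr (- 3 / 2))"
        by (subst summable_Suc_iff[of "\<lambda>i. real i powr (- 3 / 2)"]) (simp add: summable_real_powr_iff)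
    qed
  qed
qed

section \<open>Last exit decomposition and capacity\<close>

context brownian_motion_and_compact
begin

definition event_prob :: "((real \<Rightarrow> 'a) \<Rightarrow> bool) \<Rightarrow> 'a \<Rightarrow> ennreal" where
  "event_prob Q x = emeasure M {\<omega>\<in>space M. Q (\<lambda>s. x + B s \<omega>)}"

lemma sets_event: "path_event Q \<Longrightarrow> 0 \<le> c \<Longrightarrow> {\<omega>\<in>space M. Q (\<lambda>s. x + B (c + s) \<omega>)} \<in> sets M"
proof -
  assume "path_event Q" "0 \<le> c"
  then have "Measurable.pred M (\<lambda>\<omega>. Q (\<lambda>s. x + B (c + s) \<omega>))"
    by (intro path_event_pred borel_measurable_add measurable_BM) auto
  then show "{\<omega>\<in>space M. Q (\<lambda>s. x + B (c + s) \<omega>)} \<in> sets M" by (simp add: pred_def)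
qed

lemma emeasure_event:
  assumes "path_event Q" "0 \<le> c"
  shows "emeasure M {\<omega>\<in>space M. Q (\<lambda>s. x + B (c + s) \<omega>)} = (\<integral>\<^sup>+\<omega>. indicator (Collect Q) (\<lambda>s. x + B (c + s) \<omega>) \<partial>M)"
proof -
  have "emeasure M {\<omega>\<in>space M. Q (\<lambda>s. x + B (c + s) \<omega>)} = (\<integral>\<^sup>+\<omega>. indicator {\<omega>\<in>space M. Q (\<lambda>s. x + B (c + s) \<omega>)} \<omega> \<partial>M)"
    using sets_event[OF assms] by simp
  also have "\<dots> = (\<integral>\<^sup>+\<omega>. indicator (Collect Q) (\<lambda>s. x + B (c + s) \<omega>) \<partial>M)"
    by (intro nn_integral_cong) (simp add: indicator_def)
  finally show ?thesis .
qed

lemma event_prob_eq: "path_event Q \<Longrightarrow> event_prob Q x = (\<integral>\<^sup>+\<omega>. indicator (Collect Q) (\<lambda>s. x + B s \<omega>) \<partial>M)"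
  unfolding event_prob_def using emeasure_event[of Q 0 x] by simp

lemma measurable_event_indicator:
  assumes Q: "path_event Q" and f: "f \<in> borel_measurable N" and g: "\<And>s. 0 \<le> s \<Longrightarrow> (\<lambda>x. g x s) \<in> borel_measurable N"
  shows "(\<lambda>x. indicator (Collect Q) (\<lambda>s. f x + g x s) :: ennreal) \<in> borel_measurable N"
proof -
  have "Measurable.pred N (\<lambda>x. Q (\<lambda>s. f x + g x s))"
    by (intro path_event_pred Q borel_measurable_add f g)
  then show ?thesis unfolding indicator_def mem_Collect_eq of_bool_def by measurable
qed

lemma measurable_event_prob [measurable]:
  assumes "path_event Q" shows "event_prob Q \<in> borel_measurable borel"
proof -
  have "(\<lambda>p. indicator (Collect Q) (\<lambda>s. fst p + B s (snd p)) :: ennreal) \<in> borel_measurable (borel \<Otimes>\<^sub>M M)"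
    by (intro measurable_event_indicator assms measurable_compose[OF measurable_snd measurable_BM]) auto
  then have "(\<lambda>x. \<integral>\<^sup>+\<omega>. indicator (Collect Q) (\<lambda>s. x + B s \<omega>) \<partial>M) \<in> borel_measurable borel"
    by (intro borel_measurable_nn_integral) (simp add: case_prod_unfold)
  moreover have "event_prob Q = (\<lambda>x. \<integral>\<^sup>+\<omega>. indicator (Collect Q) (\<lambda>s. x + B s \<omega>) \<partial>M)"
    by (rule ext) (rule event_prob_eq[OF assms])
  ultimately show ?thesis by simp
qed

lemma event_prob_markov:
  assumes Q: "path_event Q" and s: "0 < s"
  shows "emeasure M {\<omega>\<in>space M. Q (\<lambda>u. y + B (s + u) \<omega>)} = (\<integral>\<^sup>+z. ennreal (heat s z) * event_prob Q (y + z) \<partial>lborel)"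
proof -
  have "emeasure M {\<omega>\<in>space M. Q (\<lambda>u. y + B (s + u) \<omega>)} = (\<integral>\<^sup>+\<omega>. indicator (Collect Q) (\<lambda>u. y + B (s + u) \<omega>) \<partial>M)"
    using s by (intro emeasure_event Q) simp
  also have "\<dots> = (\<integral>\<^sup>+\<omega>. indicator (Collect Q) (\<lambda>u. (y + traj (stop s B) \<omega> s) + traj (restart s B) \<omega> u) \<partial>M)"
    unfolding indicator_def mem_Collect_eq
    by (intro nn_integral_cong arg_cong[where f=of_bool] path_event_cong[OF Q]) (use s in \<open>auto simp: stop_def restart_def\<close>)
  also have "\<dots> = (\<integral>\<^sup>+\<omega>. \<integral>\<^sup>+\<omega>'. indicator (Collect Q) (\<lambda>u. (y + traj (stop s B) \<omega> s) + traj B \<omega>' u) \<partial>M \<partial>M)"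
  proof -
    have "(\<lambda>p. indicator (Collect Q) (\<lambda>u. (y + fst p s) + snd p u) :: ennreal) \<in> borel_measurable (path_space \<Otimes>\<^sub>M path_space)"
      using s by (intro measurable_event_indicator Q borel_measurable_add measurable_pair_components) auto
    from markov[of s, OF _ this] s show ?thesis by simp
  qed
  also have "\<dots> = (\<integral>\<^sup>+\<omega>. event_prob Q (y + B s \<omega>) \<partial>M)"
    unfolding event_prob_eq[OF Q] indicator_def mem_Collect_eq
    by (intro nn_integral_cong arg_cong[where f=of_bool] path_event_cong[OF Q]) (use s in \<open>auto simp: stop_def\<close>)
  also have "\<dots> = (\<integral>\<^sup>+z. ennreal (heat s z) * event_prob Q (y + z) \<partial>lborel)"
    using s measurable_event_prob[OF Q] by (intro nn_integral_BM) auto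
  finally show ?thesis .
qed

lemma event_prob_integral:
  assumes "path_event Q"
  shows "(\<integral>\<^sup>+z. event_prob Q z \<partial>lborel) = (\<integral>\<^sup>+\<omega>. vol Q (traj B \<omega>) \<partial>M)"
  unfolding event_prob_def using assms by (intro nn_integral_vol[symmetric] sigma_finite_M measurable_BM)

lemma event_prob_mono: "(\<And>w. P w \<Longrightarrow> Q w) \<Longrightarrow> path_event Q \<Longrightarrow> event_prob P x \<le> event_prob Q x"
  unfolding event_prob_def using sets_event[of Q 0 x] by (intro emeasure_mono) auto

text \<open>A hit at time \<open>1\<close> itself counts as later, already for \<open>m = 0\<close>.
  Hence a hit at an integer time, which lies in two closed unit intervals, is charged to the second
  one only.\<close>

definition last_visit :: "(real \<Rightarrow> 'a) \<Rightarrow> bool" where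
  "last_visit w \<longleftrightarrow> hitq K 0 1 w \<and> \<not> (\<exists>m::nat. hitq K 1 (1 + real m) w)"

definition ever :: "(real \<Rightarrow> 'a) \<Rightarrow> bool" where
  "ever w \<longleftrightarrow> (\<exists>n::nat. hitq K 0 (1 + real n) w)"

lemma path_event_last_visit: "path_event last_visit"
  unfolding last_visit_def[abs_def] by (intro path_event_conj path_event_not path_event_ex path_event_hitq) auto

lemma path_event_ever: "path_event ever"
  unfolding ever_def[abs_def] by (intro path_event_ex path_event_hitq) auto

text \<open>The capacity in disguise; the identification is made in
  \<open>hitting_prob_limit\<close> and \<open>Cap_eq_capacity\<close>.\<close>

definition escape_mass :: ennreal where
  "escape_mass = (\<integral>\<^sup>+z. event_prob last_visit z \<partial>lborel)"

lemma hit_mass_finite: "(\<integral>\<^sup>+z. event_prob (hitq K 0 1) z \<partial>lborel) < \<infinity>"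
proof -
  obtain C where C: "0 \<le> C" "\<And>a. norm a \<le> 1 \<Longrightarrow> (\<integral>\<^sup>+\<omega>. vol (hitq K 0 1) (traj (drift a) \<omega>) \<partial>M) \<le> ennreal C"
    using drift_volume_bound[OF zero_less_one] by blast
  have "(\<integral>\<^sup>+z. event_prob (hitq K 0 1) z \<partial>lborel) \<le> ennreal C"
    using C(2)[of 0] by (simp add: event_prob_integral path_event_hitq)
  then show ?thesis using ennreal_less_top order_le_less_trans by (auto simp: less_top[symmetric] top_unique)
qed

lemma escape_mass_finite: "escape_mass < \<infinity>"
proof -
  have "escape_mass \<le> (\<integral>\<^sup>+z. event_prob (hitq K 0 1) z \<partial>lborel)"
    unfolding escape_mass_def by (intro nn_integral_mono event_prob_mono path_event_hitq) (auto simp: last_visit_def)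
  then show ?thesis using hit_mass_finite by (rule order_le_less_trans)
qed

text \<open>The events decrease to \<open>last_visit\<close> as the look-ahead grows, and the
  probability of a hit during \<open>[0, 1]\<close> is an integrable majorant.\<close>

lemma visit_rate_tendsto: "visit_rate \<longlonglongrightarrow> enn2real escape_mass"
proof -
  have pe: "path_event (fresh_visit m)" for m by (rule local_event_path_event[OF local_fresh_visit])
  have "(\<lambda>m. \<integral>\<^sup>+z. event_prob (fresh_visit m) z \<partial>lborel) \<longlonglongrightarrow> (\<integral>\<^sup>+z. event_prob last_visit z \<partial>lborel)"
  proof (rule nn_integral_dominated_convergence[where w="event_prob (hitq K 0 1)"])
    show "AE z in lborel. event_prob (fresh_visit m) z \<le> event_prob (hitq K 0 1) z" for m
      by (intro AE_I2 event_prob_mono path_event_hitq) (auto simp: fresh_visit_def)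
    show "AE z in lborel. (\<lambda>m. event_prob (fresh_visit m) z) \<longlonglongrightarrow> event_prob last_visit z"
    proof (rule AE_I2)
      fix z
      let ?A = "\<lambda>m. {\<omega>\<in>space M. fresh_visit m (\<lambda>s. z + B s \<omega>)}"
      have "(\<lambda>m. emeasure M (?A m)) \<longlonglongrightarrow> emeasure M (\<Inter>m. ?A m)"
      proof (rule Lim_emeasure_decseq)
        show "range ?A \<subseteq> sets M" using sets_event[OF pe, of 0] by auto
        show "decseq ?A"
        proof (intro decseq_SucI subsetI)
          fix m \<omega> assume "\<omega> \<in> ?A (Suc m)"
          moreover have "hitq K 1 (1 + real m) (\<lambda>s. z + B s \<omega>) \<Longrightarrow> hitq K 1 (1 + real (Suc m)) (\<lambda>s. z + B s \<omega>)"
            by (erule hitq_mono) auto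
          ultimately show "\<omega> \<in> ?A m" by (auto simp: fresh_visit_def)
        qed
      qed simp
      moreover have "(\<Inter>m. ?A m) = {\<omega>\<in>space M. last_visit (\<lambda>s. z + B s \<omega>)}"
        by (auto simp: fresh_visit_def last_visit_def)
      ultimately show "(\<lambda>m. event_prob (fresh_visit m) z) \<longlonglongrightarrow> event_prob last_visit z"
        by (simp add: event_prob_def)
    qed
  qed (use measurable_event_prob[OF pe] measurable_event_prob[OF path_event_last_visit]
        measurable_event_prob[OF path_event_hitq[OF order.refl]] hit_mass_finite in auto)
  then have "(\<lambda>m. \<integral>\<^sup>+\<omega>. vol (fresh_visit m) (traj B \<omega>) \<partial>M) \<longlonglongrightarrow> escape_mass"
    by (simp add: event_prob_integral[OF pe] escape_mass_def)
  then show ?thesis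
    unfolding visit_rate_def[abs_def] using escape_mass_finite by (intro tendsto_enn2real) auto
qed

lemma last_visit_shift:
  "last_visit (\<lambda>s. w (real i + s)) \<longleftrightarrow> hitq K (real i) (real i + 1) w \<and> (\<forall>m::nat. \<not> hitq K (real i + 1) (real i + 1 + real m) w)"
  using hitq_shift[of "real i" K 0 1 w] hitq_shift[of "real i" K 1 "1 + real _" w]
  by (auto simp: last_visit_def add_ac)

text \<open>Unless visits go on forever, only finitely many unit intervals are visited, and the
  greatest of them qualifies.\<close>

lemma ever_imp_last_visit:
  assumes "ever w" "\<not> (\<forall>i::nat. \<exists>m::nat. hitq K (real i) (real i + real m) w)"
  shows "\<exists>i::nat. last_visit (\<lambda>s. w (real i + s))"
proof -
  define E where "E = {j::nat. hitq K (real j) (real j + 1) w}"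
  from assms(2) obtain i where i: "\<And>m::nat. \<not> hitq K (real i) (real i + real m) w" by blast
  have "E \<subseteq> {..<i}"
  proof
    fix j assume j: "j \<in> E"
    show "j \<in> {..<i}"
    proof (rule ccontr)
      assume "j \<notin> {..<i}"
      then have "hitq K (real i) (real i + real (j + 1 - i)) w"
        using j unfolding E_def by (auto elim!: hitq_mono simp: of_nat_diff)
      then show False using i by blast
    qed
  qed
  then have fin: "finite E" by (rule finite_subset) simp
  have ne: "E \<noteq> {}"
  proof -
    from assms(1) obtain n :: nat where "hitq K (real 0) (real (Suc n)) w" by (auto simp: ever_def add.commute)
    from hitq_unit[OF this] show ?thesis by (auto simp: E_def)
  qed
  define j where "j = Max E"
  have jE: "j \<in> E" unfolding j_def using fin ne by simp
  have "\<not> hitq K (real j + 1) (real j + 1 + real m) w" for m :: nat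
  proof
    assume "hitq K (real j + 1) (real j + 1 + real m) w"
    then have "hitq K (real (Suc j)) (real (Suc j + Suc m)) w"
      by (auto elim!: hitq_mono)
    from hitq_unit[OF this] obtain l where l: "Suc j \<le> l" "l \<in> E" by (auto simp: E_def)
    then have "l \<le> j" unfolding j_def using fin by simp
    then show False using l by simp
  qed
  then show ?thesis using jE unfolding last_visit_shift by (auto simp: E_def)
qed

lemma emeasure_unit_hit_le:
  assumes "1 \<le> l"
  shows "emeasure M {\<omega>\<in>space M. hitq K (real l) (real l + 1) (\<lambda>s. y + B s \<omega>)}
    \<le> ennreal (heat_max l) * (\<integral>\<^sup>+z. event_prob (hitq K 0 1) z \<partial>lborel)"
proof -
  have [measurable]: "event_prob (hitq K 0 1) \<in> borel_measurable borel"
    by (intro measurable_event_prob path_event_hitq) simp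
  have "emeasure M {\<omega>\<in>space M. hitq K (real l) (real l + 1) (\<lambda>s. y + B s \<omega>)}
    = emeasure M {\<omega>\<in>space M. hitq K 0 1 (\<lambda>u. y + B (real l + u) \<omega>)}"
    using hitq_shift[of "real l" K 0 1 "\<lambda>s. y + B s _"] by simp
  also have "\<dots> = (\<integral>\<^sup>+z. ennreal (heat (real l) z) * event_prob (hitq K 0 1) (y + z) \<partial>lborel)"
    using assms by (intro event_prob_markov path_event_hitq) auto
  also have "\<dots> \<le> (\<integral>\<^sup>+z. ennreal (heat_max l) * event_prob (hitq K 0 1) (y + z) \<partial>lborel)"
    unfolding heat_max_def using assms by (intro nn_integral_mono mult_right_mono ennreal_leI heat_le_heat_0) auto
  also have "\<dots> = ennreal (heat_max l) * (\<integral>\<^sup>+z. event_prob (hitq K 0 1) (y + z) \<partial>lborel)"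
    by (rule nn_integral_cmult) measurable
  also have "(\<integral>\<^sup>+z. event_prob (hitq K 0 1) (y + z) \<partial>lborel) = (\<integral>\<^sup>+z. event_prob (hitq K 0 1) z \<partial>lborel)"
    by (rule nn_integral_lborel_shift) measurable
  finally show ?thesis .
qed

text \<open>The first half of the Borel-Cantelli argument: a visit after time \<open>i\<close> has
  probability at most a constant times a tail of the summable \<open>heat_max\<close>, and
  \<open>i\<close> is arbitrary.\<close>

lemma transience:
  "emeasure M {\<omega>\<in>space M. \<forall>i::nat. \<exists>m::nat. hitq K (real i) (real i + real m) (\<lambda>s. y + B s \<omega>)} = 0"
proof -
  let ?N = "{\<omega>\<in>space M. \<forall>i::nat. \<exists>m::nat. hitq K (real i) (real i + real m) (\<lambda>s. y + B s \<omega>)}"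
  define \<Psi> where "\<Psi> = enn2real (\<integral>\<^sup>+z. event_prob (hitq K 0 1) z \<partial>lborel)"
  have \<Psi>: "(\<integral>\<^sup>+z. event_prob (hitq K 0 1) z \<partial>lborel) = ennreal \<Psi>" "0 \<le> \<Psi>"
    using hit_mass_finite by (simp_all add: \<Psi>_def ennreal_enn2real_if)
  have A: "{\<omega>\<in>space M. hitq K (real l) (real l + 1) (\<lambda>s. y + B s \<omega>)} \<in> sets M" for l
    using sets_event[OF path_event_hitq[of "real l" K "real l + 1"], of 0 y] by simp
  have bound: "emeasure M ?N \<le> ennreal (\<Psi> * (\<Sum>l. heat_max (l + i)))" if i: "1 \<le> i" for i
  proof -
    have sub: "?N \<subseteq> (\<Union>l. {\<omega>\<in>space M. hitq K (real (l + i)) (real (l + i) + 1) (\<lambda>s. y + B s \<omega>)})"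
    proof
      fix \<omega> assume \<omega>: "\<omega> \<in> ?N"
      then obtain m :: nat where "hitq K (real i) (real i + real m) (\<lambda>s. y + B s \<omega>)" by blast
      then have "hitq K (real i) (real (i + Suc m)) (\<lambda>s. y + B s \<omega>)" by (auto elim!: hitq_mono)
      from hitq_unit[OF this] obtain l where "i \<le> l" "hitq K (real l) (real l + 1) (\<lambda>s. y + B s \<omega>)" by auto
      then show "\<omega> \<in> (\<Union>l. {\<omega>\<in>space M. hitq K (real (l + i)) (real (l + i) + 1) (\<lambda>s. y + B s \<omega>)})"
        using \<omega> by (intro UN_I[of "l - i"]) auto
    qed
    have "emeasure M ?N \<le> emeasure M (\<Union>l. {\<omega>\<in>space M. hitq K (real (l + i)) (real (l + i) + 1) (\<lambda>s. y + B s \<omega>)})"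
      by (intro emeasure_mono sub sets.countable_UN image_subsetI A)
    also have "\<dots> \<le> (\<Sum>l. emeasure M {\<omega>\<in>space M. hitq K (real (l + i)) (real (l + i) + 1) (\<lambda>s. y + B s \<omega>)})"
      by (intro emeasure_subadditive_countably image_subsetI A)
    also have "\<dots> \<le> (\<Sum>l. ennreal (\<Psi> * heat_max (l + i)))"
    proof (intro suminf_le)
      fix l
      have "1 \<le> l + i" using i by simp
      from emeasure_unit_hit_le[OF this, of y]
      show "emeasure M {\<omega>\<in>space M. hitq K (real (l + i)) (real (l + i) + 1) (\<lambda>s. y + B s \<omega>)} \<le> ennreal (\<Psi> * heat_max (l + i))"
        unfolding \<Psi>(1) by (subst ennreal_mult'[OF \<Psi>(2)], subst mult.commute)
    qed auto
    also have "\<dots> = ennreal (\<Sum>l. \<Psi> * heat_max (l + i))"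
      using \<Psi>(2) heat_max_nonneg summable_heat_max by (intro suminf_ennreal2 summable_mult) (auto simp: summable_iff_shift)
    also have "(\<Sum>l. \<Psi> * heat_max (l + i)) = \<Psi> * (\<Sum>l. heat_max (l + i))"
      using summable_heat_max by (intro suminf_mult) (simp add: summable_iff_shift)
    finally show ?thesis .
  qed
  show ?thesis
  proof (rule ccontr)
    assume "emeasure M ?N \<noteq> 0"
    then have pos: "0 < measure M ?N" by (simp add: emeasure_eq_measure less_le measure_nonneg)
    have "0 < measure M ?N / (\<Psi> + 1)" using pos \<Psi>(2) by simp
    then obtain n where n: "\<And>i. n \<le> i \<Longrightarrow> norm (\<Sum>l. heat_max (l + i)) < measure M ?N / (\<Psi> + 1)"
      using suminf_exist_split[OF _ summable_heat_max] by blast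
    define S where "S = (\<Sum>l. heat_max (l + Suc n))"
    have S: "S < measure M ?N / (\<Psi> + 1)" "0 \<le> S"
      using n[of "Suc n"] summable_heat_max heat_max_nonneg unfolding S_def
      by (auto intro!: suminf_nonneg simp: summable_iff_shift simp del: add_Suc_right)
    have "1 \<le> Suc n" by simp
    from bound[OF this] have le: "ennreal (measure M ?N) \<le> ennreal (\<Psi> * S)"
      unfolding S_def[symmetric] emeasure_eq_measure .
    have "0 \<le> \<Psi> * S" using \<Psi>(2) S(2) by simp
    from iffD1[OF ennreal_le_iff[OF this] le] have "measure M ?N \<le> \<Psi> * S" .
    also have "\<dots> \<le> (\<Psi> + 1) * S"
      using S by (intro mult_right_mono) auto
    also have "\<dots> < measure M ?N" using S(1) \<Psi>(2) by (simp add: field_simps)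
    finally show False by simp
  qed
qed

text \<open>The events that the last visit falls into the unit interval \<open>i\<close> are
  disjoint and cover \<open>ever\<close> up to the null event of \<open>transience\<close>. The
  Markov property at the fixed time \<open>i\<close> gives each its kernel: none for
  \<open>i = 0\<close>, and \<open>heat\<close> at time \<open>i\<close> for the others.\<close>

theorem last_exit_decomposition:
  "event_prob ever y = event_prob last_visit y
     + (\<integral>\<^sup>+z. ennreal (lattice_heat (z - y)) * event_prob last_visit z \<partial>lborel)"
proof -
  let ?A = "\<lambda>i::nat. {\<omega>\<in>space M. last_visit (\<lambda>u. y + B (real i + u) \<omega>)}"
  let ?N = "{\<omega>\<in>space M. \<forall>i::nat. \<exists>m::nat. hitq K (real i) (real i + real m) (\<lambda>s. y + B s \<omega>)}"
  let ?H = "{\<omega>\<in>space M. ever (\<lambda>s. y + B s \<omega>)}"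
  have [measurable]: "event_prob last_visit \<in> borel_measurable borel"
    by (rule measurable_event_prob[OF path_event_last_visit])
  have A: "?A i \<in> sets M" for i by (intro sets_event path_event_last_visit) simp
  have H: "?H \<in> sets M" using sets_event[OF path_event_ever, of 0 y] by simp
  have N: "?N \<in> sets M"
  proof -
    have "{\<omega>\<in>space M. hitq K (real i) (real i + real m) (\<lambda>s. y + B s \<omega>)} \<in> sets M" for i m :: nat
      using sets_event[OF path_event_hitq[of "real i" K "real i + real m"], of 0 y] by simp
    then show ?thesis by (intro sets.sets_Collect_countable_All sets.sets_Collect_countable_Ex)
  qed
  have sub1: "(\<Union>i. ?A i) \<subseteq> ?H"
  proof
    fix \<omega> assume "\<omega> \<in> (\<Union>i. ?A i)"
    then obtain i :: nat where i: "\<omega> \<in> space M" "last_visit (\<lambda>u. y + B (real i + u) \<omega>)" by auto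
    then have "hitq K (real i) (real i + 1) (\<lambda>s. y + B s \<omega>)"
      using last_visit_shift[of "\<lambda>s. y + B s \<omega>" i] by simp
    then have "hitq K 0 (1 + real i) (\<lambda>s. y + B s \<omega>)" by (auto elim!: hitq_mono)
    then show "\<omega> \<in> ?H" using i(1) by (auto simp: ever_def)
  qed
  have sub2: "?H \<subseteq> (\<Union>i. ?A i) \<union> ?N"
  proof
    fix \<omega> assume "\<omega> \<in> ?H"
    then show "\<omega> \<in> (\<Union>i. ?A i) \<union> ?N"
      using ever_imp_last_visit[of "\<lambda>s. y + B s \<omega>"] by auto
  qed
  have dis: "disjoint_family ?A"
  proof -
    have no: False if "i < j" "last_visit (\<lambda>u. y + B (real i + u) \<omega>)" "last_visit (\<lambda>u. y + B (real j + u) \<omega>)" for i j :: nat and \<omega>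
    proof -
      have "hitq K (real j) (real j + 1) (\<lambda>s. y + B s \<omega>)"
        using that(3) last_visit_shift[of "\<lambda>s. y + B s \<omega>" j] by simp
      then have "hitq K (real i + 1) (real i + 1 + real (j - i)) (\<lambda>s. y + B s \<omega>)"
        using that(1) by (auto elim!: hitq_mono simp: of_nat_diff)
      then show False using that(2) last_visit_shift[of "\<lambda>s. y + B s \<omega>" i] by blast
    qed
    show ?thesis unfolding disjoint_family_on_def
      using no by (auto simp: set_eq_iff) (metis nat_neq_iff)
  qed
  have "emeasure M ?H \<le> emeasure M ((\<Union>i. ?A i) \<union> ?N)"
    using A N by (intro emeasure_mono sub2 sets.Un sets.countable_UN) auto
  also have "\<dots> \<le> emeasure M (\<Union>i. ?A i) + emeasure M ?N"
    using A N by (intro emeasure_subadditive sets.countable_UN) auto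
  also have "\<dots> = emeasure M (\<Union>i. ?A i)" unfolding transience by simp
  finally have "emeasure M ?H = emeasure M (\<Union>i. ?A i)"
    using emeasure_mono[OF sub1 H] by (rule order.antisym)
  also have "\<dots> = (\<Sum>i. emeasure M (?A i))"
    using A dis by (intro suminf_emeasure[symmetric]) auto
  also have "\<dots> = emeasure M (?A 0) + (\<Sum>i. emeasure M (?A (Suc i)))"
    by (subst suminf_offset[of _ 1]) auto
  also have "emeasure M (?A 0) = event_prob last_visit y" by (simp add: event_prob_def)
  also have "(\<Sum>i. emeasure M (?A (Suc i))) = (\<Sum>i. \<integral>\<^sup>+z. ennreal (heat (real (Suc i)) z) * event_prob last_visit (y + z) \<partial>lborel)"
    by (intro suminf_cong event_prob_markov path_event_last_visit) simp
  also have "\<dots> = (\<integral>\<^sup>+z. (\<Sum>i. ennreal (heat (real (Suc i)) z) * event_prob last_visit (y + z)) \<partial>lborel)"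
    by (rule nn_integral_suminf[symmetric]) measurable
  also have "\<dots> = (\<integral>\<^sup>+z. ennreal (lattice_heat (y + z - y)) * event_prob last_visit (y + z) \<partial>lborel)"
  proof (intro nn_integral_cong)
    fix z :: 'a
    have "(\<Sum>i. ennreal (heat (real (Suc i)) z)) = ennreal (lattice_heat z)"
      unfolding lattice_heat_def by (intro suminf_ennreal2 lattice_heat_limit_and_bound(3)[OF dim]) simp
    then show "(\<Sum>i. ennreal (heat (real (Suc i)) z) * event_prob last_visit (y + z)) = ennreal (lattice_heat (y + z - y)) * event_prob last_visit (y + z)"
      by simp
  qed
  also have "\<dots> = (\<integral>\<^sup>+z. ennreal (lattice_heat (z - y)) * event_prob last_visit z \<partial>lborel)"
    by (rule nn_integral_lborel_shift[of "\<lambda>z. ennreal (lattice_heat (z - y)) * event_prob last_visit z"])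
       (unfold lattice_heat_def, measurable)
  finally show ?thesis unfolding event_prob_def[of ever] .
qed

end

text \<open>Reduces a limit at infinity to sequences, along which dominated convergence
  applies.\<close>

lemma tendsto_at_infinity_sequentially:
  fixes f :: "'a::real_normed_vector \<Rightarrow> real"
  assumes "\<And>y. filterlim y at_infinity sequentially \<Longrightarrow> (\<lambda>n. f (y n)) \<longlonglongrightarrow> L"
  shows "(f \<longlongrightarrow> L) at_infinity"
proof (rule ccontr)
  assume "\<not> ?thesis"
  then obtain e where e: "0 < e" "\<And>b. \<exists>y. b \<le> norm y \<and> \<not> dist (f y) L < e"
    unfolding Lim_at_infinity by blast
  then have "\<exists>y. real n \<le> norm y \<and> \<not> dist (f y) L < e" for n :: nat by blast
  then obtain y where y: "\<And>n::nat. real n \<le> norm (y n)" "\<And>n. \<not> dist (f (y n)) L < e" by metis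
  have "filterlim (\<lambda>n. norm (y n)) at_top sequentially"
    by (rule filterlim_at_top_mono[OF filterlim_real_sequentially]) (simp add: y)
  then have "filterlim y at_infinity sequentially"
    using filterlim_at_infinity_conv_norm_at_top by blast
  from tendstoD[OF assms[OF this] e(1)] y(2) show False by simp
qed

lemma lattice_heat_nonneg: "3 \<le> DIM('a) \<Longrightarrow> 0 \<le> lattice_heat (w::'a::euclidean_space)"
  unfolding lattice_heat_def by (intro suminf_nonneg lattice_heat_limit_and_bound(3)) auto

lemma measurable_lattice_heat [measurable]: "lattice_heat \<in> borel_measurable borel"
  unfolding lattice_heat_def by measurable

lemma lattice_heat_le:
  fixes w :: "'a::euclidean_space"
  assumes "3 \<le> DIM('a)"
  shows "lattice_heat w \<le> lattice_heat (0 :: 'a)"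
  unfolding lattice_heat_def
proof (intro suminf_le lattice_heat_limit_and_bound(3) assms)
  show "heat (real (Suc i)) w \<le> heat (real (Suc i)) (0 :: 'a)" for i
    using heat_le_heat_0[of "real (Suc i)" w] by (simp add: heat_def)
qed

text \<open>If \<open>norm y \<le> 2 * norm (z - y)\<close>, the bounded weighted kernel decides.
  Otherwise \<open>norm y \<le> 2 * norm z\<close>, and the power of \<open>norm y\<close> is paid
  for by \<open>z\<close>, with \<open>lattice_heat\<close> at most its value at
  \<open>0\<close>.\<close>

lemma lattice_heat_weighted_bound:
  assumes dim: "3 \<le> DIM('a::euclidean_space)"
  obtains C where "0 \<le> C" "\<And>y z::'a. norm y ^ (DIM('a) - 2) * lattice_heat (z - y) \<le> C * (1 + norm z) ^ (DIM('a) - 2)"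
proof -
  let ?n = "DIM('a) - 2"
  obtain C1 where C1: "\<And>w::'a. norm w ^ ?n * lattice_heat w \<le> C1"
    using lattice_heat_limit_and_bound(2)[OF dim] by blast
  define C2 where "C2 = lattice_heat (0 :: 'a)"
  have C2: "0 \<le> C2" unfolding C2_def by (rule lattice_heat_nonneg[OF dim])
  have C10: "0 \<le> C1" using C1[of 0] lattice_heat_nonneg[OF dim, of "0::'a"]
    by (meson norm_ge_zero order.trans mult_nonneg_nonneg zero_le_power)
  have "norm y ^ ?n * lattice_heat (z - y) \<le> 2 ^ ?n * (C1 + C2) * (1 + norm z) ^ ?n" for y z :: 'a
  proof (cases "norm y \<le> 2 * norm (z - y)")
    case True
    have "norm y ^ ?n * lattice_heat (z - y) \<le> (2 * norm (z - y)) ^ ?n * lattice_heat (z - y)"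
      using True lattice_heat_nonneg[OF dim] by (intro mult_right_mono power_mono) auto
    also have "\<dots> = 2 ^ ?n * (norm (z - y) ^ ?n * lattice_heat (z - y))" by (simp add: power_mult_distrib)
    also have "\<dots> \<le> 2 ^ ?n * (C1 + C2)" using C1[of "z - y"] C2 by (intro mult_left_mono) auto
    also have "\<dots> \<le> 2 ^ ?n * (C1 + C2) * (1 + norm z) ^ ?n"
      using C10 C2 mult_left_mono[of 1 "(1 + norm z) ^ ?n" "2 ^ ?n * (C1 + C2)"] by (simp add: one_le_power)
    finally show ?thesis .
  next
    case False
    have "norm y \<le> norm z + norm (z - y)" using norm_triangle_ineq[of z "y - z"] by (simp add: norm_minus_commute)
    with False have "norm y \<le> 2 * norm z" by linarith
    then have "norm y ^ ?n * lattice_heat (z - y) \<le> (2 * (1 + norm z)) ^ ?n * C2"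
      using lattice_heat_le[OF dim, of "z - y"] lattice_heat_nonneg[OF dim, of "z - y"] unfolding C2_def
      by (intro mult_mono power_mono) auto
    also have "\<dots> = 2 ^ ?n * C2 * (1 + norm z) ^ ?n" by (simp only: power_mult_distrib mult_ac)
    also have "\<dots> \<le> 2 ^ ?n * (C1 + C2) * (1 + norm z) ^ ?n"
      using C10 by (intro mult_right_mono mult_left_mono) auto
    finally show ?thesis .
  qed
  then show ?thesis using that[of "2 ^ ?n * (C1 + C2)"] C10 C2 by simp
qed

text \<open>The quotient of \<open>norm (y n)\<close> and \<open>norm (z - y n)\<close> tends to
  \<open>1\<close>, so the limit for the unshifted kernel carries over.\<close>

lemma lattice_heat_shift_limit:
  fixes y :: "nat \<Rightarrow> 'a::euclidean_space"
  assumes dim: "3 \<le> DIM('a)" and y: "filterlim y at_infinity sequentially"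
  shows "(\<lambda>n. norm (y n) ^ (DIM('a) - 2) * lattice_heat (z - y n)) \<longlonglongrightarrow> Green_one DIM('a)"
proof -
  let ?k = "DIM('a) - 2"
  have ny: "filterlim (\<lambda>n. norm (y n)) at_top sequentially"
    by (rule filterlim_compose[OF filterlim_norm_at_top y])
  have nzy: "filterlim (\<lambda>n. norm (z - y n)) at_top sequentially"
  proof (rule filterlim_at_top_mono)
    show "filterlim (\<lambda>n. - norm z + norm (y n)) at_top sequentially"
      by (rule filterlim_tendsto_add_at_top[OF tendsto_const ny])
    show "\<forall>\<^sub>F n in sequentially. - norm z + norm (y n) \<le> norm (z - y n)"
      using norm_triangle_ineq2[of "y _" z] by (intro always_eventually allI) (simp add: norm_minus_commute)
  qed
  then have zy: "filterlim (\<lambda>n. z - y n) at_infinity sequentially"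
    using filterlim_at_infinity_conv_norm_at_top by blast
  have "(\<lambda>n. (norm (y n) - norm (z - y n)) / norm (z - y n)) \<longlonglongrightarrow> 0"
  proof (rule Lim_null_comparison)
    show "(\<lambda>n. norm z / norm (z - y n)) \<longlonglongrightarrow> 0"
      by (rule real_tendsto_divide_at_top[OF tendsto_const nzy])
    have "\<bar>norm (y n) - norm (z - y n)\<bar> \<le> norm z" for n
      using norm_triangle_ineq3[of "y n" "y n - z"] by (simp add: norm_minus_commute)
    then show "\<forall>\<^sub>F n in sequentially. norm ((norm (y n) - norm (z - y n)) / norm (z - y n)) \<le> norm z / norm (z - y n)"
      by (intro always_eventually allI) (simp add: divide_right_mono)
  qed
  then have "(\<lambda>n. (1 + (norm (y n) - norm (z - y n)) / norm (z - y n)) ^ ?k * (norm (z - y n) ^ ?k * lattice_heat (z - y n)))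
      \<longlonglongrightarrow> (1 + 0) ^ ?k * Green_one DIM('a)"
    by (intro tendsto_intros filterlim_compose[OF lattice_heat_limit_and_bound(1)[OF dim] zy])
  then have "(\<lambda>n. (1 + (norm (y n) - norm (z - y n)) / norm (z - y n)) ^ ?k * (norm (z - y n) ^ ?k * lattice_heat (z - y n)))
      \<longlonglongrightarrow> Green_one DIM('a)" by simp
  then show ?thesis
  proof (rule Lim_transform_eventually)
    show "\<forall>\<^sub>F n in sequentially. (1 + (norm (y n) - norm (z - y n)) / norm (z - y n)) ^ ?k * (norm (z - y n) ^ ?k * lattice_heat (z - y n))
        = norm (y n) ^ ?k * lattice_heat (z - y n)"
      using filterlim_at_top_dense[THEN iffD1, OF nzy, rule_format, of 0]
    proof eventually_elim
      case (elim n)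
      then have "1 + (norm (y n) - norm (z - y n)) / norm (z - y n) = norm (y n) / norm (z - y n)"
        by (simp add: diff_divide_distrib)
      then show ?case using elim by (simp add: power_divide)
    qed
  qed
qed

section \<open>Decay of the hitting probability at infinity\<close>

context brownian_motion_and_compact
begin

definition capacity :: real where "capacity = enn2real escape_mass"

lemma escape_prob_bound:
  obtains C where "0 \<le> C" "\<And>z. measure M {\<omega>\<in>space M. last_visit (\<lambda>s. z + B s \<omega>)} \<le> C * (1 / (1 + norm z) ^ (2 * (DIM('a) + 6)))"
proof -
  obtain C where C: "0 \<le> C" "\<And>z. emeasure M {\<omega>\<in>space M. hitq K 0 1 (\<lambda>s. z + B s \<omega>)} \<le> ennreal (C * (1 / (1 + norm z) ^ (2 * (DIM('a) + 6))))"
    using hit_prob_bound by blast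
  have "measure M {\<omega>\<in>space M. last_visit (\<lambda>s. z + B s \<omega>)} \<le> C * (1 / (1 + norm z) ^ (2 * (DIM('a) + 6)))" for z
  proof -
    have "event_prob last_visit z \<le> event_prob (hitq K 0 1) z"
      by (intro event_prob_mono path_event_hitq) (auto simp: last_visit_def)
    also have "\<dots> \<le> ennreal (C * (1 / (1 + norm z) ^ (2 * (DIM('a) + 6))))"
      using C(2) by (simp add: event_prob_def)
    finally show ?thesis
      unfolding event_prob_def emeasure_eq_measure using C(1) by (subst (asm) ennreal_le_iff) auto
  qed
  then show ?thesis using that C(1) by blast
qed

lemma integrable_escape_prob:
  "integrable lborel (\<lambda>z. measure M {\<omega>\<in>space M. last_visit (\<lambda>s. z + B s \<omega>)})"
  "integral\<^sup>L lborel (\<lambda>z. measure M {\<omega>\<in>space M. last_visit (\<lambda>s. z + B s \<omega>)}) = capacity"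
proof -
  let ?\<phi> = "\<lambda>z. measure M {\<omega>\<in>space M. last_visit (\<lambda>s. z + B s \<omega>)}"
  have e: "event_prob last_visit z = ennreal (?\<phi> z)" for z by (simp add: event_prob_def emeasure_eq_measure)
  have "?\<phi> = (\<lambda>z. enn2real (event_prob last_visit z))" by (simp add: e)
  then have m: "?\<phi> \<in> borel_measurable borel"
    using measurable_event_prob[OF path_event_last_visit] by simp
  have nn: "(\<integral>\<^sup>+z. ennreal (?\<phi> z) \<partial>lborel) = escape_mass" by (simp add: escape_mass_def e)
  show "integrable lborel ?\<phi>"
    by (rule integrableI_nonneg) (use m nn escape_mass_finite in auto)
  show "integral\<^sup>L lborel ?\<phi> = capacity"
    using m by (subst integral_eq_nn_integral) (auto simp: nn capacity_def)
qed

text \<open>Scale the last exit decomposition by \<open>norm y ^ (DIM('a) - 2)\<close>. The first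
  term vanishes by the decay of the escape probability, and in the integral the kernel tends to the
  constant \<open>Green_one DIM('a)\<close>.\<close>

theorem hitting_prob_limit:
  "((\<lambda>y. norm y ^ (DIM('a) - 2) * measure M {\<omega>\<in>space M. ever (\<lambda>s. y + B s \<omega>)}) \<longlongrightarrow> Green_one DIM('a) * capacity) at_infinity"
proof -
  let ?k = "DIM('a) - 2" and ?p = "2 * (DIM('a) + 6)"
  define \<phi> where "\<phi> z = measure M {\<omega>\<in>space M. last_visit (\<lambda>s. z + B s \<omega>)}" for z
  have e: "event_prob last_visit z = ennreal (\<phi> z)" for z by (simp add: event_prob_def emeasure_eq_measure \<phi>_def)
  have \<phi>i: "integrable lborel \<phi>" "integral\<^sup>L lborel \<phi> = capacity"
    using integrable_escape_prob unfolding \<phi>_def by auto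
  have [measurable]: "\<phi> \<in> borel_measurable borel" using \<phi>i(1) by auto
  have \<phi>0: "0 \<le> \<phi> z" for z by (simp add: \<phi>_def)
  obtain C where C: "0 \<le> C" "\<And>z. \<phi> z \<le> C * (1 / (1 + norm z) ^ ?p)"
    using escape_prob_bound unfolding \<phi>_def by blast
  obtain C' where C': "0 \<le> C'" "\<And>y z::'a. norm y ^ ?k * lattice_heat (z - y) \<le> C' * (1 + norm z) ^ ?k"
    using lattice_heat_weighted_bound[OF dim] by blast
  define I where "I y = integral\<^sup>L lborel (\<lambda>z. lattice_heat (z - y) * \<phi> z)" for y
  have lh0: "0 \<le> lattice_heat w" for w :: 'a by (rule lattice_heat_nonneg[OF dim])
  have int: "integrable lborel (\<lambda>z. lattice_heat (z - y) * \<phi> z)" for y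
  proof (rule Bochner_Integration.integrable_bound)
    show "integrable lborel (\<lambda>z. lattice_heat (0::'a) * \<phi> z)" using \<phi>i(1) by simp
    show "AE z in lborel. norm (lattice_heat (z - y) * \<phi> z) \<le> norm (lattice_heat (0::'a) * \<phi> z)"
      using lh0 \<phi>0 lattice_heat_le[OF dim] by (intro AE_I2) (auto simp: abs_mult intro!: mult_right_mono)
  qed measurable
  have decomp: "measure M {\<omega>\<in>space M. ever (\<lambda>s. y + B s \<omega>)} = \<phi> y + I y" for y
  proof -
    have "(\<integral>\<^sup>+z. ennreal (lattice_heat (z - y)) * event_prob last_visit z \<partial>lborel) = (\<integral>\<^sup>+z. ennreal (lattice_heat (z - y) * \<phi> z) \<partial>lborel)"
      unfolding e using lh0 by (simp add: ennreal_mult')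
    also have "\<dots> = ennreal (I y)"
      unfolding I_def using int lh0 \<phi>0 by (intro nn_integral_eq_integral) auto
    finally have "ennreal (measure M {\<omega>\<in>space M. ever (\<lambda>s. y + B s \<omega>)}) = ennreal (\<phi> y) + ennreal (I y)"
      using last_exit_decomposition[of y] unfolding e by (simp add: event_prob_def emeasure_eq_measure)
    moreover have I0: "0 \<le> I y" unfolding I_def using lh0 \<phi>0 by (intro integral_nonneg_AE) auto
    ultimately show ?thesis using \<phi>0[of y] by (simp flip: ennreal_plus)
  qed
  \<comment> \<open>The growth of the kernel in \<open>z\<close> is paid from the decay of
    \<open>\<phi>\<close>. The exponent left is \<open>DIM('a) + 14\<close>, more than the
    \<open>DIM('a) + 2\<close> that integrability asks for.\<close>
  define D where "D z = C' * C * (1 / (1 + norm (z::'a)) ^ (?p - ?k))" for z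
  have Di: "integrable lborel D"
    unfolding D_def using dim by (intro integrable_mult_right integrable_inverse_power_norm) auto
  have dom: "norm (norm y ^ ?k * (lattice_heat (z - y) * \<phi> z)) \<le> D z" for y z
  proof -
    have "norm (norm y ^ ?k * (lattice_heat (z - y) * \<phi> z)) = (norm y ^ ?k * lattice_heat (z - y)) * \<phi> z"
      using lh0 \<phi>0 by (simp add: abs_mult)
    also have "\<dots> \<le> (C' * (1 + norm z) ^ ?k) * (C * (1 / (1 + norm z) ^ ?p))"
      by (rule mult_mono[OF C'(2) C(2)]) (use C' \<phi>0 in auto)
    also have "\<dots> = D z"
    proof -
      have "?p - ?k + ?k = ?p" using dim by simp
      from power_add[of "1 + norm z" "?p - ?k" ?k, unfolded this]
      have pw: "(1 + norm z) ^ ?p = (1 + norm z) ^ (?p - ?k) * (1 + norm z) ^ ?k" .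
      have "(1 + norm z) ^ ?k \<noteq> 0" by (simp add: add_nonneg_eq_0_iff)
      then show ?thesis unfolding D_def pw by simp
    qed
    finally show ?thesis .
  qed
  have seq: "(\<lambda>n. norm (y n) ^ ?k * measure M {\<omega>\<in>space M. ever (\<lambda>s. y n + B s \<omega>)}) \<longlonglongrightarrow> Green_one DIM('a) * capacity"
    if y: "filterlim y at_infinity sequentially" for y :: "nat \<Rightarrow> 'a"
  proof -
    have "(\<lambda>n. integral\<^sup>L lborel (\<lambda>z. norm (y n) ^ ?k * (lattice_heat (z - y n) * \<phi> z))) \<longlonglongrightarrow> integral\<^sup>L lborel (\<lambda>z. Green_one DIM('a) * \<phi> z)"
    proof (rule integral_dominated_convergence[OF _ _ Di])
      show "AE z in lborel. (\<lambda>n. norm (y n) ^ ?k * (lattice_heat (z - y n) * \<phi> z)) \<longlonglongrightarrow> Green_one DIM('a) * \<phi> z"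
      proof (rule AE_I2)
        fix z
        have "(\<lambda>n. norm (y n) ^ ?k * lattice_heat (z - y n) * \<phi> z) \<longlonglongrightarrow> Green_one DIM('a) * \<phi> z"
          by (intro tendsto_mult tendsto_const lattice_heat_shift_limit[OF dim y])
        then show "(\<lambda>n. norm (y n) ^ ?k * (lattice_heat (z - y n) * \<phi> z)) \<longlonglongrightarrow> Green_one DIM('a) * \<phi> z"
          by (simp only: mult.assoc)
      qed
    qed (use dom in auto)
    then have I: "(\<lambda>n. norm (y n) ^ ?k * I (y n)) \<longlonglongrightarrow> Green_one DIM('a) * capacity"
      unfolding I_def using \<phi>i(2) by simp
    have "(\<lambda>n. norm (y n) ^ ?k * \<phi> (y n)) \<longlonglongrightarrow> 0"
    proof (rule Lim_null_comparison)
      show "(\<lambda>n. C / norm (y n)) \<longlonglongrightarrow> 0"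
        by (rule real_tendsto_divide_at_top[OF tendsto_const filterlim_compose[OF filterlim_norm_at_top y]])
      show "\<forall>\<^sub>F n in sequentially. norm (norm (y n) ^ ?k * \<phi> (y n)) \<le> C / norm (y n)"
        using filterlim_at_top_dense[THEN iffD1, OF filterlim_compose[OF filterlim_norm_at_top y], rule_format, of 0]
      proof eventually_elim
        case (elim n)
        let ?r = "norm (y n)"
        have "norm (?r ^ ?k * \<phi> (y n)) = ?r ^ ?k * \<phi> (y n)" using \<phi>0 by simp
        also have "\<dots> \<le> (1 + ?r) ^ ?k * (C * (1 / (1 + ?r) ^ ?p))"
          using C \<phi>0 by (intro mult_mono power_mono) auto
        also have "\<dots> = C * ((1 + ?r) ^ ?k / (1 + ?r) ^ ?p)" by simp
        also have "\<dots> \<le> C * (1 / ?r)"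
        proof (intro mult_left_mono C)
          have "?r * (1 + ?r) ^ ?k \<le> (1 + ?r) ^ (Suc ?k)" using elim by (simp add: mult_right_mono)
          also have "\<dots> \<le> (1 + ?r) ^ ?p" using elim by (intro power_increasing) auto
          finally have "(1 + ?r) ^ ?k \<le> (1 + ?r) ^ ?p / ?r"
            by (subst pos_le_divide_eq[OF elim]) (simp only: mult.commute)
          then have le: "(1 + ?r) ^ ?k \<le> 1 / ?r * (1 + ?r) ^ ?p" by simp
          have P: "0 < (1 + ?r) ^ ?p" using elim by (intro zero_less_power add_pos_pos) auto
          show "(1 + ?r) ^ ?k / (1 + ?r) ^ ?p \<le> 1 / ?r"
            unfolding pos_divide_le_eq[OF P] by (rule le)
        qed
        finally show ?case by simp
      qed
    qed
    from tendsto_add[OF this I] show ?thesis unfolding decomp by (simp add: distrib_left)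
  qed
  show ?thesis by (rule tendsto_at_infinity_sequentially) (rule seq)
qed

section \<open>Identification with \<open>Cap\<close>, and positivity\<close>

lemma hitq_iff_path:
  assumes "\<omega> \<in> space M" "0 \<le> a" "a < b"
  shows "hitq K a b (\<lambda>s. y + B s \<omega>) \<longleftrightarrow> (\<exists>s\<in>{a..b}. y + B s \<omega> \<in> K)"
  by (intro hitq_iff compact_imp_closed compact_K K_nonempty assms continuous_intros
        continuous_on_subset[OF continuous_BM[OF assms(1)]]) (use assms in auto)

lemma hitting_time_finite_iff: "hitting_time K w < \<infinity> \<longleftrightarrow> (\<exists>t>0. w t \<in> K)"
  unfolding hitting_time_def Inf_less_iff by auto

text \<open>\<open>hitq\<close> tests time \<open>0\<close> whereas \<open>hitting_time\<close> does
  not; starting outside \<open>K\<close> removes the difference.\<close>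

lemma ever_iff:
  assumes "\<omega> \<in> space M" "y \<notin> K"
  shows "ever (\<lambda>s. y + B s \<omega>) \<longleftrightarrow> hitting_time K (\<lambda>s. y + B s \<omega>) < \<infinity>"
proof
  assume "ever (\<lambda>s. y + B s \<omega>)"
  then obtain n :: nat where "hitq K 0 (1 + real n) (\<lambda>s. y + B s \<omega>)" by (auto simp: ever_def)
  then obtain s where s: "0 \<le> s" "y + B s \<omega> \<in> K" using hitq_iff_path[OF assms(1), of 0 "1 + real n" y] by auto
  have "s \<noteq> 0" using s assms start_BM by auto
  then show "hitting_time K (\<lambda>s. y + B s \<omega>) < \<infinity>" using s unfolding hitting_time_finite_iff by (intro exI[of _ s]) auto
next
  assume "hitting_time K (\<lambda>s. y + B s \<omega>) < \<infinity>"
  then obtain s where s: "0 < s" "y + B s \<omega> \<in> K" unfolding hitting_time_finite_iff by blast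
  obtain n :: nat where "s \<le> real n" using real_arch_simple by blast
  then have "hitq K 0 (1 + real n) (\<lambda>s. y + B s \<omega>)"
    using s hitq_iff_path[OF assms(1), of 0 "1 + real n" y] by (auto intro!: bexI[of _ s])
  then show "ever (\<lambda>s. y + B s \<omega>)" by (auto simp: ever_def)
qed

theorem Cap_eq_capacity: "Cap M B K = capacity"
proof -
  have "((\<lambda>y. norm y ^ (DIM('a) - 2) * prob_from M B y (\<lambda>w. hitting_time K w < \<infinity>)) \<longlongrightarrow> Green_one DIM('a) * capacity) at_infinity"
  proof (rule Lim_transform_eventually[OF hitting_prob_limit])
    show "\<forall>\<^sub>F y in at_infinity. norm y ^ (DIM('a) - 2) * measure M {\<omega>\<in>space M. ever (\<lambda>s. y + B s \<omega>)}
       = norm y ^ (DIM('a) - 2) * prob_from M B y (\<lambda>w. hitting_time K w < \<infinity>)"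
      unfolding eventually_at_infinity
    proof (intro exI allI impI)
      fix y :: 'a assume "R \<le> norm y"
      then have "y \<notin> K" using K_ball by auto
      then have "{\<omega>\<in>space M. ever (\<lambda>s. y + B s \<omega>)} = {\<omega>\<in>space M. hitting_time K (\<lambda>s. y + B s \<omega>) < \<infinity>}"
        using ever_iff by blast
      then show "norm y ^ (DIM('a) - 2) * measure M {\<omega>\<in>space M. ever (\<lambda>s. y + B s \<omega>)}
       = norm y ^ (DIM('a) - 2) * prob_from M B y (\<lambda>w. hitting_time K w < \<infinity>)"
        by (simp add: prob_from_def)
    qed
  qed
  then have "Lim at_infinity (\<lambda>y. norm y ^ (DIM('a) - 2) * prob_from M B y (\<lambda>w. hitting_time K w < \<infinity>)) = Green_one DIM('a) * capacity"
    by (rule tendsto_Lim[OF trivial_limit_at_infinity])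
  then show ?thesis using Green_one_pos[OF dim] by (simp add: Cap_def)
qed

text \<open>Zero capacity makes the escape probability vanish almost everywhere, and with it, by the
  last exit decomposition, the hitting probability. Nonpolarity only provides one starting point
  \<open>y\<close>, which could be exceptional; but after a short time \<open>e n\<close> the motion
  has a density, so a null set of positions is not felt.\<close>

theorem capacity_pos:
  assumes "nonpolar M B K" shows "0 < capacity"
proof (rule ccontr)
  assume "\<not> 0 < capacity"
  then have "capacity = 0" by (simp add: capacity_def less_le)
  then have "escape_mass = 0"
    using escape_mass_finite by (auto simp: capacity_def enn2real_eq_0_iff)
  then have \<phi>0: "AE z in lborel. event_prob last_visit z = 0"
    unfolding escape_mass_def
    using nn_integral_0_iff_AE[of "event_prob last_visit" lborel] measurable_event_prob[OF path_event_last_visit] by simp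
  have ever0: "AE z in lborel. event_prob ever z = 0"
    using \<phi>0
  proof eventually_elim
    case (elim y)
    have "(\<integral>\<^sup>+z. ennreal (lattice_heat (z - y)) * event_prob last_visit z \<partial>lborel) = (\<integral>\<^sup>+z. 0 \<partial>(lborel::'a measure))"
      by (rule nn_integral_cong_AE) (use \<phi>0 in eventually_elim, simp)
    then show ?case using last_exit_decomposition[of y] elim by simp
  qed
  obtain y where y: "0 < prob_from M B y (\<lambda>w. hitting_time K w < \<infinity>)" using assms by (auto simp: nonpolar_def)
  \<comment> \<open>Rational, as \<open>hitq_shift\<close> requires, and tending to
    \<open>0\<close>, so that the intervals \<open>[e n, n + 2]\<close> exhaust the positive
    times.\<close>
  define e where "e n = 1 / (real n + 1)" for n :: nat
  have e: "0 < e n" "e n \<le> 1" "e n \<in> \<rat>" for n by (auto simp: e_def)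
  let ?A = "\<lambda>n::nat. {\<omega>\<in>space M. hitq K (e n) (real n + 2) (\<lambda>s. y + B s \<omega>)}"
  have A: "?A n \<in> sets M" for n
    using sets_event[OF path_event_hitq[of "e n" K "real n + 2"], of 0 y] e(1)[of n] by simp
  have A0: "emeasure M (?A n) = 0" for n
  proof -
    have "?A n = {\<omega>\<in>space M. hitq K 0 (real n + 2 - e n) (\<lambda>u. y + B (e n + u) \<omega>)}"
      using hitq_shift[OF e(3)[of n], of K 0 "real n + 2 - e n" "\<lambda>s. y + B s _"] by simp
    then have "emeasure M (?A n) = (\<integral>\<^sup>+z. ennreal (heat (e n) z) * event_prob (hitq K 0 (real n + 2 - e n)) (y + z) \<partial>lborel)"
      using event_prob_markov[OF path_event_hitq[OF order.refl] e(1)[of n]] by simp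
    also have "\<dots> \<le> (\<integral>\<^sup>+z. ennreal (heat (e n) (y + z - y)) * event_prob ever (y + z) \<partial>lborel)"
    proof (intro nn_integral_mono mult_mono order.refl event_prob_mono path_event_ever)
      fix z :: 'a and w assume "hitq K 0 (real n + 2 - e n) w"
      then have "hitq K 0 (1 + real (Suc n)) w" by (rule hitq_mono) (use e(1)[of n] in auto)
      then show "ever w" unfolding ever_def by blast
    qed auto
    also have "\<dots> = (\<integral>\<^sup>+z. ennreal (heat (e n) (z - y)) * event_prob ever z \<partial>lborel)"
    proof (rule nn_integral_lborel_shift[of "\<lambda>z. ennreal (heat (e n) (z - y)) * event_prob ever z"])
      note [measurable] = measurable_event_prob[OF path_event_ever]
      show "(\<lambda>z. ennreal (heat (e n) (z - y)) * event_prob ever z) \<in> borel_measurable borel" by measurable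
    qed
    also have "\<dots> = (\<integral>\<^sup>+z. 0 \<partial>(lborel::'a measure))"
      by (rule nn_integral_cong_AE) (use ever0 in eventually_elim, simp)
    finally show ?thesis by simp
  qed
  have "{\<omega>\<in>space M. hitting_time K (\<lambda>s. y + B s \<omega>) < \<infinity>} \<subseteq> (\<Union>n. ?A n)"
  proof
    fix \<omega> assume "\<omega> \<in> {\<omega>\<in>space M. hitting_time K (\<lambda>s. y + B s \<omega>) < \<infinity>}"
    then obtain s where \<omega>: "\<omega> \<in> space M" and s: "0 < s" "y + B s \<omega> \<in> K" unfolding hitting_time_finite_iff by blast
    obtain n :: nat where n: "max s (1 / s) \<le> real n" using real_arch_simple by blast
    have "e n \<le> s"
    proof -
      have "1 / s \<le> real n + 1" using n by simp
      then show ?thesis using s by (simp add: e_def field_simps)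
    qed
    moreover have "s \<le> real n + 2" "e n < real n + 2" using n e(2)[of n] by auto
    ultimately have "hitq K (e n) (real n + 2) (\<lambda>s. y + B s \<omega>)"
      using s hitq_iff_path[OF \<omega>, of "e n" "real n + 2" y] e(1)[of n] by (auto intro!: bexI[of _ s])
    then show "\<omega> \<in> (\<Union>n. ?A n)" using \<omega> by blast
  qed
  then have "emeasure M {\<omega>\<in>space M. hitting_time K (\<lambda>s. y + B s \<omega>) < \<infinity>} \<le> emeasure M (\<Union>n. ?A n)"
    using A by (intro emeasure_mono sets.countable_UN) auto
  also have "\<dots> = 0"
    using A A0 by (intro emeasure_UN_eq_0) auto
  finally have "emeasure M {\<omega>\<in>space M. hitting_time K (\<lambda>s. y + B s \<omega>) < \<infinity>} = 0" by simp
  then show False using y by (simp add: prob_from_def measure_def)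
qed

end

section \<open>The Wiener sausage\<close>

text \<open>
  \<open>vol\<close> measures the \<open>z\<close> for which \<open>z + w\<close> hits \<open>K\<close>, whereas the sausage uses \<open>z - w\<close>: the asymptotics
  are applied to \<open>- B\<close>, whose capacity agrees with that of \<open>B\<close> by uniqueness of the law.
\<close>

lemma standard_brownian_motion_minus:
  fixes B :: "real \<Rightarrow> 'w \<Rightarrow> 'a::euclidean_space"
  assumes "standard_brownian_motion M B"
  shows "standard_brownian_motion M (\<lambda>t \<omega>. - B t \<omega>)"
proof -
  interpret standard_brownian_motion M B by fact
  show ?thesis
  proof
    fix s t :: real assume st: "0 \<le> s" "s < t"
    let ?f = "\<lambda>z::'a. ennreal (\<Prod>b\<in>Basis. normal_density 0 (sqrt (t - s)) (z \<bullet> b))"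
    have f: "?f = (\<lambda>z. ennreal (heat (t - s) z))" using st by (simp add: prod_normal_density)
    have "distributed M lborel (\<lambda>\<omega>. - B t \<omega> - - B s \<omega>) (\<lambda>z. ennreal (heat (t - s) z))"
      unfolding distributed_def
    proof (intro conjI)
      have m: "(\<lambda>\<omega>. B t \<omega> - B s \<omega>) \<in> borel_measurable M" using st by (intro measurable_increment) auto
      then have m': "(\<lambda>\<omega>. - B t \<omega> - - B s \<omega>) \<in> borel_measurable M"
        using borel_measurable_uminus[OF m] by simp
      then show "(\<lambda>\<omega>. - B t \<omega> - - B s \<omega>) \<in> measurable M lborel" by simp
      show "distr M lborel (\<lambda>\<omega>. - B t \<omega> - - B s \<omega>) = density lborel (\<lambda>z. ennreal (heat (t - s) z))"
      proof (rule measure_eqI)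
        fix A assume "A \<in> sets (distr M lborel (\<lambda>\<omega>. - B t \<omega> - - B s \<omega>))"
        then have A [measurable]: "A \<in> sets borel" by simp
        have "emeasure (distr M lborel (\<lambda>\<omega>. - B t \<omega> - - B s \<omega>)) A = emeasure M {\<omega>\<in>space M. - B t \<omega> - - B s \<omega> \<in> A}"
          using m' by (subst emeasure_distr) (auto intro!: arg_cong[where f="emeasure M"])
        also have "\<dots> = (\<integral>\<^sup>+\<omega>. indicator A (- B t \<omega> - - B s \<omega>) \<partial>M)"
          by (rule emeasure_vimage_eq_nn_integral[OF m' A])
        also have "\<dots> = (\<integral>\<^sup>+z. ennreal (heat (t - s) z) * indicator A (- z) \<partial>lborel)"
          using nn_integral_increment[OF st, of "\<lambda>z. indicator A (- z)"] by simp
        also have "\<dots> = (\<integral>\<^sup>+z. ennreal (heat (t - s) z) * indicator A ((-1) *\<^sub>R z) \<partial>lborel)" by simp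
        also have "\<dots> = (\<integral>\<^sup>+z. ennreal (heat ((-1)\<^sup>2 * (t - s)) z) * indicator A z \<partial>lborel)"
          using st by (intro nn_integral_heat_scale) auto
        finally show "emeasure (distr M lborel (\<lambda>\<omega>. - B t \<omega> - - B s \<omega>)) A = emeasure (density lborel (\<lambda>z. ennreal (heat (t - s) z))) A"
          by (simp add: emeasure_density)
      qed simp
    qed measurable
    then show "distributed M lborel (\<lambda>\<omega>. - B t \<omega> - - B s \<omega>) ?f" unfolding f .
  next
    fix n :: nat and \<tau> :: "nat \<Rightarrow> real"
    assume "0 \<le> \<tau> 0" "\<And>i. i < n \<Longrightarrow> \<tau> i \<le> \<tau> (Suc i)"
    then have iv: "indep_vars (\<lambda>_. borel) (\<lambda>i \<omega>. B (\<tau> (Suc i)) \<omega> - B (\<tau> i) \<omega>) {..<n}"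
      by (rule increments_indep)
    have "indep_vars (\<lambda>_. borel) (\<lambda>i. uminus \<circ> (\<lambda>\<omega>. B (\<tau> (Suc i)) \<omega> - B (\<tau> i) \<omega>)) {..<n}"
      by (rule indep_vars_compose[OF iv]) simp
    then show "indep_vars (\<lambda>_. borel) (\<lambda>i \<omega>. - B (\<tau> (Suc i)) \<omega> - - B (\<tau> i) \<omega>) {..<n}"
      by (simp add: o_def)
  qed (auto intro!: borel_measurable_uminus measurable_BM continuous_on_minus continuous_BM simp: start_BM)
qed

lemma standard_brownian_motion_law_unique:
  fixes B B' :: "real \<Rightarrow> 'w \<Rightarrow> 'a::euclidean_space"
  assumes "standard_brownian_motion M B" "standard_brownian_motion M B'"
  shows "distr M path_space (traj B) = distr M path_space (traj B')"
proof -
  interpret B: standard_brownian_motion M B by fact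
  interpret B': standard_brownian_motion M B' by fact
  show ?thesis
  proof (rule law_eqI)
    fix n and \<tau> :: "nat \<Rightarrow> real" and A :: "nat \<Rightarrow> 'a set"
    assume 1: "\<tau> 0 = 0" "\<And>i. i < n \<Longrightarrow> \<tau> i \<le> \<tau> (Suc i)" "\<And>i. i \<le> n \<Longrightarrow> 0 \<le> \<tau> i" "\<And>i. A i \<in> sets borel"
    have one: "B.prob {\<omega>\<in>space M. B (\<tau> (Suc i)) \<omega> - B (\<tau> i) \<omega> \<in> A i} = B.prob {\<omega>\<in>space M. B' (\<tau> (Suc i)) \<omega> - B' (\<tau> i) \<omega> \<in> A i}"
      if i: "i < n" for i
    proof (cases "\<tau> i = \<tau> (Suc i)")
      case False
      then have st: "0 \<le> \<tau> i" "\<tau> i < \<tau> (Suc i)" using 1(2)[OF i] 1(3)[of i] i by auto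
      have mI: "(indicator (A i) :: 'a \<Rightarrow> ennreal) \<in> borel_measurable borel" using 1(4) by simp
      have "emeasure M {\<omega>\<in>space M. B (\<tau> (Suc i)) \<omega> - B (\<tau> i) \<omega> \<in> A i} = emeasure M {\<omega>\<in>space M. B' (\<tau> (Suc i)) \<omega> - B' (\<tau> i) \<omega> \<in> A i}"
        using st emeasure_vimage_eq_nn_integral[OF B.measurable_increment 1(4), of "\<tau> i" "\<tau> (Suc i)" i]
          emeasure_vimage_eq_nn_integral[OF B'.measurable_increment 1(4), of "\<tau> i" "\<tau> (Suc i)" i]
          B.nn_integral_increment[OF st mI] B'.nn_integral_increment[OF st mI]
        by simp
      then show ?thesis by (simp add: measure_def)
    qed simp
    have "B.prob {\<omega>\<in>space M. \<forall>i<n. B (\<tau> (Suc i)) \<omega> - B (\<tau> i) \<omega> \<in> A i} = (\<Prod>i<n. B.prob {\<omega>\<in>space M. B (\<tau> (Suc i)) \<omega> - B (\<tau> i) \<omega> \<in> A i})"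
      by (rule B.prob_increments) (use 1 in auto)
    also have "\<dots> = (\<Prod>i<n. B.prob {\<omega>\<in>space M. B' (\<tau> (Suc i)) \<omega> - B' (\<tau> i) \<omega> \<in> A i})"
      by (intro prod.cong refl one) simp
    also have "\<dots> = B.prob {\<omega>\<in>space M. \<forall>i<n. B' (\<tau> (Suc i)) \<omega> - B' (\<tau> i) \<omega> \<in> A i}"
      by (rule B'.prob_increments[symmetric]) (use 1 in auto)
    finally show "emeasure M {\<omega>\<in>space M. \<forall>i<n. B (\<tau> (Suc i)) \<omega> - B (\<tau> i) \<omega> \<in> A i}
      = emeasure M {\<omega>\<in>space M. \<forall>i<n. B' (\<tau> (Suc i)) \<omega> - B' (\<tau> i) \<omega> \<in> A i}"
      by (simp add: B.emeasure_eq_measure)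
  qed (simp_all add: B.finite_measure_axioms B.measurable_BM B'.measurable_BM B.start_BM B'.start_BM)
qed

section \<open>From closed time intervals to the half-open interval of the sausage\<close>

context brownian_motion_and_compact
begin

text \<open>The sausage runs over \<open>[0, t)\<close>, while \<open>hitq\<close> speaks of closed
  intervals, which exhaust it from inside. The \<open>2\<close> keeps the right end positive for
  \<open>n = 0\<close>.\<close>

definition half_open_hit :: "real \<Rightarrow> (real \<Rightarrow> 'a) \<Rightarrow> bool" where
  "half_open_hit t w \<longleftrightarrow> (\<exists>n::nat. hitq K 0 (t - t / (real n + 2)) w)"

lemma path_event_half_open_hit: "path_event (half_open_hit t)"
  unfolding half_open_hit_def[abs_def] by (intro path_event_ex path_event_hitq) simp

lemma half_open_hit_iff:
  assumes t: "0 < t" and w: "continuous_on {0..t} w"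
  shows "half_open_hit t w \<longleftrightarrow> (\<exists>s\<in>{0..<t}. w s \<in> K)"
proof -
  have lt: "0 < t - t / (real n + 2)" "t - t / (real n + 2) < t" for n :: nat
  proof -
    have "t / (real n + 2) \<le> t / 2" using t by (intro divide_left_mono) auto
    moreover have "0 < t / (real n + 2)" using t by simp
    ultimately show "0 < t - t / (real n + 2)" "t - t / (real n + 2) < t" using t by linarith+
  qed
  have "half_open_hit t w \<longleftrightarrow> (\<exists>n::nat. \<exists>s\<in>{0..t - t / (real n + 2)}. w s \<in> K)"
    unfolding half_open_hit_def
  proof (intro ex_cong1 hitq_iff compact_imp_closed compact_K K_nonempty lt)
    show "continuous_on {0..t - t / (real n + 2)} w" for n :: nat
      using lt[of n] by (intro continuous_on_subset[OF w]) auto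
  qed
  also have "\<dots> \<longleftrightarrow> (\<exists>s\<in>{0..<t}. w s \<in> K)"
  proof
    assume "\<exists>n::nat. \<exists>s\<in>{0..t - t / (real n + 2)}. w s \<in> K"
    then obtain n :: nat and s where "s \<in> {0..t - t / (real n + 2)}" "w s \<in> K" by blast
    then show "\<exists>s\<in>{0..<t}. w s \<in> K" using lt(2)[of n] by (intro bexI[of _ s]) auto
  next
    assume "\<exists>s\<in>{0..<t}. w s \<in> K"
    then obtain s where s: "0 \<le> s" "s < t" "w s \<in> K" by auto
    obtain n :: nat where n: "t / (t - s) \<le> real n" using real_arch_simple by blast
    have "t / (real n + 2) \<le> t - s"
      using n s t by (simp add: field_simps) 
    then show "\<exists>n::nat. \<exists>s\<in>{0..t - t / (real n + 2)}. w s \<in> K"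
      using s by (intro exI[of _ n] bexI[of _ s]) auto
  qed
  finally show ?thesis .
qed

lemma continuous_bridge: "\<omega> \<in> space M \<Longrightarrow> 0 < t \<Longrightarrow> continuous_on {0..} (\<lambda>s. brownian_bridge B t x s \<omega>)"
  unfolding brownian_bridge_def by (intro continuous_intros continuous_BM) auto

definition sausage_mean :: "real \<Rightarrow> 'a \<Rightarrow> ennreal" where
  "sausage_mean t x = (\<integral>\<^sup>+\<omega>. vol (half_open_hit t) (traj (brownian_bridge B t x) \<omega>) \<partial>M)"

text \<open>The two events differ only by hits at the final time \<open>t\<close>, and the points
  concerned lie in a translate of \<open>K\<close>: a bounded error.\<close>

lemma sausage_mean_bounds:
  assumes t: "0 < t"
  shows "sausage_mean t x \<le> bridge_volume t x" "bridge_volume t x \<le> sausage_mean t x + emeasure lborel K"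
proof -
  have le: "t - t / (real n + 2) \<le> t" for n :: nat using t by simp
  show "sausage_mean t x \<le> bridge_volume t x"
    unfolding sausage_mean_def bridge_volume_def
    by (intro nn_integral_mono vol_mono) (auto simp: half_open_hit_def intro: hitq_mono[OF _ order.refl le])
  have K [measurable]: "K \<in> sets borel" using compact_K by (simp add: compact_imp_closed)
  have pt: "vol (hitq K 0 t) (traj (brownian_bridge B t x) \<omega>) \<le> vol (half_open_hit t) (traj (brownian_bridge B t x) \<omega>) + emeasure lborel K"
    if \<omega>: "\<omega> \<in> space M" for \<omega>
  proof -
    let ?w = "\<lambda>s. brownian_bridge B t x s \<omega>"
    have c: "continuous_on {0..t} (\<lambda>s. z + ?w s)" for z
      using continuous_bridge[OF \<omega> t, of x] by (intro continuous_intros) (auto intro: continuous_on_subset)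
    have "vol (hitq K 0 t) (traj (brownian_bridge B t x) \<omega>) = vol (hitq K 0 t) ?w"
      by (intro vol_cong path_event_hitq) auto
    also have "\<dots> \<le> (\<integral>\<^sup>+z. indicator (Collect (half_open_hit t)) (\<lambda>s. z + ?w s) + indicator K (?w t + z) \<partial>lborel)"
      unfolding vol_def
    proof (intro nn_integral_mono)
      fix z
      show "indicator (Collect (hitq K 0 t)) (\<lambda>s. z + ?w s)
        \<le> (indicator (Collect (half_open_hit t)) (\<lambda>s. z + ?w s) + indicator K (?w t + z) :: ennreal)"
      proof (cases "hitq K 0 t (\<lambda>s. z + ?w s)")
        case True
        then obtain s where s: "0 \<le> s" "s \<le> t" "z + ?w s \<in> K"
          using hitq_iff[OF compact_imp_closed[OF compact_K] K_nonempty t c, of z] by auto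
        show ?thesis
        proof (cases "s = t")
          case True
          then have "?w t + z \<in> K" using s by (simp add: add.commute)
          then show ?thesis by (simp add: indicator_def)
        next
          case False
          then have "half_open_hit t (\<lambda>s. z + ?w s)"
            using s half_open_hit_iff[OF t c, of z] by auto
          then show ?thesis by (simp add: indicator_def)
        qed
      qed simp
    qed
    also have "\<dots> = vol (half_open_hit t) ?w + (\<integral>\<^sup>+z. indicator K (?w t + z) \<partial>lborel)"
      unfolding vol_def using path_event_slice_measurable[OF path_event_half_open_hit]
      by (intro nn_integral_add) auto
    also have "(\<integral>\<^sup>+z. indicator K (?w t + z) \<partial>lborel) = (\<integral>\<^sup>+z. indicator K z \<partial>lborel)"
      by (rule nn_integral_lborel_shift) measurable
    also have "\<dots> = emeasure lborel K" by simp
    also have "vol (half_open_hit t) ?w = vol (half_open_hit t) (traj (brownian_bridge B t x) \<omega>)"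
      by (intro vol_cong path_event_half_open_hit) auto
    finally show ?thesis .
  qed
  have "bridge_volume t x \<le> (\<integral>\<^sup>+\<omega>. vol (half_open_hit t) (traj (brownian_bridge B t x) \<omega>) + emeasure lborel K \<partial>M)"
    unfolding bridge_volume_def by (intro nn_integral_mono pt)
  also have "\<dots> = sausage_mean t x + emeasure lborel K"
    unfolding sausage_mean_def using measurable_vol_bridge[OF path_event_half_open_hit] t
    by (subst nn_integral_add) (auto simp: emeasure_space_1)
  finally show "bridge_volume t x \<le> sausage_mean t x + emeasure lborel K" .
qed

text \<open>\<open>measure\<close> and \<open>enn2real\<close> send infinity to \<open>0\<close>, so
  the mean must be finite before the Bochner integral can be identified with the extended
  one.\<close>

lemma integral_sausage:
  assumes t: "0 < t" and fin: "sausage_mean t x < \<infinity>"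
  shows "(\<integral>\<omega>. measure lebesgue {z. \<exists>s\<in>{0..<t}. z + brownian_bridge B t x s \<omega> \<in> K} \<partial>M) = enn2real (sausage_mean t x)"
proof -
  let ?V = "\<lambda>\<omega>. vol (half_open_hit t) (traj (brownian_bridge B t x) \<omega>)"
  have m: "?V \<in> borel_measurable M" using t by (intro measurable_vol_bridge path_event_half_open_hit) auto
  have "(\<integral>\<omega>. measure lebesgue {z. \<exists>s\<in>{0..<t}. z + brownian_bridge B t x s \<omega> \<in> K} \<partial>M) = (\<integral>\<omega>. enn2real (?V \<omega>) \<partial>M)"
  proof (intro Bochner_Integration.integral_cong refl)
    fix \<omega> assume \<omega>: "\<omega> \<in> space M"
    let ?w = "\<lambda>s. brownian_bridge B t x s \<omega>"
    have c: "continuous_on {0..t} (\<lambda>s. z + ?w s)" for z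
      using continuous_bridge[OF \<omega> t, of x] by (intro continuous_intros) (auto intro: continuous_on_subset)
    have "Measurable.pred borel (\<lambda>z. half_open_hit t (\<lambda>s. z + ?w s))"
      by (intro path_event_pred path_event_half_open_hit) measurable
    then have S: "{z. half_open_hit t (\<lambda>s. z + ?w s)} \<in> sets borel" by (simp add: pred_def)
    have "{z. \<exists>s\<in>{0..<t}. z + ?w s \<in> K} = {z. half_open_hit t (\<lambda>s. z + ?w s)}"
      using half_open_hit_iff[OF t c] by simp
    then have "measure lebesgue {z. \<exists>s\<in>{0..<t}. z + ?w s \<in> K} = measure lborel {z. half_open_hit t (\<lambda>s. z + ?w s)}"
      using S by (simp add: measure_completion)
    also have "\<dots> = enn2real (vol (half_open_hit t) ?w)"
    proof -
      have "vol (half_open_hit t) ?w = (\<integral>\<^sup>+z. indicator {z. half_open_hit t (\<lambda>s. z + ?w s)} z \<partial>lborel)"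
        unfolding vol_def by (intro nn_integral_cong) (simp add: indicator_def)
      also have "\<dots> = emeasure lborel {z. half_open_hit t (\<lambda>s. z + ?w s)}" using S by simp
      finally show ?thesis by (simp add: measure_def)
    qed
    also have "vol (half_open_hit t) ?w = ?V \<omega>" by (intro vol_cong path_event_half_open_hit) auto
    finally show "measure lebesgue {z. \<exists>s\<in>{0..<t}. z + ?w s \<in> K} = enn2real (?V \<omega>)" .
  qed
  also have "\<dots> = enn2real (\<integral>\<^sup>+\<omega>. ennreal (enn2real (?V \<omega>)) \<partial>M)"
    using m by (intro integral_eq_nn_integral) auto
  also have "(\<integral>\<^sup>+\<omega>. ennreal (enn2real (?V \<omega>)) \<partial>M) = sausage_mean t x"
    unfolding sausage_mean_def
  proof (rule nn_integral_cong_AE)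
    have "AE \<omega> in M. ?V \<omega> \<noteq> \<infinity>"
      using nn_integral_PInf_AE[OF m] fin by (simp add: sausage_mean_def less_top)
    then show "AE \<omega> in M. ennreal (enn2real (?V \<omega>)) = ?V \<omega>"
      by eventually_elim (simp add: ennreal_enn2real_if)
  qed
  finally show ?thesis .
qed

theorem sausage_asymptotics:
  assumes c: "0 < capacity" and \<epsilon>: "0 < \<epsilon>"
  shows "\<exists>T>0. \<exists>\<delta>>0. \<forall>t x. t \<ge> T \<longrightarrow> norm x / t < \<delta> \<longrightarrow>
    \<bar>(\<integral>\<omega>. measure lebesgue {z. \<exists>s\<in>{0..<t}. z + brownian_bridge B t x s \<omega> \<in> K} \<partial>M) / (capacity * t) - 1\<bar> < \<epsilon>"
proof -
  \<comment> \<open>Two errors of size \<open>e\<close> arise, one from the bridge volume and one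
    from the final time; dividing by \<open>4\<close> instead of \<open>2\<close> makes the
    resulting inequality strict.\<close>
  define e where "e = \<epsilon> * capacity / 4"
  have e: "0 < e" using c \<epsilon> by (simp add: e_def)
  obtain T0 \<delta> where T0: "0 < T0" and \<delta>: "0 < \<delta>" and as: "\<And>t x. T0 \<le> t \<Longrightarrow> norm x / t < \<delta> \<Longrightarrow>
      bridge_volume t x < \<infinity> \<and> \<bar>enn2real (bridge_volume t x) / t - capacity\<bar> \<le> e"
    using bridge_volume_asymptotics[OF visit_rate_tendsto e] unfolding capacity_def by blast
  define k where "k = measure lborel K"
  have "emeasure lborel K \<noteq> \<infinity>" using emeasure_compact_finite[OF compact_K] by simp
  then have k: "emeasure lborel K = ennreal k" "0 \<le> k" by (simp_all add: k_def emeasure_eq_ennreal_measure)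
  \<comment> \<open>Beyond \<open>k / e\<close> the volume of \<open>K\<close> is at most
    \<open>e * t\<close>.\<close>
  define T where "T = max T0 (k / e)"
  have main: "\<bar>(\<integral>\<omega>. measure lebesgue {z. \<exists>s\<in>{0..<t}. z + brownian_bridge B t x s \<omega> \<in> K} \<partial>M) / (capacity * t) - 1\<bar> < \<epsilon>"
    if t: "T \<le> t" and x: "norm x / t < \<delta>" for t x
  proof -
    have t0: "0 < t" "T0 \<le> t" "k / e \<le> t" using t T0 by (auto simp: T_def)
    define V where "V = enn2real (bridge_volume t x)"
    define S where "S = enn2real (sausage_mean t x)"
    have Vf: "bridge_volume t x = ennreal V" and Vc: "\<bar>V / t - capacity\<bar> \<le> e"
      using as[OF t0(2) x] by (auto simp: V_def ennreal_enn2real_if)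
    have Sfin: "sausage_mean t x < \<infinity>"
      using sausage_mean_bounds(1)[OF t0(1), of x] Vf by (metis ennreal_less_top infinity_ennreal_def order_le_less_trans)
    then have Sf: "sausage_mean t x = ennreal S" by (simp add: S_def ennreal_enn2real_if)
    have S0: "0 \<le> S" and V0: "0 \<le> V" by (simp_all add: S_def V_def)
    have Sk: "0 \<le> S + k" using S0 k by simp
    have a: "ennreal S \<le> ennreal V" using sausage_mean_bounds(1)[OF t0(1), of x] unfolding Vf Sf .
    have b: "ennreal V \<le> ennreal (S + k)"
      using sausage_mean_bounds(2)[OF t0(1), of x] S0 k unfolding Vf Sf by (simp add: ennreal_plus)
    have SV: "S \<le> V" by (rule iffD1[OF ennreal_le_iff[OF V0] a])
    have VS: "V \<le> S + k" by (rule iffD1[OF ennreal_le_iff[OF Sk] b])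
    have "k \<le> e * t" using t0(3) e by (simp add: pos_divide_le_eq mult.commute)
    then have "V - e * t \<le> S" using VS by linarith
    then have "(V - e * t) / t \<le> S / t" using t0 by (intro divide_right_mono) auto
    then have "V / t - e \<le> S / t" using t0 by (simp add: diff_divide_distrib)
    moreover have "S / t \<le> V / t" using SV t0 by (intro divide_right_mono) auto
    ultimately have "\<bar>S / t - capacity\<bar> \<le> 2 * e" using Vc by linarith
    then have "\<bar>S / t - capacity\<bar> < \<epsilon> * capacity" using e unfolding e_def by linarith
    moreover have "S / (capacity * t) - 1 = (S / t - capacity) / capacity" using c t0 by (simp add: field_simps)
    ultimately have "\<bar>S / (capacity * t) - 1\<bar> < \<epsilon>" using c by (simp add: abs_divide pos_divide_less_eq)
    then show ?thesis using integral_sausage[OF t0(1) Sfin] by (simp add: S_def)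
  qed
  have "0 < T" using T0 by (simp add: T_def)
  with main \<delta> show ?thesis by blast
qed

end

theorem theorem4p1:
  fixes M :: "'w measure" and B :: "real \<Rightarrow> 'w \<Rightarrow> 'a::euclidean_space"
    and K :: "'a set" and R :: real
  assumes "DIM('a) \<ge> 3"
    and "standard_brownian_motion M B"
    and "compact K"
    and "nonpolar M B K"
    and "K \<subseteq> ball 0 R"
    and "UNIV - Omega M B R K = regular_points M B K"
  shows "\<forall>\<epsilon>>0. \<exists>T>0. \<exists>\<delta>>0. \<forall>t x. t \<ge> T \<longrightarrow> norm x / t < \<delta> \<longrightarrow>
    \<bar>bridge_expectation M B t x (\<lambda>w. measure lebesgue (wiener_sausage K t w))
        / (Cap M B K * t) - 1\<bar> < \<epsilon>"
proof (intro allI impI)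
  fix \<epsilon> :: real assume \<epsilon>: "0 < \<epsilon>"
  let ?B = "\<lambda>t \<omega>. - B t \<omega>"
  \<comment> \<open>The infimum of the empty set is \<open>\<infinity>\<close>, so the empty set is
    polar.\<close>
  have "K \<noteq> {}"
  proof
    assume "K = {}"
    then have "hitting_time K w = \<infinity>" for w :: "real \<Rightarrow> 'a" by (simp add: hitting_time_def top_ereal_def)
    then show False using assms(4) by (simp add: nonpolar_def prob_from_def)
  qed
  then interpret P: brownian_motion_and_compact M B K R
    using assms by (intro brownian_motion_and_compact.intro brownian_motion_and_compact_axioms.intro)
  interpret N: brownian_motion_and_compact M ?B K R
    using assms \<open>K \<noteq> {}\<close>
    by (intro brownian_motion_and_compact.intro brownian_motion_and_compact_axioms.intro standard_brownian_motion_minus)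
  have law: "distr M path_space (traj B) = distr M path_space (traj ?B)"
    by (rule standard_brownian_motion_law_unique[OF assms(2) standard_brownian_motion_minus[OF assms(2)]])
  \<comment> \<open>For each motion the capacity is the limit of its \<open>visit_rate\<close>, so
    equality of laws passes to the capacities without comparing hitting probabilities.\<close>
  have rate: "P.visit_rate = N.visit_rate"
  proof
    fix m
    have v: "vol (P.fresh_visit m) \<in> borel_measurable path_space"
      by (intro vol_measurable local_event_path_event[OF P.local_fresh_visit])
    have "(\<integral>\<^sup>+\<omega>. vol (P.fresh_visit m) (traj B \<omega>) \<partial>M) = (\<integral>\<^sup>+w. vol (P.fresh_visit m) w \<partial>distr M path_space (traj B))"
      using v by (subst nn_integral_distr) (auto intro: measurable_traj P.measurable_BM)
    also have "\<dots> = (\<integral>\<^sup>+\<omega>. vol (P.fresh_visit m) (traj ?B \<omega>) \<partial>M)"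
      unfolding law using v by (subst nn_integral_distr) (auto intro!: measurable_traj P.measurable_BM)
    finally show "P.visit_rate m = N.visit_rate m" unfolding P.visit_rate_def N.visit_rate_def by (rule arg_cong)
  qed
  have "P.capacity = N.capacity"
    unfolding P.capacity_def N.capacity_def
    by (rule LIMSEQ_unique[OF P.visit_rate_tendsto N.visit_rate_tendsto[folded rate]])
  then have cap: "Cap M B K = N.capacity" by (simp add: P.Cap_eq_capacity)
  have pos: "0 < N.capacity" using P.capacity_pos[OF assms(4)] P.Cap_eq_capacity cap by simp
  \<comment> \<open>The negated bridge to \<open>x\<close> is the bridge of the negated motion to
    \<open>- x\<close>, and the norm of the endpoint is unchanged.\<close>
  have neg: "wiener_sausage K t (\<lambda>s. brownian_bridge B t x s \<omega>) = {z. \<exists>s\<in>{0..<t}. z + brownian_bridge ?B t (- x) s \<omega> \<in> K}" for t x \<omega>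
  proof -
    have "brownian_bridge ?B t (- x) s \<omega> = - brownian_bridge B t x s \<omega>" for s
      by (simp add: brownian_bridge_def algebra_simps)
    then show ?thesis by (simp add: wiener_sausage_def)
  qed
  obtain T \<delta> where T: "0 < T" and \<delta>: "0 < \<delta>" and as: "\<And>t x. T \<le> t \<Longrightarrow> norm x / t < \<delta> \<Longrightarrow>
    \<bar>(\<integral>\<omega>. measure lebesgue {z. \<exists>s\<in>{0..<t}. z + brownian_bridge ?B t x s \<omega> \<in> K} \<partial>M) / (N.capacity * t) - 1\<bar> < \<epsilon>"
    using N.sausage_asymptotics[OF pos \<epsilon>] by blast
  have "\<bar>bridge_expectation M B t x (\<lambda>w. measure lebesgue (wiener_sausage K t w)) / (Cap M B K * t) - 1\<bar> < \<epsilon>"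
    if "T \<le> t" "norm x / t < \<delta>" for t x
    using as[of t "- x"] that unfolding bridge_expectation_def neg cap by simp
  then show "\<exists>T>0. \<exists>\<delta>>0. \<forall>t x. t \<ge> T \<longrightarrow> norm x / t < \<delta> \<longrightarrow>
    \<bar>bridge_expectation M B t x (\<lambda>w. measure lebesgue (wiener_sausage K t w)) / (Cap M B K * t) - 1\<bar> < \<epsilon>"
    using T \<delta> by blast
qed

end
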